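(* Let $1/4<H<1$, $T>0$, let $b,\sigma$ satisfy the standing assumption (A) of the context, and let $\bar X$ solve $\bar X_t'=b_t(\bar X_t)$, $\bar X_0=x_0$ on $[0,T]$. Suppose that $\nabla(\nabla\cdot b_t)(\bar X_t)=0$ for all $t\in[0,T]$. Then there exists $\epsilon_*>0$ such that, for every $0<\epsilon<\epsilon_*$, the path $\bar X$ is the unique global minimizer of $J_\epsilon$ over $x_0+\mathcal H_H^\sigma([0,T];\mathbb R^n)$. Consequently, it is also the unique global minimizer of $J_\epsilon$ over $\mathcal H^{\sigma,T}_{H;x_0,x_T}$, where $x_T=\bar X_T$.
   Context: Standing assumption (A): $b\in C_b^{1,3}([0,T]\times\mathbb R^n;\mathbb R^n)$ (bounded, with bounded continuous derivatives up to order one in $t$ and order three in $x$); $\sigma_t=\operatorname{diag}(\sigma_t^1,\dots,\sigma_t^n)$ with $\sigma^i\in C^1([0,T])$ and $0<m_i\le\sigma_t^i\le M_i$. $\nabla,\nabla\cdot$ act in the space variable. Kernel, for $0<s<t$: $K_H(t,s)=c_H\left[(t/s)^{H-\frac12}(t-s)^{H-\frac12}-(H-\frac12)s^{\frac12-H}\int_s^tu^{H-\frac32}(u-s)^{H-\frac12}du\right]$, $c_H=\sqrt{\frac{2H\Gamma(3/2-H)}{\Gamma(H+1/2)\Gamma(2-2H)}}$. For $u\in L^2([0,T];\mathbb R^n)$: $(K_Hu)(t)=\int_0^tK_H(t,s)u(s)ds$, $(K_H^\sigma u)(t)=\int_0^t\sigma_s\,d(K_Hu)(s)$ (Young integral).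 $K_H^\sigma$ is injective; $\mathcal H_H^\sigma([0,T];\mathbb R^n):=K_H^\sigma(L^2)$. $d_H=\sqrt{2H\Gamma(H+\frac12)\Gamma(\frac32-H)/\Gamma(2-2H)}$. For $\phi\in x_0+\mathcal H_H^\sigma([0,T];\mathbb R^n)$, $$J_\epsilon(\phi)=\frac1{2\epsilon}\int_0^T\left|(K_H^\sigma)^{-1}\left(\phi_\cdot-x_0-\int_0^\cdot b_s(\phi_s)ds\right)(t)\right|^2dt+\frac{d_H}2\int_0^T\nabla\cdot b_t(\phi_t)\,dt .$$ $\mathcal H^{\sigma,T}_{H;x_0,x_T}=\{\phi\in x_0+\mathcal H_H^\sigma([0,T];\mathbb R^n):\phi_T=x_T\}$. *)

theory Defs
  imports "HOL-Analysis.Analysis"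
begin

section \<open>The coefficients\<close>

definition Cb_joint :: "real \<Rightarrow> (real \<Rightarrow> real^'n \<Rightarrow> real^'n) \<Rightarrow> bool" where
  "Cb_joint T f \<longleftrightarrow>
     continuous_on ({0..T} \<times> UNIV) (\<lambda>(t, x). f t x) \<and>
     bounded ((\<lambda>(t, x). f t x) ` ({0..T} \<times> UNIV))"

text \<open>Spatial regularity of order \<open>k\<close> on \<open>[0,T] \<times> \<real>\<^sup>n\<close>: all iterated partial derivatives in the
  space variable of order at most \<open>k\<close> exist and are bounded and jointly continuous.\<close>

primrec Cb_space :: "nat \<Rightarrow> real \<Rightarrow> (real \<Rightarrow> real^'n \<Rightarrow> real^'n) \<Rightarrow> bool" where
  "Cb_space 0 = Cb_joint"
| "Cb_space (Suc k) = (\<lambda>T f.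
     Cb_joint T f \<and>
     (\<forall>t\<in>{0..T}. \<forall>x. f t differentiable (at x)) \<and>
     (\<forall>i. Cb_space k T (\<lambda>t x. frechet_derivative (f t) (at x) (axis i 1))))"

text \<open>No mixed space-time derivatives are required; at \<open>0\<close> and \<open>T\<close> the time derivative is
  one-sided.\<close>

definition Cb_1_3 :: "real \<Rightarrow> (real \<Rightarrow> real^'n \<Rightarrow> real^'n) \<Rightarrow> bool" where
  "Cb_1_3 T b \<longleftrightarrow>
     Cb_space 3 T b \<and>
     (\<exists>b'. (\<forall>t\<in>{0..T}. \<forall>x. ((\<lambda>s. b s x) has_vector_derivative b' t x) (at t within {0..T})) \<and>
           Cb_joint T b')"

definition C1_on_interval :: "real \<Rightarrow> (real \<Rightarrow> real) \<Rightarrow> bool" where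
  "C1_on_interval T f \<longleftrightarrow>
     (\<exists>f'. (\<forall>t\<in>{0..T}. (f has_real_derivative f' t) (at t within {0..T})) \<and>
           continuous_on {0..T} f')"

text \<open>The diffusion coefficient is given by the vector \<open>\<sigma> t\<close> of its diagonal entries; it enters the
  equations through the matrix \<open>diag_mat (\<sigma> t)\<close>.\<close>

definition diag_mat :: "real^'n \<Rightarrow> real^'n^'n" where
  "diag_mat v = (\<chi> i j. if i = j then v $ i else 0)"

definition assumption_A ::
  "real \<Rightarrow> (real \<Rightarrow> real^'n \<Rightarrow> real^'n) \<Rightarrow> (real \<Rightarrow> real^'n) \<Rightarrow> bool" where
  "assumption_A T b \<sigma> \<longleftrightarrow>
     Cb_1_3 T b \<and>
     (\<forall>i. C1_on_interval T (\<lambda>t. \<sigma> t $ i)) \<and>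
     (\<exists>m M :: 'n \<Rightarrow> real. \<forall>i. 0 < m i \<and> (\<forall>t\<in>{0..T}. m i \<le> \<sigma> t $ i \<and> \<sigma> t $ i \<le> M i))"

definition divergence :: "(real^'n \<Rightarrow> real^'n) \<Rightarrow> real^'n \<Rightarrow> real" where
  "divergence f x = (\<Sum>i\<in>UNIV. frechet_derivative f (at x) (axis i 1) $ i)"


section \<open>The Young integral\<close>

text \<open>\<open>\<integral>\<^sub>a\<^sup>b A dg\<close> is the limit of the Riemann--Stieltjes sums, with arbitrary tags, as the mesh of
  the partition tends to zero.\<close>

definition has_young_integral ::
  "(real \<Rightarrow> real^'n^'n) \<Rightarrow> (real \<Rightarrow> real^'n) \<Rightarrow> real \<Rightarrow> real \<Rightarrow> real^'n \<Rightarrow> bool" where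
  "has_young_integral A g a b I \<longleftrightarrow>
     (\<forall>e>0. \<exists>d>0. \<forall>p. p tagged_division_of {a..b} \<and> (\<lambda>x. ball x d) fine p \<longrightarrow>
        norm ((\<Sum>(x, K)\<in>p. A x *v (g (Sup K) - g (Inf K))) - I) < e)"

definition young_integral ::
  "(real \<Rightarrow> real^'n^'n) \<Rightarrow> (real \<Rightarrow> real^'n) \<Rightarrow> real \<Rightarrow> real \<Rightarrow> real^'n" where
  "young_integral A g a b = (THE I. has_young_integral A g a b I)"


section \<open>The Cameron--Martin space\<close>

definition c_const :: "real \<Rightarrow> real" where
  "c_const H = sqrt (2 * H * Gamma (3/2 - H) / (Gamma (H + 1/2) * Gamma (2 - 2 * H)))"

definition d_const :: "real \<Rightarrow> real" where
  "d_const H = sqrt (2 * H * Gamma (H + 1/2) * Gamma (3/2 - H) / Gamma (2 - 2 * H))"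

text \<open>Only the values for \<open>0 < s < t\<close> are meaningful.\<close>

definition K_kernel :: "real \<Rightarrow> real \<Rightarrow> real \<Rightarrow> real" where
  "K_kernel H t s =
     c_const H *
       ((t / s) powr (H - 1/2) * (t - s) powr (H - 1/2)
        - (H - 1/2) * s powr (1/2 - H) *
          (LINT u:{s..t}|lborel. u powr (H - 3/2) * (u - s) powr (H - 1/2)))"

definition L2 :: "real \<Rightarrow> (real \<Rightarrow> real^'n) set" where
  "L2 T = {u. set_borel_measurable lborel {0..T} u \<and>
              set_integrable lborel {0..T} (\<lambda>t. (norm (u t))\<^sup>2)}"

definition K_op :: "real \<Rightarrow> (real \<Rightarrow> real^'n) \<Rightarrow> real \<Rightarrow> real^'n" where
  "K_op H u t = (LINT s:{0..t}|lborel. K_kernel H t s *\<^sub>R u s)"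

definition K_sigma_op ::
  "real \<Rightarrow> (real \<Rightarrow> real^'n) \<Rightarrow> (real \<Rightarrow> real^'n) \<Rightarrow> real \<Rightarrow> real^'n" where
  "K_sigma_op H \<sigma> u t = young_integral (\<lambda>s. diag_mat (\<sigma> s)) (K_op H u) 0 t"

text \<open>Paths are total functions of which only the restriction to \<open>[0,T]\<close> matters, so membership
  and the inverse below refer to equality on \<open>[0,T]\<close>.\<close>

definition CM_space :: "real \<Rightarrow> real \<Rightarrow> (real \<Rightarrow> real^'n) \<Rightarrow> (real \<Rightarrow> real^'n) set" where
  "CM_space T H \<sigma> = {h. \<exists>u\<in>L2 T. \<forall>t\<in>{0..T}. h t = K_sigma_op H \<sigma> u t}"

text \<open>The preimage is unique up to null sets; the choice selects a representative of its class.\<close>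

definition K_sigma_inv ::
  "real \<Rightarrow> real \<Rightarrow> (real \<Rightarrow> real^'n) \<Rightarrow> (real \<Rightarrow> real^'n) \<Rightarrow> real \<Rightarrow> real^'n" where
  "K_sigma_inv T H \<sigma> h = (SOME u. u \<in> L2 T \<and> (\<forall>t\<in>{0..T}. h t = K_sigma_op H \<sigma> u t))"

definition affine_CM ::
  "real \<Rightarrow> real \<Rightarrow> (real \<Rightarrow> real^'n) \<Rightarrow> real^'n \<Rightarrow> (real \<Rightarrow> real^'n) set" where
  "affine_CM T H \<sigma> x0 = {\<phi>. (\<lambda>t. \<phi> t - x0) \<in> CM_space T H \<sigma>}"

definition affine_CM_bridge ::
  "real \<Rightarrow> real \<Rightarrow> (real \<Rightarrow> real^'n) \<Rightarrow> real^'n \<Rightarrow> real^'n \<Rightarrow> (real \<Rightarrow> real^'n) set" where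
  "affine_CM_bridge T H \<sigma> x0 xT = {\<phi> \<in> affine_CM T H \<sigma> x0. \<phi> T = xT}"


section \<open>The functional and its minimizers\<close>

definition J_functional ::
  "real \<Rightarrow> real \<Rightarrow> (real \<Rightarrow> real^'n \<Rightarrow> real^'n) \<Rightarrow> (real \<Rightarrow> real^'n) \<Rightarrow> real^'n \<Rightarrow> real
     \<Rightarrow> (real \<Rightarrow> real^'n) \<Rightarrow> real" where
  "J_functional T H b \<sigma> x0 \<epsilon> \<phi> =
     1 / (2 * \<epsilon>) *
       (LINT t:{0..T}|lborel.
          (norm (K_sigma_inv T H \<sigma> (\<lambda>t. \<phi> t - x0 - (LINT s:{0..t}|lborel. b s (\<phi> s))) t))\<^sup>2)
     + d_const H / 2 * (LINT t:{0..T}|lborel. divergence (b t) (\<phi> t))"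

text \<open>Uniqueness is uniqueness as a path on \<open>[0,T]\<close>.\<close>

definition unique_minimizer ::
  "real \<Rightarrow> ((real \<Rightarrow> real^'n) \<Rightarrow> real) \<Rightarrow> (real \<Rightarrow> real^'n) set \<Rightarrow> (real \<Rightarrow> real^'n) \<Rightarrow> bool" where
  "unique_minimizer T J S X \<longleftrightarrow>
     is_arg_min J (\<lambda>\<phi>. \<phi> \<in> S) X \<and>
     (\<forall>\<psi>. is_arg_min J (\<lambda>\<phi>. \<phi> \<in> S) \<psi> \<longrightarrow> (\<forall>t\<in>{0..T}. \<psi> t = X t))"

end

theory Submission
  imports Defs
begin

text \<open>Write \<open>a = H - 1/2\<close>. Exchanging integrals in the kernel turns \<open>K\<^sub>H u\<close> into
  \<open>c\<^sub>H (t\<^sup>a W(t) - a \<integral>\<^sub>0\<^sup>t r\<^sup>a\<^sup>-\<^sup>1 W(r) dr)\<close>, where \<open>W\<close> is the fractional integral of order \<open>a + 1\<close>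
  of \<open>s \<mapsto> s\<^sup>-\<^sup>a u(s)\<close>. Boundedness by the \<open>L\<^sup>2\<close> norm, continuity, injectivity and surjectivity
  onto the primitives of (for \<open>H > 1/2\<close>, 1/2-Hoelder) continuous functions all reduce to the Abel
  equation for \<open>W\<close>, and pass to \<open>K\<^sub>H\<^sup>\<sigma>\<close> by integration by parts in the Young integral.

  Surjectivity shows that every admissible path \<open>\<phi>\<close> solves \<open>\<phi> = x\<^sub>0 + \<integral> b(\<phi>) + K\<^sub>H\<^sup>\<sigma> u\<close> for some
  \<open>u\<close>, and injectivity that the first term of \<open>J\<^sub>\<epsilon>\<close> equals \<open>\<parallel>u\<parallel>\<^sup>2 / (2\<epsilon>)\<close>. Gronwall's lemma gives
  \<open>\<bar>\<phi> - X\<bar> \<le> C \<parallel>u\<parallel>\<close>. Since \<open>X\<^sub>t\<close> is a critical point of the divergence of \<open>b\<^sub>t\<close>, the second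
  term of \<open>J\<^sub>\<epsilon>\<close> changes by at most \<open>D \<parallel>u\<parallel>\<^sup>2\<close>, so that
  \<open>J\<^sub>\<epsilon>(\<phi>) - J\<^sub>\<epsilon>(X) \<ge> (1/(2\<epsilon>) - D) \<parallel>u\<parallel>\<^sup>2\<close>.\<close>

section \<open>Fubini on a triangle and fractional integrals\<close>

text \<open>The range has to be known before the energy can be read at all:
  \<open>K_sigma_inv\<close> is a choice, and its value means something only if the residual of a
  path is an image. This asks for a class of paths whose drift integrals lie in the range. For
  \<open>a < 0\<close> solving the Abel equation is a fractional integration of order
  \<open>- a\<close>, and bounded densities suffice. For \<open>a > 0\<close> it is a fractional
  differentiation of order \<open>a < 1/2\<close>, which 1/2-Hoelder densities allow. Images of the
  operator are 1/2-Hoelder, and \<open>b\<close> along such a path is 1/2-Hoelder again, so the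
  class is closed; the one exponent 1/2 serves every \<open>H > 1/2\<close>. The other obstacle is
  the singular weight at 0. Every bound on \<open>W_frac\<close> carries the factor
  \<open>sqrt t\<close> dictated by scaling: it makes
  \<open>r powr (a - 1) *\<^sub>R W_frac a u r\<close> integrable, and it is the rate that the
  contraction behind injectivity preserves. Injectivity acts at \<open>X\<close>: the preimage
  chosen for the residual 0 must have energy 0. For any other path the chosen preimage itself
  supplies the energy.\<close>

lemma triangle_Fubini:
  fixes k :: "real \<Rightarrow> real \<Rightarrow> 'a::{banach, second_countable_topology}"
  assumes int: "integrable (lborel \<Otimes>\<^sub>M lborel)
      (\<lambda>(s, r). indicator {0..t} r *\<^sub>R indicator {0..r} s *\<^sub>R k s r)"
  shows "set_integrable lborel {0..t} (\<lambda>r. LINT s:{0..r}|lborel. k s r)"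
    and "set_integrable lborel {0..t} (\<lambda>s. LINT r:{s..t}|lborel. k s r)"
    and "(LINT r:{0..t}|lborel. LINT s:{0..r}|lborel. k s r)
           = (LINT s:{0..t}|lborel. LINT r:{s..t}|lborel. k s r)"
    and "AE r in lborel. r \<in> {0..t} \<longrightarrow> set_integrable lborel {0..r} (\<lambda>s. k s r)"
    and "(LINT r:{0..t}|lborel. LINT s:{0..r}|lborel. k s r)
           = integral\<^sup>L (lborel \<Otimes>\<^sub>M lborel) (\<lambda>(s, r). indicator {0..t} r *\<^sub>R indicator {0..r} s *\<^sub>R k s r)"
proof -
  define f where "f s r = indicator {0..t} r *\<^sub>R indicator {0..r} s *\<^sub>R k s r" for s r
  have f1: "f s r = indicator {0..t} r *\<^sub>R (indicator {0..r} s *\<^sub>R k s r)" for s r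
    by (simp add: f_def)
  have f2: "f s r = indicator {0..t} s *\<^sub>R (indicator {s..t} r *\<^sub>R k s r)" for s r
    by (auto simp: f_def indicator_def)
  have i1: "integrable (lborel \<Otimes>\<^sub>M lborel) (\<lambda>(s, r). f s r)"
    using int unfolding f_def .
  have i2: "integrable (lborel \<Otimes>\<^sub>M lborel) (\<lambda>(r, s). f s r)"
    using lborel_pair.integrable_product_swap[OF i1] by (simp add: case_prod_unfold)
  have A: "integrable lborel (\<lambda>s. LINT r|lborel. f s r)"
    using lborel_pair.integrable_fst'[OF i1] by simp
  have B: "integrable lborel (\<lambda>r. LINT s|lborel. f s r)"
    using lborel_pair.integrable_fst'[OF i2] by simp
  show "set_integrable lborel {0..t} (\<lambda>r. LINT s:{0..r}|lborel. k s r)"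
    using B unfolding set_integrable_def set_lebesgue_integral_def f1 by (simp del: scaleR_scaleR)
  show "set_integrable lborel {0..t} (\<lambda>s. LINT r:{s..t}|lborel. k s r)"
    using A unfolding set_integrable_def set_lebesgue_integral_def f2 by (simp del: scaleR_scaleR)
  have eq1: "(LINT r|lborel. LINT s|lborel. f s r) = (LINT s|lborel. LINT r|lborel. f s r)"
    using lborel_pair.Fubini_integral[OF i1] by simp
  have eq2: "(LINT r|lborel. LINT s|lborel. f s r) = (LINT r:{0..t}|lborel. LINT s:{0..r}|lborel. k s r)"
    unfolding set_lebesgue_integral_def f1 by (simp del: scaleR_scaleR)
  have eq3: "(LINT s|lborel. LINT r|lborel. f s r) = (LINT s:{0..t}|lborel. LINT r:{s..t}|lborel. k s r)"
    unfolding set_lebesgue_integral_def f2 by (simp del: scaleR_scaleR)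
  from eq1 eq2 eq3 show "(LINT r:{0..t}|lborel. LINT s:{0..r}|lborel. k s r)
           = (LINT s:{0..t}|lborel. LINT r:{s..t}|lborel. k s r)" by simp
  have "AE r in lborel. integrable lborel (\<lambda>s. f s r)"
    using lborel_pair.AE_integrable_fst'[OF i2] by simp
  then show "AE r in lborel. r \<in> {0..t} \<longrightarrow> set_integrable lborel {0..r} (\<lambda>s. k s r)"
    by eventually_elim (auto simp: set_integrable_def f_def)
  have "(LINT s|lborel. LINT r|lborel. f s r) = integral\<^sup>L (lborel \<Otimes>\<^sub>M lborel) (\<lambda>(s, r). f s r)"
    using lborel_pair.integral_fst'[OF i1] by simp
  then show "(LINT r:{0..t}|lborel. LINT s:{0..r}|lborel. k s r)
      = integral\<^sup>L (lborel \<Otimes>\<^sub>M lborel) (\<lambda>(s, r). indicator {0..t} r *\<^sub>R indicator {0..r} s *\<^sub>R k s r)"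
    using eq1 eq2 eq3 unfolding f_def by simp
qed

lemma set_integrable_nn_finite:
  fixes \<beta> :: "real \<Rightarrow> real"
  assumes "set_integrable lborel A \<beta>"
  shows "(\<integral>\<^sup>+s\<in>A. ennreal (\<beta> s) \<partial>lborel) < \<infinity>"
proof -
  have "(\<integral>\<^sup>+s\<in>A. ennreal (\<beta> s) \<partial>lborel) \<le> (\<integral>\<^sup>+s. ennreal (norm (indicator A s *\<^sub>R \<beta> s)) \<partial>lborel)"
    by (intro nn_integral_mono) (auto simp: indicator_def intro!: ennreal_leI)
  also have "\<dots> < \<infinity>"
    using assms unfolding set_integrable_def integrable_iff_bounded by simp
  finally show ?thesis .
qed

text \<open>Tonelli with the smaller variable \<open>s\<close> outermost. The bound is asked only
  for \<open>0 < s < t\<close>, because the power weights fed in below are singular or take default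
  values at the end points, which form a null set.\<close>

lemma triangle_integrable_fstI:
  fixes k :: "real \<Rightarrow> real \<Rightarrow> 'a::{banach, second_countable_topology}"
  assumes [measurable]: "(\<lambda>(s, r). k s r) \<in> borel_measurable (borel \<Otimes>\<^sub>M borel)"
    and bd: "\<And>s. 0 < s \<Longrightarrow> s < t \<Longrightarrow> (\<integral>\<^sup>+r\<in>{s..t}. ennreal (norm (k s r)) \<partial>lborel) \<le> ennreal (\<beta> s)"
    and \<beta>: "set_integrable lborel {0..t} \<beta>"
  shows "integrable (lborel \<Otimes>\<^sub>M lborel)
      (\<lambda>(s, r). indicator {0..t} r *\<^sub>R indicator {0..r} s *\<^sub>R k s r)"
proof (rule integrableI_bounded)
  let ?f = "\<lambda>(s, r). indicator {0..t} r *\<^sub>R indicator {0..r} s *\<^sub>R k s r"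
  have eq: "?f = (\<lambda>(s, r). (if 0 \<le> s \<and> s \<le> r \<and> r \<le> t then 1 else 0) *\<^sub>R k s r)"
    by (auto simp: fun_eq_iff indicator_def)
  show meas: "?f \<in> borel_measurable (lborel \<Otimes>\<^sub>M lborel)"
    unfolding eq by measurable
  have "(\<integral>\<^sup>+x. ennreal (norm (?f x)) \<partial>(lborel \<Otimes>\<^sub>M lborel))
      = (\<integral>\<^sup>+s. \<integral>\<^sup>+r. ennreal (norm (?f (s, r))) \<partial>lborel \<partial>lborel)"
    by (rule lborel.nn_integral_fst[symmetric]) (use meas in measurable)
  also have "\<dots> \<le> (\<integral>\<^sup>+s\<in>{0..t}. ennreal (\<beta> s) \<partial>lborel)"
  proof (rule nn_integral_mono_AE)
    have "AE s in lborel. s \<noteq> 0 \<and> s \<noteq> t"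
      using AE_lborel_singleton[of 0] AE_lborel_singleton[of t] by eventually_elim simp
    then show "AE s in lborel. (\<integral>\<^sup>+r. ennreal (norm (?f (s, r))) \<partial>lborel) \<le> ennreal (\<beta> s) * indicator {0..t} s"
    proof eventually_elim
      fix s assume s: "s \<noteq> 0 \<and> s \<noteq> t"
      show "(\<integral>\<^sup>+r. ennreal (norm (?f (s, r))) \<partial>lborel) \<le> ennreal (\<beta> s) * indicator {0..t} s"
      proof (cases "0 < s \<and> s < t")
        case True
        then have "(\<integral>\<^sup>+r. ennreal (norm (?f (s, r))) \<partial>lborel) = (\<integral>\<^sup>+r\<in>{s..t}. ennreal (norm (k s r)) \<partial>lborel)"
          by (intro nn_integral_cong) (auto simp: indicator_def)
        then show ?thesis using bd[of s] True by (simp add: indicator_def)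
      next
        case False
        with s have "s < 0 \<or> s > t" by auto
        then have z: "?f (s, r) = 0" for r
          by (auto simp: indicator_def)
        show ?thesis unfolding z by simp
      qed
    qed
  qed
  also have "\<dots> < \<infinity>"
    by (rule set_integrable_nn_finite[OF \<beta>])
  finally show "(\<integral>\<^sup>+x. ennreal (norm (?f x)) \<partial>(lborel \<Otimes>\<^sub>M lborel)) < \<infinity>" .
qed

text \<open>The companion with the larger variable outermost, for kernels whose integral over the
  smaller variable is the one that can be estimated, by Cauchy--Schwarz or by Hoelder
  continuity.\<close>

lemma triangle_integrable_sndI:
  fixes k :: "real \<Rightarrow> real \<Rightarrow> 'a::{banach, second_countable_topology}"
  assumes [measurable]: "(\<lambda>(s, r). k s r) \<in> borel_measurable (borel \<Otimes>\<^sub>M borel)"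
    and bd: "\<And>r. 0 < r \<Longrightarrow> r < t \<Longrightarrow> (\<integral>\<^sup>+s\<in>{0..r}. ennreal (norm (k s r)) \<partial>lborel) \<le> ennreal (\<beta> r)"
    and \<beta>: "set_integrable lborel {0..t} \<beta>"
  shows "integrable (lborel \<Otimes>\<^sub>M lborel)
      (\<lambda>(s, r). indicator {0..t} r *\<^sub>R indicator {0..r} s *\<^sub>R k s r)"
proof (rule integrableI_bounded)
  let ?f = "\<lambda>(s, r). indicator {0..t} r *\<^sub>R indicator {0..r} s *\<^sub>R k s r"
  have eq: "?f = (\<lambda>(s, r). (if 0 \<le> s \<and> s \<le> r \<and> r \<le> t then 1 else 0) *\<^sub>R k s r)"
    by (auto simp: fun_eq_iff indicator_def)
  show meas: "?f \<in> borel_measurable (lborel \<Otimes>\<^sub>M lborel)"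
    unfolding eq by measurable
  have "(\<integral>\<^sup>+x. ennreal (norm (?f x)) \<partial>(lborel \<Otimes>\<^sub>M lborel))
      = (\<integral>\<^sup>+r. \<integral>\<^sup>+s. ennreal (norm (?f (s, r))) \<partial>lborel \<partial>lborel)"
    by (rule lborel_pair.nn_integral_snd[symmetric]) (use meas in measurable)
  also have "\<dots> \<le> (\<integral>\<^sup>+r\<in>{0..t}. ennreal (\<beta> r) \<partial>lborel)"
  proof (rule nn_integral_mono_AE)
    have "AE r in lborel. r \<noteq> 0 \<and> r \<noteq> t"
      using AE_lborel_singleton[of 0] AE_lborel_singleton[of t] by eventually_elim simp
    then show "AE r in lborel. (\<integral>\<^sup>+s. ennreal (norm (?f (s, r))) \<partial>lborel) \<le> ennreal (\<beta> r) * indicator {0..t} r"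
    proof eventually_elim
      fix r assume r: "r \<noteq> 0 \<and> r \<noteq> t"
      show "(\<integral>\<^sup>+s. ennreal (norm (?f (s, r))) \<partial>lborel) \<le> ennreal (\<beta> r) * indicator {0..t} r"
      proof (cases "0 < r \<and> r < t")
        case True
        then have "(\<integral>\<^sup>+s. ennreal (norm (?f (s, r))) \<partial>lborel) = (\<integral>\<^sup>+s\<in>{0..r}. ennreal (norm (k s r)) \<partial>lborel)"
          by (intro nn_integral_cong) (auto simp: indicator_def)
        then show ?thesis using bd[of r] True by (simp add: indicator_def)
      next
        case False
        with r have "r < 0 \<or> r > t" by auto
        then have z: "?f (s, r) = 0" for s
          by (auto simp: indicator_def)
        show ?thesis unfolding z by simp
      qed
    qed
  qed
  also have "\<dots> < \<infinity>"
    by (rule set_integrable_nn_finite[OF \<beta>])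
  finally show "(\<integral>\<^sup>+x. ennreal (norm (?f x)) \<partial>(lborel \<Otimes>\<^sub>M lborel)) < \<infinity>" .
qed

section \<open>Beta integrals and norm estimates\<close>

lemma Beta_real_pos: "0 < p \<Longrightarrow> 0 < q \<Longrightarrow> 0 < Beta p (q::real)"
  by (simp add: Beta_def Gamma_real_pos)

lemma nn_integral_Beta_Icc:
  fixes p q s t :: real
  assumes "0 < p" "0 < q" "s \<le> t"
  shows "(\<integral>\<^sup>+r\<in>{s..t}. ennreal ((t - r) powr (p - 1) * (r - s) powr (q - 1)) \<partial>lborel)
           = ennreal (Beta p q * (t - s) powr (p + q - 1))"
proof (cases "s = t")
  \<comment> \<open>On a degenerate interval both sides are 0, since \<open>0 powr y = 0\<close> for
    every exponent \<open>y\<close>, negative ones included.\<close>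
  case True
  then have "(\<integral>\<^sup>+r\<in>{s..t}. ennreal ((t - r) powr (p - 1) * (r - s) powr (q - 1)) \<partial>lborel) = (\<integral>\<^sup>+r. 0 \<partial>(lborel::real measure))"
    by (intro nn_integral_cong) (auto simp: indicator_def)
  then show ?thesis using True by simp
next
  case False
  define L where "L = t - s"
  have L: "L > 0" using False assms by (simp add: L_def)
  have t: "t = s + L" by (simp add: L_def)
  let ?g = "\<lambda>x::real. indicator {0..1} x * (x powr (q - 1) * (1 - x) powr (p - 1))"
  have "(?g has_integral Beta q p) UNIV"
  proof -
    have "?g = (\<lambda>x. if x \<in> {0..1} then x powr (q - 1) * (1 - x) powr (p - 1) else 0)"
      by (auto simp: fun_eq_iff indicator_def)
    then show ?thesis
      using has_integral_Beta_real[OF assms(2,1)] by (simp only: has_integral_restrict_UNIV)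
  qed
  then have 1: "(\<integral>\<^sup>+x. ennreal (?g x) \<partial>lborel) = ennreal (Beta q p)"
    by (intro nn_integral_has_integral_lborel) (auto simp: indicator_def)
  have "(\<integral>\<^sup>+r\<in>{s..t}. ennreal ((t - r) powr (p - 1) * (r - s) powr (q - 1)) \<partial>lborel)
     = \<bar>L\<bar> * (\<integral>\<^sup>+x. ennreal ((t - (s + L * x)) powr (p - 1) * ((s + L * x) - s) powr (q - 1)) * indicator {s..t} (s + L * x) \<partial>lborel)"
    using L by (intro nn_integral_real_affine) auto
  also have "(\<integral>\<^sup>+x. ennreal ((t - (s + L * x)) powr (p - 1) * ((s + L * x) - s) powr (q - 1)) * indicator {s..t} (s + L * x) \<partial>lborel)
     = (\<integral>\<^sup>+x. ennreal (L powr (p + q - 2)) * ennreal (?g x) \<partial>lborel)"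
  proof (intro nn_integral_cong)
    fix x :: real
    have ind: "indicator {s..t} (s + L * x) = (indicator {0..1} x :: ennreal)"
      using L by (auto simp: indicator_def t mult_le_cancel_left1 zero_le_mult_iff)
    have "(t - (s + L * x)) powr (p - 1) * ((s + L * x) - s) powr (q - 1) = L powr (p + q - 2) * ?g x" if "0 \<le> x" "x \<le> 1"
    proof -
      have "t - (s + L * x) = L * (1 - x)" by (simp add: t algebra_simps)
      moreover have "L powr (p - 1) * L powr (q - 1) = L powr (p + q - 2)"
        by (simp add: powr_add[symmetric])
      ultimately show ?thesis using that L by (simp add: powr_mult mult_ac)
    qed
    then show "ennreal ((t - (s + L * x)) powr (p - 1) * ((s + L * x) - s) powr (q - 1)) * indicator {s..t} (s + L * x)
       = ennreal (L powr (p + q - 2)) * ennreal (?g x)"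
      unfolding ind by (auto simp: indicator_def ennreal_mult[symmetric])
  qed
  also have "\<dots> = ennreal (L powr (p + q - 2)) * ennreal (Beta q p)"
    using 1 by (subst nn_integral_cmult) auto
  also have "ennreal \<bar>L\<bar> * \<dots> = ennreal (L * L powr (p + q - 2) * Beta q p)"
    using L assms Beta_real_pos[of q p] by (simp add: ennreal_mult[symmetric] mult_ac)
  also have "L * L powr (p + q - 2) = L powr (p + q - 1)"
    using L by (simp add: powr_mult_base)
  finally show ?thesis by (simp add: L_def Beta_commute mult_ac)
qed

lemma Beta_Icc:
  fixes p q s t :: real
  assumes "0 < p" "0 < q" "s \<le> t"
  shows "set_integrable lborel {s..t} (\<lambda>r. (t - r) powr (p - 1) * (r - s) powr (q - 1))"
    and "(LINT r:{s..t}|lborel. (t - r) powr (p - 1) * (r - s) powr (q - 1)) = Beta p q * (t - s) powr (p + q - 1)"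
proof -
  let ?f = "\<lambda>r. indicator {s..t} r *\<^sub>R ((t - r) powr (p - 1) * (r - s) powr (q - 1))"
  have "(\<integral>\<^sup>+r. ennreal (?f r) \<partial>lborel) = ennreal (Beta p q * (t - s) powr (p + q - 1))"
    unfolding nn_integral_Beta_Icc[OF assms, symmetric]
    by (intro nn_integral_cong) (auto simp: indicator_def)
  moreover have "0 \<le> Beta p q * (t - s) powr (p + q - 1)"
    using Beta_real_pos[of p q] assms by simp
  ultimately have "has_bochner_integral lborel ?f (Beta p q * (t - s) powr (p + q - 1))"
    by (intro has_bochner_integral_nn_integral) (auto simp: indicator_def)
  then show "set_integrable lborel {s..t} (\<lambda>r. (t - r) powr (p - 1) * (r - s) powr (q - 1))"
    and "(LINT r:{s..t}|lborel. (t - r) powr (p - 1) * (r - s) powr (q - 1)) = Beta p q * (t - s) powr (p + q - 1)"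
    unfolding set_integrable_def set_lebesgue_integral_def has_bochner_integral_iff by auto
qed

text \<open>Passing through the nonnegative integral yields integrability and the norm bound from
  one inequality, also for \<open>g\<close> with values in a Banach space.\<close>

lemma set_integral_Cauchy_Schwarz:
  fixes f :: "real \<Rightarrow> real" and g :: "real \<Rightarrow> 'a::{banach, second_countable_topology}"
  assumes [measurable]: "f \<in> borel_measurable borel" "g \<in> borel_measurable borel" "A \<in> sets borel"
    and f: "set_integrable lborel A (\<lambda>x. (f x)\<^sup>2)"
    and g: "set_integrable lborel A (\<lambda>x. (norm (g x))\<^sup>2)"
  shows "set_integrable lborel A (\<lambda>x. f x *\<^sub>R g x)"
    and "norm (LINT x:A|lborel. f x *\<^sub>R g x)
          \<le> sqrt (LINT x:A|lborel. (f x)\<^sup>2) * sqrt (LINT x:A|lborel. (norm (g x))\<^sup>2)"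
proof -
  define P where "P = (LINT x:A|lborel. (f x)\<^sup>2)"
  define Q where "Q = (LINT x:A|lborel. (norm (g x))\<^sup>2)"
  have P0: "0 \<le> P" and Q0: "0 \<le> Q"
    unfolding P_def Q_def set_lebesgue_integral_def by (auto intro!: integral_nonneg_AE)
  let ?f = "\<lambda>x. ennreal (indicator A x * \<bar>f x\<bar>)" and ?g = "\<lambda>x. ennreal (indicator A x * norm (g x))"
  let ?h = "\<lambda>x. indicator A x *\<^sub>R (f x *\<^sub>R g x)"
  have fP: "(\<integral>\<^sup>+x. (?f x)\<^sup>2 \<partial>lborel) = ennreal P"
    unfolding P_def set_lebesgue_integral_def
    by (subst nn_integral_eq_integral[symmetric])
       (use f in \<open>auto simp: set_integrable_def indicator_def ennreal_power intro!: nn_integral_cong\<close>)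
  have gQ: "(\<integral>\<^sup>+x. (?g x)\<^sup>2 \<partial>lborel) = ennreal Q"
    unfolding Q_def set_lebesgue_integral_def
    by (subst nn_integral_eq_integral[symmetric])
       (use g in \<open>auto simp: set_integrable_def indicator_def ennreal_power intro!: nn_integral_cong\<close>)
  have "(\<integral>\<^sup>+x. ?f x * ?g x \<partial>lborel)\<^sup>2 \<le> ennreal P * ennreal Q"
    using Cauchy_Schwarz_nn_integral[of ?f lborel ?g] unfolding fP gQ by simp
  moreover have "(\<integral>\<^sup>+x. ?f x * ?g x \<partial>lborel) = (\<integral>\<^sup>+x. ennreal (norm (?h x)) \<partial>lborel)"
    by (intro nn_integral_cong) (auto simp: indicator_def ennreal_mult[symmetric])
  ultimately have le: "(\<integral>\<^sup>+x. ennreal (norm (?h x)) \<partial>lborel)\<^sup>2 \<le> ennreal (P * Q)"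
    using P0 Q0 by (simp add: ennreal_mult)
  then have "(\<integral>\<^sup>+x. ennreal (norm (?h x)) \<partial>lborel) \<noteq> \<infinity>"
    by (auto simp: power2_eq_square top_unique ennreal_mult_top)
  then obtain r where r: "0 \<le> r" "(\<integral>\<^sup>+x. ennreal (norm (?h x)) \<partial>lborel) = ennreal r"
    by (cases "\<integral>\<^sup>+x. ennreal (norm (?h x)) \<partial>lborel") auto
  show int: "set_integrable lborel A (\<lambda>x. f x *\<^sub>R g x)"
    unfolding set_integrable_def by (rule integrableI_bounded) (use r in auto)
  have "ennreal (norm (LINT x:A|lborel. f x *\<^sub>R g x)) \<le> ennreal r"
    unfolding r(2)[symmetric] set_lebesgue_integral_def
    by (rule integral_norm_bound_ennreal) (use int in \<open>simp add: set_integrable_def\<close>)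
  then have "norm (LINT x:A|lborel. f x *\<^sub>R g x) \<le> r" using r by simp
  also have "r\<^sup>2 \<le> P * Q"
    using le r P0 Q0 unfolding r(2) by (simp add: ennreal_power)
  then have "r \<le> sqrt (P * Q)" by (rule real_le_rsqrt)
  finally show "norm (LINT x:A|lborel. f x *\<^sub>R g x) \<le> sqrt P * sqrt Q"
    by (simp add: real_sqrt_mult)
qed

lemma set_integral_norm_bound:
  fixes f :: "real \<Rightarrow> 'a::{banach, second_countable_topology}"
  assumes "set_integrable lborel A f" "set_integrable lborel A g"
    and "\<And>x. x \<in> A \<Longrightarrow> norm (f x) \<le> g x"
  shows "norm (LINT x:A|lborel. f x) \<le> (LINT x:A|lborel. g x)"
proof -
  have "norm (LINT x:A|lborel. f x) \<le> (LINT x|lborel. norm (indicator A x *\<^sub>R f x))"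
    unfolding set_lebesgue_integral_def by (rule integral_norm_bound)
  also have "\<dots> \<le> (LINT x:A|lborel. g x)"
    unfolding set_lebesgue_integral_def
    by (rule integral_mono)
       (use assms integrable_norm[OF assms(1)[unfolded set_integrable_def]]
         in \<open>auto simp: set_integrable_def indicator_def split: if_splits\<close>)
  finally show ?thesis .
qed

text \<open>The Riemann--Liouville integral of order \<open>p\<close> without the factor \<open>1 / \<Gamma>(p)\<close>.\<close>

definition RL :: "real \<Rightarrow> (real \<Rightarrow> 'a::{banach, second_countable_topology}) \<Rightarrow> real \<Rightarrow> 'a" where
  "RL p F t = (LINT s:{0..t}|lborel. (t - s) powr (p - 1) *\<^sub>R F s)"

lemma RL_measurable [measurable]:
  assumes [measurable]: "F \<in> borel_measurable borel"
  shows "RL p F \<in> borel_measurable borel"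
proof -
  \<comment> \<open>The domain of integration moves with \<open>t\<close>; as a condition inside the
    integrand it leaves a jointly measurable function on a fixed domain.\<close>
  have "RL p F = (\<lambda>t. LINT s|lborel. (if 0 \<le> s \<and> s \<le> t then (t - s) powr (p - 1) else 0) *\<^sub>R F s)"
    unfolding RL_def set_lebesgue_integral_def
    by (intro ext Bochner_Integration.integral_cong) (auto simp: indicator_def)
  then show ?thesis by simp
qed

text \<open>Semigroup law of fractional integration. Exchanging the integrals leaves a Beta integral
  in the inner variable, and as \<open>RL\<close> is not normalised its value stays as a factor. The
  condition \<open>1 \<le> p + q\<close> bounds \<open>(t - s) powr (p + q - 1)\<close> by
  \<open>t powr (p + q - 1)\<close>, so integrability of \<open>F\<close> is enough and the law
  holds at every single \<open>t\<close>.\<close>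

lemma RL_RL:
  fixes F :: "real \<Rightarrow> 'a::{banach, second_countable_topology}"
  assumes [measurable]: "F \<in> borel_measurable borel"
    and p: "0 < p" and q: "0 < q" and pq: "1 \<le> p + q"
    and F: "set_integrable lborel {0..t} F"
  shows "set_integrable lborel {0..t} (\<lambda>r. (t - r) powr (p - 1) *\<^sub>R RL q F r)"
    and "RL p (RL q F) t = Beta p q *\<^sub>R RL (p + q) F t"
    and "AE r in lborel. r \<in> {0..t} \<longrightarrow> set_integrable lborel {0..r} (\<lambda>s. (t - r) powr (p - 1) *\<^sub>R (r - s) powr (q - 1) *\<^sub>R F s)"
proof -
  define k where "k s r = (t - r) powr (p - 1) *\<^sub>R (r - s) powr (q - 1) *\<^sub>R F s" for s r :: real
  have B: "0 < Beta p q" using p q by (rule Beta_real_pos)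
  have int: "integrable (lborel \<Otimes>\<^sub>M lborel)
      (\<lambda>(s, r). indicator {0..t} r *\<^sub>R indicator {0..r} s *\<^sub>R k s r)"
  proof (rule triangle_integrable_fstI)
    show "(\<lambda>(s, r). k s r) \<in> borel_measurable (borel \<Otimes>\<^sub>M borel)"
      unfolding k_def by measurable
    fix s assume s: "0 < s" "s < t"
    have "(\<integral>\<^sup>+r\<in>{s..t}. ennreal (norm (k s r)) \<partial>lborel)
       = (\<integral>\<^sup>+r. ennreal (norm (F s)) * (ennreal ((t - r) powr (p - 1) * (r - s) powr (q - 1)) * indicator {s..t} r) \<partial>lborel)"
      by (intro nn_integral_cong) (auto simp: k_def indicator_def ennreal_mult[symmetric] mult_ac)
    also have "\<dots> = ennreal (norm (F s)) * ennreal (Beta p q * (t - s) powr (p + q - 1))"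
      using nn_integral_Beta_Icc[OF p q, of s t] s by (subst nn_integral_cmult) auto
    also have "\<dots> = ennreal (norm (F s) * (Beta p q * (t - s) powr (p + q - 1)))"
      using B by (simp add: ennreal_mult)
    also have "\<dots> \<le> ennreal (Beta p q * t powr (p + q - 1) * norm (F s))"
    proof -
      have "(t - s) powr (p + q - 1) \<le> t powr (p + q - 1)"
        using s pq by (intro powr_mono2) auto
      then have "norm (F s) * (Beta p q * (t - s) powr (p + q - 1)) \<le> norm (F s) * (Beta p q * t powr (p + q - 1))"
        using B by (intro mult_left_mono) auto
      then show ?thesis by (intro ennreal_leI) (simp add: mult_ac)
    qed
    finally show "(\<integral>\<^sup>+r\<in>{s..t}. ennreal (norm (k s r)) \<partial>lborel) \<le> ennreal (Beta p q * t powr (p + q - 1) * norm (F s))" .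
  next
    have "set_integrable lborel {0..t} (\<lambda>s. norm (F s))"
      using F unfolding set_integrable_def by (drule_tac integrable_norm) (simp add: abs_mult)
    then show "set_integrable lborel {0..t} (\<lambda>s. Beta p q * t powr (p + q - 1) * norm (F s))"
      by (rule set_integrable_mult_right)
  qed
  have R: "(LINT s:{0..r}|lborel. k s r) = (t - r) powr (p - 1) *\<^sub>R RL q F r" for r
    by (simp add: k_def RL_def del: scaleR_scaleR)
  have L: "(LINT r:{s..t}|lborel. k s r) = Beta p q *\<^sub>R ((t - s) powr (p + q - 1) *\<^sub>R F s)" if "s \<in> {0..t}" for s
  proof -
    have "(LINT r:{s..t}|lborel. k s r) = (LINT r:{s..t}|lborel. ((t - r) powr (p - 1) * (r - s) powr (q - 1)) *\<^sub>R F s)"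
      by (simp add: k_def)
    also have "\<dots> = (LINT r:{s..t}|lborel. (t - r) powr (p - 1) * (r - s) powr (q - 1)) *\<^sub>R F s"
      using Beta_Icc(1)[OF p q, of s t] that
        integral_scaleR_left[of "F s" lborel "\<lambda>r. indicator {s..t} r *\<^sub>R ((t - r) powr (p - 1) * (r - s) powr (q - 1))"]
      by (simp add: set_lebesgue_integral_def set_integrable_def)
    finally show ?thesis using Beta_Icc(2)[OF p q, of s t] that by simp
  qed
  show "AE r in lborel. r \<in> {0..t} \<longrightarrow> set_integrable lborel {0..r} (\<lambda>s. (t - r) powr (p - 1) *\<^sub>R (r - s) powr (q - 1) *\<^sub>R F s)"
    using triangle_Fubini(4)[OF int] unfolding k_def .
  show "set_integrable lborel {0..t} (\<lambda>r. (t - r) powr (p - 1) *\<^sub>R RL q F r)"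
    using triangle_Fubini(1)[OF int] unfolding R .
  have "RL p (RL q F) t = (LINT r:{0..t}|lborel. LINT s:{0..r}|lborel. k s r)"
    unfolding R by (simp add: RL_def)
  also have "\<dots> = (LINT s:{0..t}|lborel. LINT r:{s..t}|lborel. k s r)"
    by (rule triangle_Fubini(3)[OF int])
  also have "\<dots> = (LINT s:{0..t}|lborel. Beta p q *\<^sub>R ((t - s) powr (p + q - 1) *\<^sub>R F s))"
    by (intro set_lebesgue_integral_cong) (auto simp: L)
  finally show "RL p (RL q F) t = Beta p q *\<^sub>R RL (p + q) F t"
    by (simp add: RL_def del: scaleR_scaleR)
qed

text \<open>With \<open>0 powr y = 0\<close>, identities such as \<open>x powr 0 = 1\<close> or
  \<open>x powr a * x powr (- a) = 1\<close> fail at one point; this removes that point.\<close>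

lemma AE_lborel_neq: "AE x in lborel. x \<noteq> (c::real)"
  by (rule AE_lborel_singleton)

lemma RL_one:
  assumes [measurable]: "F \<in> borel_measurable borel"
  shows "RL 1 F t = (LINT s:{0..t}|lborel. F s)"
  unfolding RL_def
  by (rule set_lebesgue_integral_cong_AE) (use AE_lborel_neq[of t] in \<open>auto elim!: eventually_mono\<close>)

lemma Beta_one_left:
  assumes "0 < (q::real)"
  shows "Beta 1 q = 1 / q"
proof -
  have "q \<notin> \<int>\<^sub>\<le>\<^sub>0" using assms by (auto elim!: nonpos_Ints_cases)
  then have "Gamma (1 + q) = q * Gamma q" using Gamma_plus1[of q] by (simp add: add.commute)
  then show ?thesis using Gamma_real_pos[OF assms] by (simp add: Beta_def)
qed

text \<open>The semigroup law with outer order 1. It exhibits \<open>RL (q + 1) F\<close> as a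
  multiple of a primitive, which for \<open>q = a > 0\<close> is the source of continuity and
  Hoelder bounds.\<close>

lemma RL_integral:
  fixes F :: "real \<Rightarrow> 'a::{banach, second_countable_topology}"
  assumes [measurable]: "F \<in> borel_measurable borel"
    and q: "0 < q" and F: "set_integrable lborel {0..t} F"
  shows "set_integrable lborel {0..t} (RL q F)"
    and "(LINT r:{0..t}|lborel. RL q F r) = (1 / q) *\<^sub>R RL (q + 1) F t"
    and "AE r in lborel. r \<in> {0..t} \<longrightarrow> set_integrable lborel {0..r} (\<lambda>s. (r - s) powr (q - 1) *\<^sub>R F s)"
proof -
  have "AE r in lborel. r \<in> {0..t} \<longrightarrow> set_integrable lborel {0..r} (\<lambda>s. (t - r) powr (1 - 1) *\<^sub>R (r - s) powr (q - 1) *\<^sub>R F s)"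
    by (rule RL_RL(3)) (use q F in auto)
  with AE_lborel_neq[of t]
  show "AE r in lborel. r \<in> {0..t} \<longrightarrow> set_integrable lborel {0..r} (\<lambda>s. (r - s) powr (q - 1) *\<^sub>R F s)"
    by eventually_elim simp
  have "set_integrable lborel {0..t} (\<lambda>r. (t - r) powr (1 - 1) *\<^sub>R RL q F r)"
    by (rule RL_RL(1)) (use q F in auto)
  also have "?this \<longleftrightarrow> set_integrable lborel {0..t} (RL q F)"
    by (rule set_integrable_cong_AE) (use AE_lborel_neq[of t] in \<open>auto elim!: eventually_mono\<close>)
  finally show "set_integrable lborel {0..t} (RL q F)" .
  have "RL 1 (RL q F) t = Beta 1 q *\<^sub>R RL (1 + q) F t"
    by (rule RL_RL(2)) (use q F in auto)
  then show "(LINT r:{0..t}|lborel. RL q F r) = (1 / q) *\<^sub>R RL (q + 1) F t"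
    using q by (simp add: RL_one Beta_one_left add.commute)
qed

lemma RL_of_integral:
  fixes F :: "real \<Rightarrow> 'a::{banach, second_countable_topology}"
  assumes [measurable]: "F \<in> borel_measurable borel"
    and p: "0 < p" and F: "set_integrable lborel {0..t} F"
  shows "RL p (\<lambda>r. LINT s:{0..r}|lborel. F s) t = (1 / p) *\<^sub>R RL (p + 1) F t"
proof -
  have "RL p (RL 1 F) t = Beta p 1 *\<^sub>R RL (p + 1) F t"
    by (rule RL_RL(2)) (use p F in auto)
  moreover have "RL 1 F = (\<lambda>r. LINT s:{0..r}|lborel. F s)"
    by (auto simp: RL_one)
  ultimately show ?thesis
    using p by (simp add: Beta_one_left Beta_commute[of p])
qed

text \<open>Avoids differentiating the primitive of a merely integrable function: after extension by
  zero the integral vanishes on half-lines, hence on compact intervals, hence by induction over the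
  Borel sets on all of them, and so the density is null.\<close>

lemma AE_zero_if_integrals_zero:
  fixes f :: "real \<Rightarrow> 'a::{banach, second_countable_topology}"
  assumes f: "set_integrable lborel {0..T} f"
    and z: "\<And>t. 0 \<le> t \<Longrightarrow> t \<le> T \<Longrightarrow> (LINT s:{0..t}|lborel. f s) = 0"
  shows "AE t in lborel. t \<in> {0..T} \<longrightarrow> f t = 0"
proof -
  define g where "g t = indicator {0..T} t *\<^sub>R f t" for t
  have g: "integrable lborel g" using f by (simp add: g_def[abs_def] set_integrable_def)
  have gA: "set_integrable lborel A g" if "A \<in> sets borel" for A
    unfolding set_integrable_def by (rule integrable_mult_indicator) (use g that in auto)
  have g0: "(LINT s:{0..t}|lborel. g s) = 0" if "t \<le> T" for t
  proof (cases "0 \<le> t")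
    case True
    then have "(LINT s:{0..t}|lborel. g s) = (LINT s:{0..t}|lborel. f s)"
      using that by (intro set_lebesgue_integral_cong) (auto simp: g_def)
    then show ?thesis using z True that by simp
  qed (simp add: set_lebesgue_integral_def)
  have gT: "(LINT s:{..t}|lborel. g s) = 0" for t
  proof -
    have "(LINT s:{..t}|lborel. g s) = (LINT s:{0..min t T}|lborel. g s)"
      unfolding set_lebesgue_integral_def
      by (intro Bochner_Integration.integral_cong) (auto simp: g_def indicator_def)
    then show ?thesis using g0[of "min t T"] by simp
  qed
  have "(LINT s:A|lborel. g s) = 0" if "A \<in> sets borel" for A
    using that
  proof (induction rule: borel_set_induct)
    case empty
    then show ?case by (simp add: set_lebesgue_integral_def)
  next
    case (interval a b)
    have "(LINT s:{..b}|lborel. g s) = (LINT s:{..<a}|lborel. g s) + (LINT s:{a..b}|lborel. g s)"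
      using interval by (subst set_integral_Un[symmetric]) (auto simp: gA ivl_disj_un)
    moreover have "(LINT s:{..<a}|lborel. g s) = (LINT s:{..a}|lborel. g s)"
      by (rule set_integral_cong_set) 
         (use AE_lborel_neq[of a] gA in \<open>auto simp: set_borel_measurable_def set_integrable_def elim!: eventually_mono\<close>)
    ultimately show ?case using gT by simp
  next
    case (compl A)
    have "(LINT s:UNIV|lborel. g s) = (LINT s:{..T}|lborel. g s)"
      unfolding set_lebesgue_integral_def
      by (intro Bochner_Integration.integral_cong) (auto simp: g_def indicator_def)
    then have "(LINT s:UNIV|lborel. g s) = 0" using gT by simp
    moreover have "(LINT s:UNIV|lborel. g s) = (LINT s:A|lborel. g s) + (LINT s:-A|lborel. g s)"
      using compl by (subst set_integral_Un[symmetric]) (auto simp: gA)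
    ultimately show ?case using compl by simp
  next
    case (union F)
    have "(LINT s:(\<Union>i. F i)|lborel. g s) = (\<Sum>i. LINT s:F i|lborel. g s)"
      using union by (intro lebesgue_integral_countable_add) (auto simp: gA disjoint_family_on_def)
    then show ?case using union by simp
  qed
  then have "AE t in lborel. g t = 0"
    by (intro sigma_finite_measure.density_zero[OF lborel.sigma_finite_measure_axioms g]) auto
  then show ?thesis
    by eventually_elim (auto simp: g_def)
qed

lemma integral_powr_from_zero:
  fixes c t :: real
  assumes "-1 < c" "0 \<le> t"
  shows "set_integrable lborel {0..t} (\<lambda>s. s powr c)"
    and "(LINT s:{0..t}|lborel. s powr c) = t powr (c + 1) / (c + 1)"
proof -
  have ae: "AE r in lborel. r \<in> {0..t} \<longrightarrow> (t - r) powr (1 - 1) * (r - 0) powr (c + 1 - 1) = r powr c"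
    using AE_lborel_neq[of t] by (auto elim!: eventually_mono)
  have "set_integrable lborel {0..t} (\<lambda>r. (t - r) powr (1 - 1) * (r - 0) powr (c + 1 - 1))"
    by (rule Beta_Icc) (use assms in auto)
  also have "?this \<longleftrightarrow> set_integrable lborel {0..t} (\<lambda>s. s powr c)"
    by (rule set_integrable_cong_AE) (use ae in auto)
  finally show "set_integrable lborel {0..t} (\<lambda>s. s powr c)" .
  have "(LINT s:{0..t}|lborel. s powr c) = (LINT r:{0..t}|lborel. (t - r) powr (1 - 1) * (r - 0) powr (c + 1 - 1))"
    by (rule set_lebesgue_integral_cong_AE[symmetric]) (use ae in auto)
  also have "\<dots> = Beta 1 (c + 1) * (t - 0) powr (1 + (c + 1) - 1)"
    by (rule Beta_Icc) (use assms in auto)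
  finally show "(LINT s:{0..t}|lborel. s powr c) = t powr (c + 1) / (c + 1)"
    using assms by (simp add: Beta_one_left add.commute[of 1 c])
qed

lemma continuous_on_LINT:
  fixes f :: "real \<Rightarrow> 'a::euclidean_space"
  assumes "set_integrable lborel {0..T} f"
  shows "continuous_on {0..T} (\<lambda>t. LINT s:{0..t}|lborel. f s)"
proof -
  have "continuous_on {0..T} (\<lambda>t. integral {0..t} f)"
    by (intro indefinite_integral_continuous_1 set_borel_integral_eq_integral(1) assms)
  also have "?this \<longleftrightarrow> ?thesis"
    by (intro continuous_on_cong refl set_borel_integral_eq_integral(2)[symmetric]
         set_integrable_subset[OF assms]) auto
  finally show ?thesis .
qed

lemma powr_square: "(x powr c)\<^sup>2 = x powr (2 * c)" for x c :: real
  by (simp add: power2_eq_square powr_add[symmetric])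

section \<open>The kernel operator in fractional form\<close>

definition L2_norm_on :: "real \<Rightarrow> (real \<Rightarrow> 'a::real_normed_vector) \<Rightarrow> real" where
  "L2_norm_on T u = sqrt (LINT t:{0..T}|lborel. (norm (u t))\<^sup>2)"

lemma L2_norm_on_nonneg: "0 \<le> L2_norm_on T u"
  unfolding L2_norm_on_def set_lebesgue_integral_def by (auto intro!: integral_nonneg_AE)

lemma L2_norm_on_mono:
  assumes "set_integrable lborel {0..T} (\<lambda>t. (norm (u t))\<^sup>2)" "t \<le> T"
  shows "L2_norm_on t u \<le> L2_norm_on T u"
proof -
  have "set_integrable lborel {0..t} (\<lambda>t. (norm (u t))\<^sup>2)"
    by (rule set_integrable_subset[OF assms(1)]) (use assms(2) in auto)
  then show ?thesis
    unfolding L2_norm_on_def set_lebesgue_integral_def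
    using assms
    by (intro real_sqrt_le_mono integral_mono) (auto simp: set_integrable_def indicator_def)
qed

definition W_frac :: "real \<Rightarrow> (real \<Rightarrow> 'a::{banach, second_countable_topology}) \<Rightarrow> real \<Rightarrow> 'a" where
  "W_frac a u t = RL (a + 1) (\<lambda>s. s powr (- a) *\<^sub>R u s) t"

lemma W_frac_measurable [measurable]:
  assumes [measurable]: "u \<in> borel_measurable borel"
  shows "W_frac a u \<in> borel_measurable borel"
proof -
  have "W_frac a u = RL (a + 1) (\<lambda>s. s powr (- a) *\<^sub>R u s)"
    by (simp add: W_frac_def fun_eq_iff)
  then show ?thesis by simp
qed

text \<open>\<open>W_bound a * sqrt t\<close> is the L2 norm over \<open>{0..t}\<close> of the
  kernel \<open>(t - s) powr a * s powr (- a)\<close>; both Beta arguments are positive exactly for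
  \<bar>a\<bar> < 1/2.\<close>

definition W_bound :: "real \<Rightarrow> real" where
  "W_bound a = sqrt (Beta (2 * a + 1) (1 - 2 * a))"

lemma W_bound_nonneg: "-1/2 < a \<Longrightarrow> a < 1/2 \<Longrightarrow> 0 \<le> W_bound a"
  unfolding W_bound_def using Beta_real_pos[of "2 * a + 1" "1 - 2 * a"] by simp

text \<open>Cauchy--Schwarz against the kernel. The squared kernel has total exponent (2a + 1) + (1
  - 2a) - 1 = 1 in \<open>t\<close>, whence \<open>sqrt t\<close> whatever \<open>a\<close> is. The
  third clause is the form that the Tonelli criterion consumes.\<close>

lemma W_frac_bound:
  fixes u :: "real \<Rightarrow> 'a::{banach, second_countable_topology}"
  assumes a: "-1/2 < a" "a < 1/2"
    and [measurable]: "u \<in> borel_measurable borel"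
    and u: "set_integrable lborel {0..T} (\<lambda>t. (norm (u t))\<^sup>2)"
    and t: "0 \<le> t" "t \<le> T"
  shows "set_integrable lborel {0..t} (\<lambda>s. (t - s) powr a *\<^sub>R s powr (- a) *\<^sub>R u s)"
    and "norm (W_frac a u t) \<le> W_bound a * sqrt t * L2_norm_on T u"
    and "(\<integral>\<^sup>+s\<in>{0..t}. ennreal (norm ((t - s) powr a *\<^sub>R s powr (- a) *\<^sub>R u s)) \<partial>lborel)
           \<le> ennreal (W_bound a * sqrt t * L2_norm_on T u)"
proof -
  define f where "f s = (t - s) powr a * s powr (- a)" for s
  have [measurable]: "f \<in> borel_measurable borel" unfolding f_def by measurable
  have f2: "(f s)\<^sup>2 = (t - s) powr ((2 * a + 1) - 1) * (s - 0) powr ((1 - 2 * a) - 1)" if "s \<in> {0..t}" for s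
    unfolding f_def power_mult_distrib powr_square by simp
  have fi: "set_integrable lborel {0..t} (\<lambda>s. (f s)\<^sup>2)"
  proof -
    have "set_integrable lborel {0..t} (\<lambda>s. (t - s) powr ((2 * a + 1) - 1) * (s - 0) powr ((1 - 2 * a) - 1))"
      by (rule Beta_Icc(1)) (use a t in auto)
    also have "?this \<longleftrightarrow> set_integrable lborel {0..t} (\<lambda>s. (f s)\<^sup>2)"
      by (intro set_integrable_cong refl f2[symmetric]) auto
    finally show ?thesis .
  qed
  have fv: "(LINT s:{0..t}|lborel. (f s)\<^sup>2) = Beta (2 * a + 1) (1 - 2 * a) * t"
  proof -
    have "(LINT s:{0..t}|lborel. (f s)\<^sup>2) = (LINT s:{0..t}|lborel. (t - s) powr ((2 * a + 1) - 1) * (s - 0) powr ((1 - 2 * a) - 1))"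
      by (intro set_lebesgue_integral_cong allI impI f2) auto
    also have "\<dots> = Beta (2 * a + 1) (1 - 2 * a) * (t - 0) powr ((2 * a + 1) + (1 - 2 * a) - 1)"
      by (intro Beta_Icc) (use a t in auto)
    finally show ?thesis using t by simp
  qed
  have ut: "set_integrable lborel {0..t} (\<lambda>t. (norm (u t))\<^sup>2)"
    by (rule set_integrable_subset[OF u]) (use t in auto)
  have eq': "(t - s) powr a *\<^sub>R s powr (- a) *\<^sub>R u s = f s *\<^sub>R u s" for s
    by (simp add: f_def)
  show I: "set_integrable lborel {0..t} (\<lambda>s. (t - s) powr a *\<^sub>R s powr (- a) *\<^sub>R u s)"
    unfolding eq' by (rule set_integral_Cauchy_Schwarz(1)) (use fi ut in auto)
  have bd: "sqrt (LINT x:{0..t}|lborel. (f x)\<^sup>2) * sqrt (LINT x:{0..t}|lborel. (norm (u x))\<^sup>2)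
      \<le> W_bound a * sqrt t * L2_norm_on T u"
    unfolding fv W_bound_def real_sqrt_mult
    using L2_norm_on_mono[OF u t(2)] t Beta_real_pos[of "2 * a + 1" "1 - 2 * a"] a
    by (intro mult_left_mono) (auto simp: L2_norm_on_def)
  have "W_frac a u t = (LINT s:{0..t}|lborel. f s *\<^sub>R u s)"
    unfolding W_frac_def RL_def by (simp add: f_def)
  also have "norm \<dots> \<le> sqrt (LINT x:{0..t}|lborel. (f x)\<^sup>2) * sqrt (LINT x:{0..t}|lborel. (norm (u x))\<^sup>2)"
    by (rule set_integral_Cauchy_Schwarz(2)) (use fi ut in auto)
  also note bd
  finally show "norm (W_frac a u t) \<le> W_bound a * sqrt t * L2_norm_on T u" .
  have J: "set_integrable lborel {0..t} (\<lambda>s. f s *\<^sub>R norm (u s))"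
    by (rule set_integral_Cauchy_Schwarz(1)) (use fi ut in auto)
  have "(\<integral>\<^sup>+s\<in>{0..t}. ennreal (norm ((t - s) powr a *\<^sub>R s powr (- a) *\<^sub>R u s)) \<partial>lborel)
     = (\<integral>\<^sup>+s. ennreal (indicator {0..t} s *\<^sub>R (f s *\<^sub>R norm (u s))) \<partial>lborel)"
    by (intro nn_integral_cong) (auto simp: f_def indicator_def)
  also have "\<dots> = ennreal (LINT s:{0..t}|lborel. f s *\<^sub>R norm (u s))"
    unfolding set_lebesgue_integral_def
    by (rule nn_integral_eq_integral) (use J in \<open>auto simp: set_integrable_def f_def\<close>)
  also have "\<dots> \<le> ennreal (norm (LINT s:{0..t}|lborel. f s *\<^sub>R norm (u s)))"
    by (rule ennreal_leI) simp
  also have "\<dots> \<le> ennreal (sqrt (LINT x:{0..t}|lborel. (f x)\<^sup>2) * sqrt (LINT x:{0..t}|lborel. (norm (norm (u x)))\<^sup>2))"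
    by (intro ennreal_leI set_integral_Cauchy_Schwarz(2)) (use fi ut in auto)
  also have "\<dots> \<le> ennreal (W_bound a * sqrt t * L2_norm_on T u)"
    using bd by (intro ennreal_leI) simp
  finally show "(\<integral>\<^sup>+s\<in>{0..t}. ennreal (norm ((t - s) powr a *\<^sub>R s powr (- a) *\<^sub>R u s)) \<partial>lborel)
           \<le> ennreal (W_bound a * sqrt t * L2_norm_on T u)" .
qed

lemma weighted_integrable:
  fixes u :: "real \<Rightarrow> 'a::{banach, second_countable_topology}"
  assumes a: "a < 1/2"
    and [measurable]: "u \<in> borel_measurable borel"
    and u: "set_integrable lborel {0..T} (\<lambda>t. (norm (u t))\<^sup>2)" and T: "0 \<le> T"
  shows "set_integrable lborel {0..T} (\<lambda>s. s powr (- a) *\<^sub>R u s)"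
proof (rule set_integral_Cauchy_Schwarz(1))
  have "(s powr (- a))\<^sup>2 = s powr (- 2 * a)" for s :: real
    unfolding power2_eq_square powr_add[symmetric] by simp
  then show "set_integrable lborel {0..T} (\<lambda>s. (s powr (- a))\<^sup>2)"
    using integral_powr_from_zero(1)[of "- 2 * a" T] a T by simp
qed (use u in auto)

text \<open>The rate \<open>sqrt r\<close> turns the weight \<open>r powr (a - 1)\<close> into
  \<open>r powr (a - 1/2)\<close>, integrable at 0 because -1/2 < a. The constant \<open>M\<close>
  is left free so that an iteration can feed in improved ones.\<close>

lemma integral_powr_W_frac:
  fixes u :: "real \<Rightarrow> 'a::{banach, second_countable_topology}"
  assumes a: "-1/2 < a" "a < 1/2"
    and [measurable]: "u \<in> borel_measurable borel"
    and W: "\<And>r. 0 \<le> r \<Longrightarrow> r \<le> t \<Longrightarrow> norm (W_frac a u r) \<le> M * sqrt r"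
    and t: "0 \<le> t"
  shows "set_integrable lborel {0..t} (\<lambda>r. r powr (a - 1) *\<^sub>R W_frac a u r)"
    and "norm (LINT r:{0..t}|lborel. r powr (a - 1) *\<^sub>R W_frac a u r) \<le> M * t powr (a + 1/2) / (a + 1/2)"
proof -
  have bd: "norm (r powr (a - 1) *\<^sub>R W_frac a u r) \<le> M * r powr (a - 1/2)" if "r \<in> {0..t}" for r
  proof -
    have "norm (r powr (a - 1) *\<^sub>R W_frac a u r) \<le> r powr (a - 1) * (M * sqrt r)"
      using W[of r] that by (auto intro!: mult_left_mono)
    also have "\<dots> = M * (r powr (a - 1) * r powr (1/2))"
      using that by (simp add: powr_half_sqrt)
    finally show ?thesis by (simp add: powr_add[symmetric])
  qed
  have I: "set_integrable lborel {0..t} (\<lambda>r. M * r powr (a - 1/2))"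
    by (intro set_integrable_mult_right integral_powr_from_zero) (use a t in auto)
  show J: "set_integrable lborel {0..t} (\<lambda>r. r powr (a - 1) *\<^sub>R W_frac a u r)"
  proof (rule set_integrable_bound[OF I])
    show "set_borel_measurable lborel {0..t} (\<lambda>r. r powr (a - 1) *\<^sub>R W_frac a u r)"
      unfolding set_borel_measurable_def by measurable
    show "AE x in lborel. x \<in> {0..t} \<longrightarrow> norm (x powr (a - 1) *\<^sub>R W_frac a u x) \<le> norm (M * x powr (a - 1 / 2))"
      by (intro AE_I2 impI order.trans[OF bd]) auto
  qed
  have "norm (LINT r:{0..t}|lborel. r powr (a - 1) *\<^sub>R W_frac a u r) \<le> (LINT r:{0..t}|lborel. M * r powr (a - 1/2))"
    by (rule set_integral_norm_bound[OF J I bd])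
  also have "\<dots> = M * t powr (a + 1/2) / (a + 1/2)"
    using integral_powr_from_zero(2)[of "a - 1/2" t] a t by (simp add: add.commute[of "1/2" a])
  finally show "norm (LINT r:{0..t}|lborel. r powr (a - 1) *\<^sub>R W_frac a u r) \<le> M * t powr (a + 1/2) / (a + 1/2)" .
qed

definition V_frac :: "real \<Rightarrow> (real \<Rightarrow> 'a::{banach, second_countable_topology}) \<Rightarrow> real \<Rightarrow> 'a" where
  "V_frac a u t = t powr a *\<^sub>R W_frac a u t - a *\<^sub>R (LINT r:{0..t}|lborel. r powr (a - 1) *\<^sub>R W_frac a u r)"

lemma V_frac_bound:
  fixes u :: "real \<Rightarrow> 'a::{banach, second_countable_topology}"
  assumes a: "-1/2 < a" "a < 1/2"
    and [measurable]: "u \<in> borel_measurable borel"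
    and u: "set_integrable lborel {0..T} (\<lambda>t. (norm (u t))\<^sup>2)"
    and t: "0 \<le> t" "t \<le> T"
  shows "norm (V_frac a u t) \<le> W_bound a * (1 + \<bar>a\<bar> / (a + 1/2)) * t powr (a + 1/2) * L2_norm_on T u"
proof -
  define M where "M = W_bound a * L2_norm_on T u"
  have M0: "0 \<le> M" unfolding M_def by (intro mult_nonneg_nonneg W_bound_nonneg L2_norm_on_nonneg a)
  have W: "norm (W_frac a u r) \<le> M * sqrt r" if "0 \<le> r" "r \<le> t" for r
    using W_frac_bound(2)[OF a _ u, of r] that t by (simp add: M_def mult_ac)
  have "norm (V_frac a u t) \<le> t powr a * norm (W_frac a u t) + \<bar>a\<bar> * norm (LINT r:{0..t}|lborel. r powr (a - 1) *\<^sub>R W_frac a u r)"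
    unfolding V_frac_def by (rule order.trans[OF norm_triangle_ineq4]) simp
  also have "\<dots> \<le> t powr a * (M * sqrt t) + \<bar>a\<bar> * (M * t powr (a + 1/2) / (a + 1/2))"
    using W[of t] t integral_powr_W_frac(2)[OF a _ W, of t] by (intro add_mono mult_left_mono) auto
  also have "t powr a * (M * sqrt t) = M * t powr (a + 1/2)"
    using t by (simp add: powr_add powr_half_sqrt)
  also have "M * t powr (a + 1/2) + \<bar>a\<bar> * (M * t powr (a + 1/2) / (a + 1/2))
     = W_bound a * (1 + \<bar>a\<bar> / (a + 1/2)) * t powr (a + 1/2) * L2_norm_on T u"
    using a by (simp add: M_def field_simps)
  finally show ?thesis .
qed

text \<open>\<open>V_frac a\<close> is \<open>K\<^sub>H\<close> for \<open>a = H - 1/2\<close>, up to the constant \<open>c\<^sub>H\<close>.\<close>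

lemma V_frac_eq_kernel_integral:
  fixes u :: "real \<Rightarrow> 'a::{banach, second_countable_topology}"
  assumes a: "-1/2 < a" "a < 1/2"
    and [measurable]: "u \<in> borel_measurable borel"
    and u: "set_integrable lborel {0..T} (\<lambda>t. (norm (u t))\<^sup>2)"
    and t: "0 \<le> t" "t \<le> T"
  shows "set_integrable lborel {0..t} (\<lambda>s. ((t / s) powr a * (t - s) powr a
           - a * s powr (- a) * (LINT r:{s..t}|lborel. r powr (a - 1) * (r - s) powr a)) *\<^sub>R u s)"
    and "(LINT s:{0..t}|lborel. ((t / s) powr a * (t - s) powr a
           - a * s powr (- a) * (LINT r:{s..t}|lborel. r powr (a - 1) * (r - s) powr a)) *\<^sub>R u s) = V_frac a u t"
proof -
  define M where "M = W_bound a * L2_norm_on T u"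
  define k where "k s r = r powr (a - 1) *\<^sub>R (r - s) powr a *\<^sub>R s powr (- a) *\<^sub>R u s" for s r :: real
  define A where "A s = t powr a *\<^sub>R (t - s) powr a *\<^sub>R s powr (- a) *\<^sub>R u s" for s
  let ?K = "\<lambda>s. ((t / s) powr a * (t - s) powr a
           - a * s powr (- a) * (LINT r:{s..t}|lborel. r powr (a - 1) * (r - s) powr a)) *\<^sub>R u s"
  \<comment> \<open>Integrating over \<open>s\<close> first brings in the bound on
    \<open>W_frac\<close>, whose \<open>sqrt r\<close> makes the remaining weight in
    \<open>r\<close> integrable.\<close>
  have int: "integrable (lborel \<Otimes>\<^sub>M lborel)
      (\<lambda>(s, r). indicator {0..t} r *\<^sub>R indicator {0..r} s *\<^sub>R k s r)"
  proof (rule triangle_integrable_sndI)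
    show "(\<lambda>(s, r). k s r) \<in> borel_measurable (borel \<Otimes>\<^sub>M borel)"
      unfolding k_def by measurable
    fix r assume r: "0 < r" "r < t"
    have "(\<integral>\<^sup>+s\<in>{0..r}. ennreal (norm (k s r)) \<partial>lborel)
       = (\<integral>\<^sup>+s. ennreal (r powr (a - 1)) * (ennreal (norm ((r - s) powr a *\<^sub>R s powr (- a) *\<^sub>R u s)) * indicator {0..r} s) \<partial>lborel)"
      by (intro nn_integral_cong) (auto simp: k_def indicator_def ennreal_mult[symmetric] mult_ac)
    also have "\<dots> = ennreal (r powr (a - 1)) * (\<integral>\<^sup>+s\<in>{0..r}. ennreal (norm ((r - s) powr a *\<^sub>R s powr (- a) *\<^sub>R u s)) \<partial>lborel)"
      by (rule nn_integral_cmult) measurable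
    also have "\<dots> \<le> ennreal (r powr (a - 1)) * ennreal (W_bound a * sqrt r * L2_norm_on T u)"
      by (intro mult_left_mono W_frac_bound(3)) (use a u r t in auto)
    also have "\<dots> = ennreal (M * r powr (a - 1/2))"
    proof -
      have "r powr (a - 1) * sqrt r = r powr (a - 1/2)"
        using r by (simp add: powr_half_sqrt[symmetric] powr_add[symmetric])
      then show ?thesis
        using W_bound_nonneg[OF a] L2_norm_on_nonneg[of T u] r
        by (simp add: ennreal_mult[symmetric] M_def mult_ac)
    qed
    finally show "(\<integral>\<^sup>+s\<in>{0..r}. ennreal (norm (k s r)) \<partial>lborel) \<le> ennreal (M * r powr (a - 1/2))" .
  next
    show "set_integrable lborel {0..t} (\<lambda>r. M * r powr (a - 1/2))"
      by (intro set_integrable_mult_right integral_powr_from_zero) (use a t in auto)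
  qed
  have R: "(LINT s:{0..r}|lborel. k s r) = r powr (a - 1) *\<^sub>R W_frac a u r" for r
    by (simp add: k_def W_frac_def RL_def del: scaleR_scaleR)
  have L: "(LINT r:{s..t}|lborel. k s r) = (s powr (- a) * (LINT r:{s..t}|lborel. r powr (a - 1) * (r - s) powr a)) *\<^sub>R u s"
    if "s \<in> {0<..t}" for s
  proof -
    \<comment> \<open>For \<open>0 < s \<le> r\<close> the factor \<open>r powr (a - 1)\<close> is
      at most its value at \<open>s\<close>, so a Beta integral dominates the inner kernel
      integral.\<close>
    have b: "set_integrable lborel {s..t} (\<lambda>r. s powr (a - 1) * ((t - r) powr (1 - 1) * (r - s) powr (a + 1 - 1)))"
      by (intro set_integrable_mult_right Beta_Icc) (use a that in auto)
    have "set_integrable lborel {s..t} (\<lambda>r. r powr (a - 1) * (r - s) powr a)"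
    proof (rule set_integrable_bound[OF b])
      show "set_borel_measurable lborel {s..t} (\<lambda>r. r powr (a - 1) * (r - s) powr a)"
        unfolding set_borel_measurable_def by measurable
      have "r powr (a - 1) * (r - s) powr a \<le> s powr (a - 1) * (r - s) powr a" if "s \<le> r" for r
        using \<open>s \<in> {0<..t}\<close> that a by (intro mult_right_mono powr_mono2') auto
      then show "AE r in lborel. r \<in> {s..t} \<longrightarrow> norm (r powr (a - 1) * (r - s) powr a)
         \<le> norm (s powr (a - 1) * ((t - r) powr (1 - 1) * (r - s) powr (a + 1 - 1)))"
        using AE_lborel_neq[of t] by (auto elim!: eventually_mono simp: abs_mult)
    qed
    then have "(LINT r:{s..t}|lborel. (r powr (a - 1) * (r - s) powr a) *\<^sub>R (s powr (- a) *\<^sub>R u s))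
      = (LINT r:{s..t}|lborel. r powr (a - 1) * (r - s) powr a) *\<^sub>R (s powr (- a) *\<^sub>R u s)"
      using integral_scaleR_left[of "s powr (- a) *\<^sub>R u s" lborel "\<lambda>r. indicator {s..t} r *\<^sub>R (r powr (a - 1) * (r - s) powr a)"]
      by (simp add: set_lebesgue_integral_def set_integrable_def mult_ac)
    then show ?thesis by (simp add: k_def mult_ac)
  qed
  have K: "?K s = A s - a *\<^sub>R (LINT r:{s..t}|lborel. k s r)" if "s \<in> {0<..t}" for s
    using that t by (simp add: L A_def powr_divide powr_minus_divide algebra_simps)
  have Ai: "set_integrable lborel {0..t} A"
    unfolding A_def by (intro set_integrable_scaleR_right W_frac_bound(1)) (use a u t in auto)
  have Bi: "set_integrable lborel {0..t} (\<lambda>s. a *\<^sub>R (LINT r:{s..t}|lborel. k s r))"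
    by (intro set_integrable_scaleR_right triangle_Fubini(2)[OF int])
  define \<kappa> where "\<kappa> s = (LINT r:{s..t}|lborel. r powr (a - 1) * (r - s) powr a)" for s
  have [measurable]: "\<kappa> \<in> borel_measurable borel"
  proof -
    have "\<kappa> = (\<lambda>s. LINT r|lborel. (if s \<le> r \<and> r \<le> t then 1 else 0) * (r powr (a - 1) * (r - s) powr a))"
      unfolding \<kappa>_def set_lebesgue_integral_def
      by (intro ext Bochner_Integration.integral_cong) (auto simp: indicator_def)
    then show ?thesis by simp
  qed
  define AB where "AB s = A s - a *\<^sub>R (LINT r:{s..t}|lborel. k s r)" for s
  define KK where "KK s = ?K s" for s
  have ABi: "set_integrable lborel {0..t} AB"
    unfolding AB_def by (rule set_integral_diff(1)[OF Ai Bi])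
  have KK: "KK = (\<lambda>s. ((t / s) powr a * (t - s) powr a - a * s powr (- a) * \<kappa> s) *\<^sub>R u s)"
    by (simp add: KK_def \<kappa>_def fun_eq_iff)
  have [measurable]: "KK \<in> borel_measurable borel"
    unfolding KK by measurable
  have ae: "AE s in lborel. indicator {0..t} s *\<^sub>R AB s = indicator {0..t} s *\<^sub>R KK s"
    using AE_lborel_neq[of 0]
  proof eventually_elim
    fix s :: real assume "s \<noteq> 0"
    then show "indicator {0..t} s *\<^sub>R AB s = indicator {0..t} s *\<^sub>R KK s"
      using K[of s] unfolding AB_def KK_def by (cases "s \<in> {0..t}") simp_all
  qed
  have ABm: "(\<lambda>s. indicator {0..t} s *\<^sub>R AB s) \<in> borel_measurable lborel"
    using ABi unfolding set_integrable_def by (rule borel_measurable_integrable)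
  have KKm: "(\<lambda>s. indicator {0..t} s *\<^sub>R KK s) \<in> borel_measurable lborel"
    by measurable
  have "integrable lborel (\<lambda>s. indicator {0..t} s *\<^sub>R KK s)"
    using integrable_cong_AE[OF ABm KKm ae] ABi by (simp add: set_integrable_def)
  then show "set_integrable lborel {0..t} ?K"
    unfolding set_integrable_def KK_def .
  have "(LINT s:{0..t}|lborel. KK s) = (LINT s:{0..t}|lborel. AB s)"
    unfolding set_lebesgue_integral_def by (rule integral_cong_AE[OF ABm KKm ae, symmetric])
  also have "\<dots> = (LINT s:{0..t}|lborel. A s) - (LINT s:{0..t}|lborel. a *\<^sub>R (LINT r:{s..t}|lborel. k s r))"
    unfolding AB_def by (rule set_integral_diff(2)[OF Ai Bi])
  also have "(LINT s:{0..t}|lborel. A s) = t powr a *\<^sub>R W_frac a u t"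
    by (simp add: A_def W_frac_def RL_def del: scaleR_scaleR)
  also have "(LINT s:{0..t}|lborel. a *\<^sub>R (LINT r:{s..t}|lborel. k s r)) = a *\<^sub>R (LINT r:{0..t}|lborel. r powr (a - 1) *\<^sub>R W_frac a u r)"
    using triangle_Fubini(3)[OF int] unfolding R by simp
  finally show "(LINT s:{0..t}|lborel. ?K s) = V_frac a u t"
    unfolding KK_def V_frac_def .
qed

section \<open>Continuity of the fractional transforms\<close>

lemma continuous_on_Hoelder:
  fixes f :: "real \<Rightarrow> 'a::real_normed_vector"
  assumes \<beta>: "0 < \<beta>"
    and H: "\<And>s t. 0 \<le> s \<Longrightarrow> s < t \<Longrightarrow> t \<le> T \<Longrightarrow> norm (f t - f s) \<le> C * (t - s) powr \<beta>"
  shows "continuous_on {0..T} f"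
  unfolding continuous_on
proof
  fix x assume x: "x \<in> {0..T}"
  have bd: "norm (f y - f x) \<le> C * \<bar>y - x\<bar> powr \<beta>" if "y \<in> {0..T}" for y
    using H[of x y] H[of y x] x that by (cases x y rule: linorder_cases) (auto simp: norm_minus_commute abs_if)
  have "((\<lambda>y. C * \<bar>y - x\<bar> powr \<beta>) \<longlongrightarrow> C * \<bar>x - x\<bar> powr \<beta>) (at x within {0..T})"
    using \<beta> by (intro tendsto_intros tendsto_powr') auto
  then have "((\<lambda>y. C * \<bar>y - x\<bar> powr \<beta>) \<longlongrightarrow> 0) (at x within {0..T})" by simp
  then have "((\<lambda>y. f y - f x) \<longlongrightarrow> 0) (at x within {0..T})"
    by (rule Lim_null_comparison[rotated]) (use bd in \<open>auto simp: eventually_at_filter\<close>)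
  then show "(f \<longlongrightarrow> f x) (at x within {0..T})"
    by (simp add: LIM_zero_iff)
qed

text \<open>For \<open>a < 0\<close> the weight \<open>s powr (- a)\<close> is bounded on
  \<open>{0..T}\<close> and can be absorbed into a square integrable \<open>v\<close>.
  Cauchy--Schwarz then reduces the increment to the L2 distance of the two kernels
  \<open>(t' - s) powr a\<close> and \<open>(t - s) powr a\<close>.\<close>

lemma W_frac_diff_neg:
  fixes u :: "real \<Rightarrow> 'a::{banach, second_countable_topology}"
  assumes a: "-1/2 < a" "a < 0"
    and [measurable]: "u \<in> borel_measurable borel"
    and u: "set_integrable lborel {0..T} (\<lambda>t. (norm (u t))\<^sup>2)"
    and t: "0 \<le> t" "t < t'" "t' \<le> T"
  shows "norm (W_frac a u t' - W_frac a u t)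
           \<le> sqrt (2 / (2 * a + 1)) * L2_norm_on T (\<lambda>s. s powr (- a) *\<^sub>R u s) * (t' - t) powr (a + 1/2)"
proof -
  define v where "v s = s powr (- a) *\<^sub>R u s" for s
  define c where "c = 2 * a + 1"
  have c: "0 < c" using a by (simp add: c_def)
  have [measurable]: "v \<in> borel_measurable borel" unfolding v_def by measurable
  have v2: "set_integrable lborel {0..T} (\<lambda>s. (norm (v s))\<^sup>2)"
  proof (rule set_integrable_bound)
    show "set_integrable lborel {0..T} (\<lambda>s. T powr (- 2 * a) * (norm (u s))\<^sup>2)"
      by (intro set_integrable_mult_right u)
    show "set_borel_measurable lborel {0..T} (\<lambda>s. (norm (v s))\<^sup>2)"
      unfolding set_borel_measurable_def by measurable
    have "s powr (- 2 * a) * (norm (u s))\<^sup>2 \<le> T powr (- 2 * a) * (norm (u s))\<^sup>2" if "s \<in> {0..T}" for s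
      using that a by (intro mult_right_mono powr_mono2) auto
    then show "AE s in lborel. s \<in> {0..T} \<longrightarrow> norm ((norm (v s))\<^sup>2) \<le> norm (T powr (- 2 * a) * (norm (u s))\<^sup>2)"
      by (auto simp: v_def power_mult_distrib powr_square abs_mult)
  qed
  have v2': "set_integrable lborel {0..t'} (\<lambda>s. (norm (v s))\<^sup>2)"
    by (rule set_integrable_subset[OF v2]) (use t in auto)
  define D where "D s = (t' - s) powr a - indicator {0..t} s * (t - s) powr a" for s
  have [measurable]: "D \<in> borel_measurable borel" unfolding D_def by measurable
  \<comment> \<open>A majorant of \<open>(D s)\<^sup>2\<close> with explicit integral. For
    \<open>s < t\<close> it uses (x - y)^2 \<le> y^2 - x^2 for 0 \<le> x \<le> y. Beyond
    \<open>t\<close> the middle term is still subtracted, so the last one is doubled to leave one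
    copy of the square.\<close>
  define E where "E s = indicator {0..t} s * (t - s) powr (2 * a) - (t' - s) powr (2 * a) + 2 * (indicator {t..t'} s * (t' - s) powr (2 * a))" for s
  have DE: "(D s)\<^sup>2 \<le> E s" if "s \<in> {0..t'}" for s
  proof (cases "s < t")
    case True
    have "(t' - s) powr a \<le> (t - s) powr a" using True t a by (intro powr_mono2') auto
    then have "(D s)\<^sup>2 \<le> ((t - s) powr a)\<^sup>2 - ((t' - s) powr a)\<^sup>2"
      using that True by (simp add: D_def power2_eq_square algebra_simps mult_right_mono)
    then show ?thesis using that True by (simp add: E_def powr_square)
  qed (use that t in \<open>auto simp: D_def E_def powr_square indicator_def\<close>)
  have B: "set_integrable lborel {x..y} (\<lambda>s. (y - s) powr (2 * a))"
          "(LINT s:{x..y}|lborel. (y - s) powr (2 * a)) = (y - x) powr c / c" if "x \<le> y" for x y :: real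
  proof -
    have ae: "AE s in lborel. s \<in> {x..y} \<longrightarrow> (y - s) powr (c - 1) * (s - x) powr (1 - 1) = (y - s) powr (2 * a)"
      using AE_lborel_neq[of x] by eventually_elim (auto simp: c_def)
    have "set_integrable lborel {x..y} (\<lambda>s. (y - s) powr (c - 1) * (s - x) powr (1 - 1))"
      by (rule Beta_Icc) (use c that in auto)
    also have "?this \<longleftrightarrow> set_integrable lborel {x..y} (\<lambda>s. (y - s) powr (2 * a))"
      by (rule set_integrable_cong_AE) (use ae in auto)
    finally show "set_integrable lborel {x..y} (\<lambda>s. (y - s) powr (2 * a))" .
    have "(LINT s:{x..y}|lborel. (y - s) powr (2 * a)) = (LINT s:{x..y}|lborel. (y - s) powr (c - 1) * (s - x) powr (1 - 1))"
      by (rule set_lebesgue_integral_cong_AE[symmetric]) (use ae in auto)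
    also have "\<dots> = Beta c 1 * (y - x) powr (c + 1 - 1)"
      by (rule Beta_Icc) (use c that in auto)
    finally show "(LINT s:{x..y}|lborel. (y - s) powr (2 * a)) = (y - x) powr c / c"
      using c by (simp add: Beta_commute[of c] Beta_one_left)
  qed
  have r1: "indicator {0..t'} s * (indicator {0..t} s * x) = indicator {0..t} s * x" for s x :: real
    using t by (auto simp: indicator_def)
  have r2: "indicator {0..t'} s * (indicator {t..t'} s * x) = indicator {t..t'} s * x" for s x :: real
    using t by (auto simp: indicator_def)
  have E1: "set_integrable lborel {0..t'} (\<lambda>s. indicator {0..t} s * (t - s) powr (2 * a))"
    "(LINT s:{0..t'}|lborel. indicator {0..t} s * (t - s) powr (2 * a)) = t powr c / c"
    using B[of 0 t] t unfolding set_integrable_def set_lebesgue_integral_def real_scaleR_def r1 by auto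
  have E2: "set_integrable lborel {0..t'} (\<lambda>s. indicator {t..t'} s * (t' - s) powr (2 * a))"
    "(LINT s:{0..t'}|lborel. indicator {t..t'} s * (t' - s) powr (2 * a)) = (t' - t) powr c / c"
    using B[of t t'] t unfolding set_integrable_def set_lebesgue_integral_def real_scaleR_def r2 by auto
  have E3: "set_integrable lborel {0..t'} (\<lambda>s. (t' - s) powr (2 * a))"
    "(LINT s:{0..t'}|lborel. (t' - s) powr (2 * a)) = t' powr c / c"
    using B[of 0 t'] t by auto
  have Ei: "set_integrable lborel {0..t'} E"
    unfolding E_def by (intro set_integral_add set_integral_diff set_integrable_mult_right E1 E2 E3)
  have "(LINT s:{0..t'}|lborel. E s) = t powr c / c - t' powr c / c + 2 * ((t' - t) powr c / c)"
    unfolding E_def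
    by (simp add: set_integral_add set_integral_diff set_integrable_mult_right E1 E2 E3)
  also have "t powr c \<le> t' powr c" using t c by (intro powr_mono2) auto
  then have "t powr c / c - t' powr c / c + 2 * ((t' - t) powr c / c) \<le> 2 / c * (t' - t) powr c"
    using c by (simp add: divide_right_mono)
  finally have Ev: "(LINT s:{0..t'}|lborel. E s) \<le> 2 / c * (t' - t) powr c" .
  have Di: "set_integrable lborel {0..t'} (\<lambda>s. (D s)\<^sup>2)"
  proof (rule set_integrable_bound[OF Ei])
    show "set_borel_measurable lborel {0..t'} (\<lambda>s. (D s)\<^sup>2)"
      unfolding set_borel_measurable_def by measurable
    show "AE s in lborel. s \<in> {0..t'} \<longrightarrow> norm ((D s)\<^sup>2) \<le> norm (E s)"
      using DE by (intro AE_I2) force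
  qed
  have "(LINT s:{0..t'}|lborel. (D s)\<^sup>2) \<le> (LINT s:{0..t'}|lborel. E s)"
    by (rule set_integral_mono[OF Di Ei DE])
  with Ev have Dv: "(LINT s:{0..t'}|lborel. (D s)\<^sup>2) \<le> 2 / c * (t' - t) powr c" by simp
  have W: "set_integrable lborel {0..r} (\<lambda>s. (r - s) powr a *\<^sub>R v s)"
     "W_frac a u r = (LINT s:{0..r}|lborel. (r - s) powr a *\<^sub>R v s)" if "0 \<le> r" "r \<le> T" for r
    using W_frac_bound(1)[of a u T r] a u that by (simp_all add: v_def W_frac_def RL_def)
  have r1': "indicator {0..t'} s *\<^sub>R (indicator {0..t} s *\<^sub>R x) = indicator {0..t} s *\<^sub>R x" for s and x :: 'a
    using t by (auto simp: indicator_def)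
  have W': "set_integrable lborel {0..t'} (\<lambda>s. indicator {0..t} s *\<^sub>R (t - s) powr a *\<^sub>R v s)"
     "W_frac a u t = (LINT s:{0..t'}|lborel. indicator {0..t} s *\<^sub>R (t - s) powr a *\<^sub>R v s)"
    using W[of t] t unfolding set_integrable_def set_lebesgue_integral_def r1' by auto
  have "W_frac a u t' - W_frac a u t = (LINT s:{0..t'}|lborel. (t' - s) powr a *\<^sub>R v s - indicator {0..t} s *\<^sub>R (t - s) powr a *\<^sub>R v s)"
    using W[of t'] W' t by (subst set_integral_diff) auto
  also have "\<dots> = (LINT s:{0..t'}|lborel. D s *\<^sub>R v s)"
    by (simp add: D_def algebra_simps)
  also have "norm \<dots> \<le> sqrt (LINT s:{0..t'}|lborel. (D s)\<^sup>2) * sqrt (LINT s:{0..t'}|lborel. (norm (v s))\<^sup>2)"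
    by (rule set_integral_Cauchy_Schwarz(2)) (use Di v2' in auto)
  also have "\<dots> \<le> sqrt (2 / c * (t' - t) powr c) * L2_norm_on T v"
    using Dv c L2_norm_on_mono[OF v2, of t'] t
    by (intro mult_mono real_sqrt_le_mono) (auto simp: L2_norm_on_def set_lebesgue_integral_def intro!: integral_nonneg_AE)
  also have "\<dots> = sqrt (2 / c) * L2_norm_on T v * (t' - t) powr (a + 1/2)"
  proof -
    have "((t' - t) powr (a + 1/2))\<^sup>2 = (t' - t) powr c"
      unfolding powr_square by (simp add: c_def algebra_simps)
    then have "sqrt ((t' - t) powr c) = (t' - t) powr (a + 1/2)"
      by (metis powr_ge_zero real_sqrt_unique)
    then show ?thesis by (simp only: real_sqrt_mult mult_ac)
  qed
  finally show ?thesis by (simp add: c_def v_def[abs_def])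
qed

text \<open>For \<open>a < 0\<close> the Hoelder estimate of order \<open>a + 1/2\<close> applies.
  For \<open>a = 0\<close> the transform is a primitive, and for \<open>a > 0\<close> it is
  \<open>a\<close> times the primitive of the integrable \<open>RL a v\<close>.\<close>

lemma W_frac_continuous:
  fixes u :: "real \<Rightarrow> 'a::euclidean_space"
  assumes a: "-1/2 < a" "a < 1/2"
    and [measurable]: "u \<in> borel_measurable borel"
    and u: "set_integrable lborel {0..T} (\<lambda>t. (norm (u t))\<^sup>2)" and T: "0 \<le> T"
  shows "continuous_on {0..T} (W_frac a u)"
proof -
  define v where "v s = s powr (- a) *\<^sub>R u s" for s
  have [measurable]: "v \<in> borel_measurable borel" unfolding v_def by measurable
  have v: "set_integrable lborel {0..T} v"
    using weighted_integrable[OF a(2) _ u T] by (simp add: v_def[abs_def])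
  have W: "W_frac a u t = RL (a + 1) v t" for t by (simp add: W_frac_def v_def[abs_def])
  consider "a < 0" | "a = 0" | "a > 0" by linarith
  then show ?thesis
  proof cases
    case 1
    show ?thesis
      by (rule continuous_on_Hoelder[where \<beta> = "a + 1/2"])
         (use a 1 W_frac_diff_neg[OF a(1) 1 _ u] in auto)
  next
    case 2
    have "W_frac a u t = (LINT s:{0..t}|lborel. v s)" for t
      using W[of t] RL_one[of v t] 2 by simp
    then have "W_frac a u = (\<lambda>t. LINT s:{0..t}|lborel. v s)" by (rule ext)
    then show ?thesis using continuous_on_LINT[OF v] by simp
  next
    case 3
    have "continuous_on {0..T} (\<lambda>t. a *\<^sub>R (LINT r:{0..t}|lborel. RL a v r))"
      by (intro continuous_intros continuous_on_LINT RL_integral) (use 3 v in auto)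
    also have "?this \<longleftrightarrow> ?thesis"
    proof (intro continuous_on_cong refl)
      fix t assume t: "t \<in> {0..T}"
      have "set_integrable lborel {0..t} v" by (rule set_integrable_subset[OF v]) (use t in auto)
      then show "a *\<^sub>R (LINT r:{0..t}|lborel. RL a v r) = W_frac a u t"
        using 3 by (simp add: RL_integral W)
    qed
    finally show ?thesis .
  qed
qed

lemma V_frac_continuous:
  fixes u :: "real \<Rightarrow> 'a::euclidean_space"
  assumes a: "-1/2 < a" "a < 1/2"
    and [measurable]: "u \<in> borel_measurable borel"
    and u: "set_integrable lborel {0..T} (\<lambda>t. (norm (u t))\<^sup>2)" and T: "0 \<le> T"
  shows "continuous_on {0..T} (V_frac a u)"
proof -
  define M where "M = W_bound a * L2_norm_on T u"
  have W: "norm (W_frac a u r) \<le> M * sqrt r" if "0 \<le> r" "r \<le> T" for r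
    using W_frac_bound(2)[OF a _ u, of r] that by (simp add: M_def mult_ac)
  have Wc: "continuous_on {0..T} (W_frac a u)"
    by (rule W_frac_continuous[OF a _ u T]) simp
  have "continuous_on {0..T} (\<lambda>t. LINT r:{0..t}|lborel. r powr (a - 1) *\<^sub>R W_frac a u r)"
    by (intro continuous_on_LINT integral_powr_W_frac(1)[OF a _ W T]) auto
  moreover have "continuous_on {0..T} (\<lambda>t. t powr a *\<^sub>R W_frac a u t)"
    unfolding continuous_on
  proof
    fix x assume x: "x \<in> {0..T}"
    have Wx: "(W_frac a u \<longlongrightarrow> W_frac a u x) (at x within {0..T})"
      using Wc x by (simp add: continuous_on)
    show "((\<lambda>t. t powr a *\<^sub>R W_frac a u t) \<longlongrightarrow> x powr a *\<^sub>R W_frac a u x) (at x within {0..T})"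
    proof (cases "x = 0")
      case False
      then show ?thesis by (intro tendsto_intros Wx) auto
    next
      case True
      \<comment> \<open>For \<open>a < 0\<close> the factor \<open>t powr a\<close> is unbounded
        near 0; the rate \<open>sqrt t\<close> still forces the limit 0, which agrees with the
        default value \<open>0 powr a = 0\<close>.\<close>
      have bd: "norm (t powr a *\<^sub>R W_frac a u t) \<le> M * t powr (a + 1/2)" if "t \<in> {0..T}" for t
      proof -
        have "norm (t powr a *\<^sub>R W_frac a u t) \<le> t powr a * (M * sqrt t)"
          using W[of t] that by (auto intro!: mult_left_mono)
        also have "\<dots> = M * t powr (a + 1/2)"
          using that by (simp add: powr_add powr_half_sqrt)
        finally show ?thesis .
      qed
      have "((\<lambda>t. M * \<bar>t\<bar> powr (a + 1/2)) \<longlongrightarrow> M * \<bar>0\<bar> powr (a + 1/2)) (at 0 within {0..T})"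
        using a by (intro tendsto_intros tendsto_powr') auto
      then have "((\<lambda>t. M * \<bar>t\<bar> powr (a + 1/2)) \<longlongrightarrow> 0) (at 0 within {0..T})" by simp
      then have "((\<lambda>t. t powr a *\<^sub>R W_frac a u t) \<longlongrightarrow> 0) (at 0 within {0..T})"
        by (rule Lim_null_comparison[rotated]) (use bd in \<open>auto simp: eventually_at_filter\<close>)
      then show ?thesis using True by simp
    qed
  qed
  ultimately show ?thesis
    unfolding V_frac_def[abs_def] by (intro continuous_on_diff continuous_on_scaleR[OF continuous_on_const])
qed

section \<open>Injectivity of the fractional transform\<close>

lemma integral_zero_continuous:
  fixes h :: "real \<Rightarrow> 'a::euclidean_space"
  assumes T: "0 < T" and h: "continuous_on {0..T} h"
    and z: "\<And>t. 0 \<le> t \<Longrightarrow> t \<le> T \<Longrightarrow> (LINT s:{0..t}|lborel. h s) = 0"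
    and t: "t \<in> {0..T}"
  shows "h t = 0"
proof -
  have "((\<lambda>t. integral {0..t} h) has_vector_derivative h t) (at t within {0..T})"
    by (rule integral_has_vector_derivative[OF h t])
  moreover have "integral {0..x} h = 0" if "x \<in> {0..T}" for x
  proof -
    have "set_integrable lborel {0..x} h"
      by (rule borel_integrable_atLeastAtMost'[OF continuous_on_subset[OF h]]) (use that in auto)
    then show ?thesis using z[of x] that by (simp add: set_borel_integral_eq_integral)
  qed
  then have "((\<lambda>t. integral {0..t} h) has_vector_derivative 0) (at t within {0..T})"
    using t by (intro has_vector_derivative_transform[OF t _ has_vector_derivative_const[of 0]]) auto
  ultimately show ?thesis
    using vector_derivative_unique_within_closed_interval[of 0 T t] T t by auto
qed

text \<open>The hypothesis \<open>-1/4 < a\<close>, that is \<open>H > 1/4\<close>, makes \<open>\<bar>a\<bar> / (a + 1/2) < 1\<close>, so that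
  iterating \<open>t\<^sup>a W(t) = a \<integral>\<^sub>0\<^sup>t r\<^sup>a\<^sup>-\<^sup>1 W(r) dr\<close> contracts the weighted bound \<open>\<bar>W(t)\<bar> \<le> M \<surd>t\<close> to zero.\<close>

lemma W_frac_zero:
  fixes u :: "real \<Rightarrow> 'a::{banach, second_countable_topology}"
  assumes a: "-1/4 < a" "a < 1/2"
    and [measurable]: "u \<in> borel_measurable borel"
    and u: "set_integrable lborel {0..T} (\<lambda>t. (norm (u t))\<^sup>2)"
    and V: "\<And>t. 0 \<le> t \<Longrightarrow> t \<le> T \<Longrightarrow> V_frac a u t = 0"
    and t: "0 \<le> t" "t \<le> T"
  shows "W_frac a u t = 0"
proof -
  define \<kappa> where "\<kappa> = \<bar>a\<bar> / (a + 1/2)"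
  define M where "M = W_bound a * L2_norm_on T u"
  have a': "-1/2 < a" using a by simp
  have \<kappa>: "0 \<le> \<kappa>" "\<kappa> < 1" using a by (auto simp: \<kappa>_def field_simps)
  have it: "norm (W_frac a u t) \<le> M * \<kappa> ^ n * sqrt t" if "0 \<le> t" "t \<le> T" for n t
    using that
  proof (induction n arbitrary: t)
    case 0
    then show ?case
      using W_frac_bound(2)[OF a' a(2) _ u, of t] by (simp add: M_def mult_ac)
  next
    case (Suc n)
    show ?case
    proof (cases "t = 0")
      case True
      then show ?thesis using W_frac_bound(2)[OF a' a(2) _ u, of 0] Suc.prems by simp
    next
      case False
      then have t0: "0 < t" using Suc.prems by simp
      let ?I = "LINT r:{0..t}|lborel. r powr (a - 1) *\<^sub>R W_frac a u r"
      have eq: "t powr a *\<^sub>R W_frac a u t = a *\<^sub>R ?I"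
        using V[of t] Suc.prems by (simp add: V_frac_def)
      have "t powr a * norm (W_frac a u t) = norm (t powr a *\<^sub>R W_frac a u t)" by simp
      also have "\<dots> = \<bar>a\<bar> * norm ?I" unfolding eq by simp
      also have "\<dots> \<le> \<bar>a\<bar> * (M * \<kappa> ^ n * t powr (a + 1/2) / (a + 1/2))"
        by (intro mult_left_mono integral_powr_W_frac(2)[OF a' a(2)]) (use Suc in auto)
      also have "\<dots> = t powr a * (M * \<kappa> ^ Suc n * sqrt t)"
        using t0 a by (simp add: \<kappa>_def powr_add powr_half_sqrt)
      finally show ?thesis using t0 by simp
    qed
  qed
  have "(\<lambda>n. M * \<kappa> ^ n * sqrt t) \<longlonglongrightarrow> M * 0 * sqrt t"
    by (intro tendsto_intros LIMSEQ_realpow_zero \<kappa>)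
  then have "norm (W_frac a u t) \<le> M * 0 * sqrt t"
    by (rule LIMSEQ_le_const) (use it t in auto)
  then show ?thesis by simp
qed

text \<open>Once \<open>W_frac\<close> vanishes, the weighted function \<open>v\<close> is recovered
  by applying a fractional integral of order \<open>1 - a\<close>, which is positive for both signs
  of \<open>a\<close>. The orders add up to 2, so the double primitive of \<open>v\<close> is 0; its
  inner primitive is continuous and therefore 0, and \<open>v\<close> vanishes almost
  everywhere.\<close>

lemma V_frac_injective:
  fixes u :: "real \<Rightarrow> 'a::euclidean_space"
  assumes a: "-1/4 < a" "a < 1/2" and T: "0 < T"
    and [measurable]: "u \<in> borel_measurable borel"
    and u: "set_integrable lborel {0..T} (\<lambda>t. (norm (u t))\<^sup>2)"
    and V: "\<And>t. 0 \<le> t \<Longrightarrow> t \<le> T \<Longrightarrow> V_frac a u t = 0"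
  shows "AE t in lborel. t \<in> {0..T} \<longrightarrow> u t = 0"
proof -
  define v where "v s = s powr (- a) *\<^sub>R u s" for s
  have [measurable]: "v \<in> borel_measurable borel" unfolding v_def by measurable
  have v: "set_integrable lborel {0..T} v"
    using weighted_integrable[OF a(2) _ u] T by (simp add: v_def[abs_def])
  have vt: "set_integrable lborel {0..t} v" if "t \<le> T" for t
    by (rule set_integrable_subset[OF v]) (use that in auto)
  have W: "RL (a + 1) v t = 0" if "0 \<le> t" "t \<le> T" for t
    using W_frac_zero[OF a _ u V that] by (simp add: W_frac_def v_def[abs_def])
  have R2: "RL 2 v t = 0" if "0 \<le> t" "t \<le> T" for t
  proof -
    have "RL (1 - a) (RL (a + 1) v) t = Beta (1 - a) (a + 1) *\<^sub>R RL ((1 - a) + (a + 1)) v t"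
      by (rule RL_RL(2)) (use a vt that in auto)
    moreover have "RL (1 - a) (RL (a + 1) v) t = (LINT s:{0..t}|lborel. 0)"
      unfolding RL_def[of "1 - a"]
      by (rule set_lebesgue_integral_cong) (use W that in auto)
    ultimately show ?thesis using Beta_real_pos[of "1 - a" "a + 1"] a by simp
  qed
  have "(LINT r:{0..t}|lborel. LINT s:{0..r}|lborel. v s) = 0" if "0 \<le> t" "t \<le> T" for t
    using RL_of_integral[of v 1 t] RL_integral(2)[of v 1 t] vt[of t] R2[of t] that by (simp add: RL_one)
  then have "(LINT s:{0..t}|lborel. v s) = 0" if "0 \<le> t" "t \<le> T" for t
    using integral_zero_continuous[OF T continuous_on_LINT[OF v]] that by auto
  then have "AE t in lborel. t \<in> {0..T} \<longrightarrow> v t = 0"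
    by (rule AE_zero_if_integrals_zero[OF v])
  with AE_lborel_neq[of 0] show ?thesis
    by eventually_elim (auto simp: v_def)
qed

text \<open>Integration by parts for \<open>t powr a\<close> times a primitive. Since
  \<open>\<Psi>\<close> is only integrable it is obtained from Fubini, with \<integral> a r^(a-1) dr
  = t^a - q^a over \<open>{q..t}\<close>. The left side has the shape of
  \<open>V_frac\<close>.\<close>

lemma weighted_primitive_by_parts:
  fixes \<Psi> :: "real \<Rightarrow> 'a::euclidean_space"
  assumes [measurable]: "\<Psi> \<in> borel_measurable borel"
    and t: "0 \<le> t"
    and \<Psi>: "set_integrable lborel {0..t} \<Psi>"
    and \<Psi>a: "set_integrable lborel {0..t} (\<lambda>q. q powr a *\<^sub>R \<Psi> q)"
  shows "t powr a *\<^sub>R (LINT q:{0..t}|lborel. \<Psi> q)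
           - a *\<^sub>R (LINT r:{0..t}|lborel. r powr (a - 1) *\<^sub>R (LINT q:{0..r}|lborel. \<Psi> q))
         = (LINT q:{0..t}|lborel. q powr a *\<^sub>R \<Psi> q)"
proof (cases "a = 0 \<or> t = 0")
  case True
  have ae: "AE q in lborel. q \<in> {0..t} \<longrightarrow> q powr a *\<^sub>R \<Psi> q = \<Psi> q" if "a = 0"
    using AE_lborel_neq[of 0] by eventually_elim (simp add: that)
  have "(LINT q:{0..t}|lborel. q powr a *\<^sub>R \<Psi> q) = (LINT q:{0..t}|lborel. \<Psi> q)" if "a = 0"
    by (rule set_lebesgue_integral_cong_AE) (use ae[OF that] in auto)
  moreover have "(LINT q:{0..t}|lborel. f q) = 0" if "t = 0" for f :: "real \<Rightarrow> 'a"
    unfolding set_lebesgue_integral_def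
  proof (rule integral_eq_zero_AE)
    show "AE q in lborel. indicator {0..t} q *\<^sub>R f q = 0"
      using AE_lborel_neq[of 0] by eventually_elim (simp add: that)
  qed
  ultimately show ?thesis using True by (cases "t = 0") auto
next
  case False
  then have a0: "a \<noteq> 0" and t0: "0 < t" using t by auto
  define k where "k q r = r powr (a - 1) *\<^sub>R \<Psi> q" for q r :: real
  \<comment> \<open>The first factor is the integral of \<open>r powr (a - 1)\<close> over
    \<open>{q..t}\<close>, hence nonnegative for either sign of \<open>a\<close>.\<close>
  define \<beta> where "\<beta> q = (t powr a - q powr a) / a * norm (\<Psi> q)" for q
  have nn: "(\<integral>\<^sup>+r\<in>{q..t}. ennreal (r powr (a - 1)) \<partial>lborel) = ennreal ((t powr a - q powr a) / a)"
    and ge: "0 \<le> (t powr a - q powr a) / a"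
    and hb: "has_bochner_integral lborel (\<lambda>r. r powr (a - 1) * indicator {q..t} r) ((t powr a - q powr a) / a)"
    if "0 < q" "q \<le> t" for q
  proof -
    have *: "((\<lambda>r. r powr a / a) has_real_derivative r powr (a - 1)) (at r)" if "q \<le> r" "r \<le> t" for r
      using that \<open>0 < q\<close> a0 by (auto intro!: derivative_eq_intros simp: field_simps)
    show "(\<integral>\<^sup>+r\<in>{q..t}. ennreal (r powr (a - 1)) \<partial>lborel) = ennreal ((t powr a - q powr a) / a)"
      using nn_integral_FTC_Icc[of "\<lambda>r. r powr (a - 1)" q t "\<lambda>r. r powr a / a"] * \<open>q \<le> t\<close>
      by (simp add: diff_divide_distrib has_real_derivative_iff_has_vector_derivative)
    show hb: "has_bochner_integral lborel (\<lambda>r. r powr (a - 1) * indicator {q..t} r) ((t powr a - q powr a) / a)"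
      using has_bochner_integral_FTC_Icc_nonneg[of "\<lambda>r. r powr (a - 1)" q t "\<lambda>r. r powr a / a"] * \<open>q \<le> t\<close>
      by (simp add: diff_divide_distrib has_real_derivative_iff_has_vector_derivative)
    show "0 \<le> (t powr a - q powr a) / a"
      unfolding has_bochner_integral_integral_eq[OF hb, symmetric]
      by (intro integral_nonneg_AE) (auto simp: indicator_def)
  qed
  have \<beta>i: "set_integrable lborel {0..t} \<beta>"
  proof -
    have n: "set_integrable lborel {0..t} (\<lambda>q. norm (f q))" if "set_integrable lborel {0..t} f" for f :: "real \<Rightarrow> 'a"
      using that unfolding set_integrable_def by (drule_tac integrable_norm) (simp add: abs_mult)
    have "set_integrable lborel {0..t} (\<lambda>q. (t powr a / a) * norm (\<Psi> q) - (1 / a) * norm (q powr a *\<^sub>R \<Psi> q))"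
      by (intro set_integral_diff set_integrable_mult_right n \<Psi> \<Psi>a)
    also have "(\<lambda>q. (t powr a / a) * norm (\<Psi> q) - (1 / a) * norm (q powr a *\<^sub>R \<Psi> q)) = \<beta>"
      using a0 by (simp add: \<beta>_def fun_eq_iff field_simps)
    finally show ?thesis .
  qed
  have int: "integrable (lborel \<Otimes>\<^sub>M lborel)
      (\<lambda>(q, r). indicator {0..t} r *\<^sub>R indicator {0..r} q *\<^sub>R k q r)"
  proof (rule triangle_integrable_fstI[OF _ _ \<beta>i])
    show "(\<lambda>(q, r). k q r) \<in> borel_measurable (borel \<Otimes>\<^sub>M borel)"
      unfolding k_def by measurable
    fix q assume q: "0 < q" "q < t"
    have "(\<integral>\<^sup>+r\<in>{q..t}. ennreal (norm (k q r)) \<partial>lborel)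
      = (\<integral>\<^sup>+r. ennreal (norm (\<Psi> q)) * (ennreal (r powr (a - 1)) * indicator {q..t} r) \<partial>lborel)"
      by (intro nn_integral_cong) (auto simp: k_def indicator_def ennreal_mult[symmetric] mult_ac)
    also have "\<dots> = ennreal (norm (\<Psi> q)) * ennreal ((t powr a - q powr a) / a)"
      using nn[of q] q by (subst nn_integral_cmult) auto
    also have "\<dots> = ennreal (\<beta> q)"
      using ge[of q] q by (simp add: ennreal_mult[symmetric] \<beta>_def mult_ac)
    finally show "(\<integral>\<^sup>+r\<in>{q..t}. ennreal (norm (k q r)) \<partial>lborel) \<le> ennreal (\<beta> q)" by simp
  qed
  have R: "(LINT q:{0..r}|lborel. k q r) = r powr (a - 1) *\<^sub>R (LINT q:{0..r}|lborel. \<Psi> q)" for r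
    by (simp add: k_def)
  have L: "(LINT r:{q..t}|lborel. k q r) = ((t powr a - q powr a) / a) *\<^sub>R \<Psi> q" if "0 < q" "q \<le> t" for q
  proof -
    have "(LINT r:{q..t}|lborel. k q r) = (LINT r|lborel. (r powr (a - 1) * indicator {q..t} r) *\<^sub>R \<Psi> q)"
      unfolding set_lebesgue_integral_def k_def by (simp add: mult_ac)
    also have "\<dots> = ((t powr a - q powr a) / a) *\<^sub>R \<Psi> q"
      using hb[OF that] by (subst integral_scaleR_left) (auto simp: has_bochner_integral_iff)
    finally show ?thesis .
  qed
  have "(LINT r:{0..t}|lborel. r powr (a - 1) *\<^sub>R (LINT q:{0..r}|lborel. \<Psi> q)) = (LINT q:{0..t}|lborel. LINT r:{q..t}|lborel. k q r)"
    using triangle_Fubini(3)[OF int] by (simp only: R)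
  also have "\<dots> = (LINT q:{0..t}|lborel. ((t powr a - q powr a) / a) *\<^sub>R \<Psi> q)"
    unfolding set_lebesgue_integral_def[of _ "{0..t}"]
  proof (rule integral_cong_AE)
    show "(\<lambda>q. indicator {0..t} q *\<^sub>R (LINT r:{q..t}|lborel. k q r)) \<in> borel_measurable lborel"
      using triangle_Fubini(2)[OF int] unfolding set_integrable_def by (rule borel_measurable_integrable)
    show "AE q in lborel. indicator {0..t} q *\<^sub>R (LINT r:{q..t}|lborel. k q r)
       = indicator {0..t} q *\<^sub>R ((t powr a - q powr a) / a) *\<^sub>R \<Psi> q"
      using AE_lborel_neq[of 0]
    proof eventually_elim
      fix q :: real assume "q \<noteq> 0"
      then show "indicator {0..t} q *\<^sub>R (LINT r:{q..t}|lborel. k q r)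
       = indicator {0..t} q *\<^sub>R ((t powr a - q powr a) / a) *\<^sub>R \<Psi> q"
        using L[of q] by (cases "q \<in> {0..t}") simp_all
    qed
  qed measurable
  also have "a *\<^sub>R \<dots> = (LINT q:{0..t}|lborel. t powr a *\<^sub>R \<Psi> q - q powr a *\<^sub>R \<Psi> q)"
    using a0 by (simp add: set_integral_scaleR_right[symmetric] scaleR_diff_left del: set_integral_scaleR_right)
  also have "\<dots> = t powr a *\<^sub>R (LINT q:{0..t}|lborel. \<Psi> q) - (LINT q:{0..t}|lborel. q powr a *\<^sub>R \<Psi> q)"
    by (subst set_integral_diff) (use \<Psi> \<Psi>a in auto)
  finally show ?thesis by simp
qed

text \<open>Integrability of \<open>f\<close> is decided inside the proof: if it fails, the Bochner
  integral is 0 by convention and the bound is trivial.\<close>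

lemma set_integral_norm_le_nn:
  fixes f :: "real \<Rightarrow> 'a::{banach, second_countable_topology}"
  assumes "(\<integral>\<^sup>+x\<in>A. ennreal (norm (f x)) \<partial>lborel) \<le> ennreal B" "0 \<le> B"
  shows "norm (LINT x:A|lborel. f x) \<le> B"
proof (cases "set_integrable lborel A f")
  case True
  have "ennreal (norm (LINT x:A|lborel. f x)) \<le> (\<integral>\<^sup>+x. ennreal (norm (indicator A x *\<^sub>R f x)) \<partial>lborel)"
    unfolding set_lebesgue_integral_def
    by (rule integral_norm_bound_ennreal) (use True in \<open>simp add: set_integrable_def\<close>)
  also have "\<dots> = (\<integral>\<^sup>+x\<in>A. ennreal (norm (f x)) \<partial>lborel)"
    by (intro nn_integral_cong) (auto simp: indicator_def)
  also note assms(1)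
  finally show ?thesis using assms(2) by simp
next
  case False
  then have "(LINT x:A|lborel. f x) = 0"
    unfolding set_lebesgue_integral_def set_integrable_def by (rule not_integrable_integral_eq)
  then show ?thesis using assms(2) by simp
qed

section \<open>The range of the kernel operator\<close>

text \<open>The integrated form of V' = t^a W'. It turns the Hoelder estimate and the range of
  \<open>V_frac\<close> into questions about a density of \<open>W_frac\<close>.\<close>

lemma V_frac_of_primitive:
  fixes u \<Psi> :: "real \<Rightarrow> 'a::euclidean_space"
  assumes [measurable]: "\<Psi> \<in> borel_measurable borel"
    and \<Psi>: "set_integrable lborel {0..T} \<Psi>"
    and \<Psi>a: "set_integrable lborel {0..T} (\<lambda>q. q powr a *\<^sub>R \<Psi> q)"
    and W: "\<And>t. 0 \<le> t \<Longrightarrow> t \<le> T \<Longrightarrow> W_frac a u t = (LINT q:{0..t}|lborel. \<Psi> q)"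
    and t: "0 \<le> t" "t \<le> T"
  shows "V_frac a u t = (LINT q:{0..t}|lborel. q powr a *\<^sub>R \<Psi> q)"
proof -
  have "(LINT r:{0..t}|lborel. r powr (a - 1) *\<^sub>R W_frac a u r)
      = (LINT r:{0..t}|lborel. r powr (a - 1) *\<^sub>R (LINT q:{0..r}|lborel. \<Psi> q))"
    by (intro set_lebesgue_integral_cong) (use W t in auto)
  moreover have "set_integrable lborel {0..t} \<Psi>" "set_integrable lborel {0..t} (\<lambda>q. q powr a *\<^sub>R \<Psi> q)"
    by (rule set_integrable_subset[OF \<Psi>] set_integrable_subset[OF \<Psi>a]; use t in auto)+
  ultimately show ?thesis
    using weighted_primitive_by_parts[of \<Psi> t a] W[of t] t by (simp add: V_frac_def)
qed

text \<open>The density of \<open>V_frac\<close> is a fractional integral of order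
  \<open>a < 1/2\<close>, whose kernel need not be square integrable. A weighted inequality xy \<le>
  l x^2 + y^2 / l separates a constant part, with factor \<open>l\<close>, from
  \<open>RL a U\<close>, which is integrable because U = |u|^2 is. Integrating over
  \<open>{s..t}\<close> and choosing \<open>l\<close> for that interval yields the exponent
  1/2.\<close>

lemma V_frac_Hoelder:
  fixes u :: "real \<Rightarrow> 'a::euclidean_space"
  assumes a: "0 < a" "a < 1/2"
    and [measurable]: "u \<in> borel_measurable borel"
    and u: "set_integrable lborel {0..T} (\<lambda>t. (norm (u t))\<^sup>2)"
    and T: "0 \<le> T"
  shows "\<exists>C. \<forall>s t. 0 \<le> s \<longrightarrow> s < t \<longrightarrow> t \<le> T \<longrightarrow> norm (V_frac a u t - V_frac a u s) \<le> C * sqrt (t - s)"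
proof -
  define v where "v s = s powr (- a) *\<^sub>R u s" for s
  define \<psi> where "\<psi> = RL a v"
  define \<Psi> where "\<Psi> q = a *\<^sub>R \<psi> q" for q
  define U where "U s = (norm (u s))\<^sup>2" for s
  have [measurable]: "v \<in> borel_measurable borel" unfolding v_def by measurable
  have [measurable]: "\<psi> \<in> borel_measurable borel" unfolding \<psi>_def by measurable
  have [measurable]: "\<Psi> \<in> borel_measurable borel" unfolding \<Psi>_def by measurable
  have [measurable]: "U \<in> borel_measurable borel" unfolding U_def by measurable
  have v: "set_integrable lborel {0..T} v"
    using weighted_integrable[OF a(2) _ u T] by (simp add: v_def[abs_def])
  have \<psi>: "set_integrable lborel {0..T} \<psi>"
    unfolding \<psi>_def by (rule RL_integral(1)) (use a v in auto)
  have \<Psi>: "set_integrable lborel {0..T} \<Psi>"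
    unfolding \<Psi>_def by (intro set_integrable_scaleR_right \<psi>)
  have \<Psi>a: "set_integrable lborel {0..T} (\<lambda>q. q powr a *\<^sub>R \<Psi> q)"
  proof (rule set_integrable_bound)
    show "set_integrable lborel {0..T} (\<lambda>q. T powr a *\<^sub>R \<Psi> q)"
      by (intro set_integrable_scaleR_right \<Psi>)
    show "set_borel_measurable lborel {0..T} (\<lambda>q. q powr a *\<^sub>R \<Psi> q)"
      unfolding set_borel_measurable_def by measurable
    show "AE q in lborel. q \<in> {0..T} \<longrightarrow> norm (q powr a *\<^sub>R \<Psi> q) \<le> norm (T powr a *\<^sub>R \<Psi> q)"
      using a by (auto intro!: AE_I2 mult_right_mono powr_mono2)
  qed
  have V: "V_frac a u t = (LINT q:{0..t}|lborel. q powr a *\<^sub>R \<Psi> q)" if "0 \<le> t" "t \<le> T" for t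
  proof (rule V_frac_of_primitive[OF _ \<Psi> \<Psi>a _ that])
    fix t assume t: "0 \<le> t" "t \<le> T"
    have vt: "set_integrable lborel {0..t} v" by (rule set_integrable_subset[OF v]) (use t in auto)
    have "W_frac a u t = RL (a + 1) v t" by (simp add: W_frac_def v_def[abs_def])
    also have "\<dots> = a *\<^sub>R (LINT q:{0..t}|lborel. \<psi> q)"
      using RL_integral(2)[of v a t] a vt by (simp add: \<psi>_def)
    finally show "W_frac a u t = (LINT q:{0..t}|lborel. \<Psi> q)" by (simp add: \<Psi>_def)
  qed simp
  have Ui: "set_integrable lborel {0..T} U" using u by (simp add: U_def[abs_def])
  have RU: "set_integrable lborel {0..T} (RL a U)"
    "(LINT r:{0..T}|lborel. RL a U r) = (1 / a) *\<^sub>R RL (a + 1) U T"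
    "AE q in lborel. q \<in> {0..T} \<longrightarrow> set_integrable lborel {0..q} (\<lambda>s. (q - s) powr (a - 1) *\<^sub>R U s)"
    using RL_integral[of U a T] a Ui by auto
  have RU0: "0 \<le> RL a U q" for q
    unfolding RL_def set_lebesgue_integral_def by (intro integral_nonneg_AE) (auto simp: U_def)
  define R where "R = (LINT r:{0..T}|lborel. RL a U r)"
  have R0: "0 \<le> R"
    unfolding R_def set_lebesgue_integral_def using RU0 by (intro integral_nonneg_AE) auto
  \<comment> \<open>By scaling, the Beta integral of
    \<open>(q - s) powr (a - 1) * s powr (- 2 * a)\<close> over \<open>{0..q}\<close> is
    \<open>B * q powr (- a)\<close>; the outer weight \<open>q powr a\<close> cancels that power, so
    the bound is constant in \<open>q\<close>.\<close>
  define B where "B = Beta a (1 - 2 * a)"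
  have bound: "AE q in lborel. q \<in> {0..T} \<longrightarrow>
      norm (q powr a *\<^sub>R \<Psi> q) \<le> l * B + T powr a / l * RL a U q" if l: "0 < l" for l
    using RU(3) AE_lborel_neq[of 0]
  proof eventually_elim
    fix q assume UI: "q \<in> {0..T} \<longrightarrow> set_integrable lborel {0..q} (\<lambda>s. (q - s) powr (a - 1) *\<^sub>R U s)" and q0: "q \<noteq> 0"
    show "q \<in> {0..T} \<longrightarrow> norm (q powr a *\<^sub>R \<Psi> q) \<le> l * B + T powr a / l * RL a U q"
    proof
      assume q: "q \<in> {0..T}"
      then have q': "0 < q" using q0 by auto
      let ?l = "l * q powr 0"
      define m where "m s = l * ((q - s) powr (a - 1) * (s - 0) powr ((1 - 2 * a) - 1)) + (1 / l) * ((q - s) powr (a - 1) *\<^sub>R U s)" for s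
      have mi: "set_integrable lborel {0..q} (\<lambda>s. (q - s) powr (a - 1) * (s - 0) powr ((1 - 2 * a) - 1))"
        "(LINT s:{0..q}|lborel. (q - s) powr (a - 1) * (s - 0) powr ((1 - 2 * a) - 1)) = B * q powr (- a)"
        using Beta_Icc[of a "1 - 2 * a" 0 q] a q' by (auto simp: B_def)
      have mI: "set_integrable lborel {0..q} m"
        unfolding m_def using UI q by (intro set_integral_add set_integrable_mult_right mi) auto
      have mV: "(LINT s:{0..q}|lborel. m s) = l * (B * q powr (- a)) + (1 / l) * RL a U q"
        unfolding m_def using UI q mi by (simp add: set_integral_add RL_def)
      have le: "norm ((q - s) powr (a - 1) *\<^sub>R v s) \<le> m s" for s
      proof -
        have am: "x * y \<le> l * x\<^sup>2 + (1 / l) * y\<^sup>2" if "0 \<le> x" "0 \<le> y" for x y :: real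
        proof -
          have "0 \<le> (l * x - y)\<^sup>2 / l" using l by simp
          also have "\<dots> = l * x\<^sup>2 + (1 / l) * y\<^sup>2 - 2 * (x * y)" using l by (simp add: power2_eq_square field_simps)
          finally show ?thesis using that mult_nonneg_nonneg[OF that] by linarith
        qed
        have "(s powr (- a))\<^sup>2 = s powr ((1 - 2 * a) - 1)" by (simp add: powr_square)
        then have "s powr (- a) * norm (u s) \<le> l * s powr ((1 - 2 * a) - 1) + (1 / l) * U s"
          using am[of "s powr (- a)" "norm (u s)"] by (simp add: U_def)
        then have "(q - s) powr (a - 1) * (s powr (- a) * norm (u s)) \<le> (q - s) powr (a - 1) * (l * s powr ((1 - 2 * a) - 1) + (1 / l) * U s)"
          by (rule mult_left_mono) simp
        then show ?thesis by (simp add: v_def m_def algebra_simps)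
      qed
      have vI: "set_integrable lborel {0..q} (\<lambda>s. (q - s) powr (a - 1) *\<^sub>R v s)"
      proof (rule set_integrable_bound[OF mI])
        show "set_borel_measurable lborel {0..q} (\<lambda>s. (q - s) powr (a - 1) *\<^sub>R v s)"
          unfolding set_borel_measurable_def by measurable
        show "AE s in lborel. s \<in> {0..q} \<longrightarrow> norm ((q - s) powr (a - 1) *\<^sub>R v s) \<le> norm (m s)"
          by (intro AE_I2 impI order.trans[OF le]) simp
      qed
      have "norm (\<psi> q) \<le> (LINT s:{0..q}|lborel. m s)"
        unfolding \<psi>_def RL_def by (rule set_integral_norm_bound[OF vI mI le])
      then have "norm (\<psi> q) \<le> l * (B * q powr (- a)) + (1 / l) * RL a U q" unfolding mV .
      then have "q powr a * norm (\<psi> q) \<le> q powr a * (l * (B * q powr (- a)) + (1 / l) * RL a U q)"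
        by (rule mult_left_mono) simp
      also have "\<dots> = l * B + q powr a * ((1 / l) * RL a U q)"
        using q' by (simp add: powr_minus field_simps)
      also have "q powr a * ((1 / l) * RL a U q) \<le> T powr a * ((1 / l) * RL a U q)"
        using q a l RU0 by (intro mult_right_mono powr_mono2) auto
      finally have *: "q powr a * norm (\<psi> q) \<le> l * B + T powr a / l * RL a U q" by simp
      have "norm (q powr a *\<^sub>R \<Psi> q) = a * (q powr a * norm (\<psi> q))" using a by (simp add: \<Psi>_def)
      also have "\<dots> \<le> 1 * (q powr a * norm (\<psi> q))" using a by (intro mult_right_mono) auto
      finally show "norm (q powr a *\<^sub>R \<Psi> q) \<le> l * B + T powr a / l * RL a U q" using * by simp
    qed
  qed
  have "norm (V_frac a u t - V_frac a u s) \<le> (B + T powr a * R) * sqrt (t - s)" if st: "0 \<le> s" "s < t" "t \<le> T" for s t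
  proof -
    define \<delta> where "\<delta> = t - s"
    \<comment> \<open>Balances \<open>l * B * \<delta>\<close> against
      \<open>T powr a / l * R\<close>: both become multiples of
      \<open>sqrt \<delta>\<close>.\<close>
    define l where "l = 1 / sqrt \<delta>"
    have \<delta>: "0 < \<delta>" and l: "0 < l" using st by (auto simp: \<delta>_def l_def)
    have i: "set_integrable lborel A (\<lambda>q. q powr a *\<^sub>R \<Psi> q)" if "A \<in> {{0..s}, {s..t}, {0..t}}" for A
      by (rule set_integrable_subset[OF \<Psi>a]) (use that st in auto)
    have RI: "set_integrable lborel {s..t} (RL a U)"
      by (rule set_integrable_subset[OF RU(1)]) (use st in auto)
    have "(LINT q:{0..t}|lborel. q powr a *\<^sub>R \<Psi> q) = (LINT q:{0..s} \<union> {s..t}|lborel. q powr a *\<^sub>R \<Psi> q)"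
      using st by (simp add: ivl_disj_un_two_touch)
    also have "\<dots> = (LINT q:{0..s}|lborel. q powr a *\<^sub>R \<Psi> q) + (LINT q:{s..t}|lborel. q powr a *\<^sub>R \<Psi> q)"
    proof (rule set_integral_Un_AE)
      show "AE x in lborel. \<not> (x \<in> {0..s} \<and> x \<in> {s..t})"
        using AE_lborel_neq[of s] by eventually_elim auto
    qed (use i in auto)
    finally have "V_frac a u t - V_frac a u s = (LINT q:{s..t}|lborel. q powr a *\<^sub>R \<Psi> q)"
      using V[of t] V[of s] st by simp
    also have "norm \<dots> \<le> (LINT q:{s..t}|lborel. norm (q powr a *\<^sub>R \<Psi> q))"
      by (rule set_integral_norm_bound[OF i set_integrable_norm[OF i]]) auto
    also have "\<dots> \<le> (LINT q:{s..t}|lborel. l * B + T powr a / l * RL a U q)"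
    proof (rule set_integral_mono_AE)
      show "set_integrable lborel {s..t} (\<lambda>q. norm (q powr a *\<^sub>R \<Psi> q))"
        by (rule set_integrable_norm[OF i]) auto
      show "set_integrable lborel {s..t} (\<lambda>q. l * B + T powr a / l * RL a U q)"
        by (intro set_integral_add set_integrable_mult_right RI borel_integrable_atLeastAtMost' continuous_intros)
      show "AE q\<in>{s..t} in lborel. norm (q powr a *\<^sub>R \<Psi> q) \<le> l * B + T powr a / l * RL a U q"
        using bound[OF l] by eventually_elim (use st in auto)
    qed
    also have "\<dots> = l * B * \<delta> + T powr a / l * (LINT q:{s..t}|lborel. RL a U q)"
    proof -
      have "(LINT q:{s..t}|lborel. l * B) = l * B * \<delta>"
        using st by (simp add: set_lebesgue_integral_def \<delta>_def)
      moreover have "set_integrable lborel {s..t} (\<lambda>q. l * B)"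
        by (intro borel_integrable_atLeastAtMost' continuous_intros)
      ultimately show ?thesis using RI by (simp add: set_integral_add)
    qed
    also have "(LINT q:{s..t}|lborel. RL a U q) \<le> R"
      unfolding R_def set_lebesgue_integral_def
      using RI RU(1) st RU0 by (intro integral_mono) (auto simp: set_integrable_def indicator_def)
    then have "T powr a / l * (LINT q:{s..t}|lborel. RL a U q) \<le> T powr a / l * R"
      using l by (intro mult_left_mono) auto
    also have "l * B * \<delta> + T powr a / l * R = (B + T powr a * R) * sqrt \<delta>"
    proof -
      have "l * \<delta> = sqrt \<delta>" using \<delta> by (simp add: l_def real_div_sqrt)
      moreover have "1 / l = sqrt \<delta>" by (simp add: l_def)
      moreover have "l * B * \<delta> + T powr a / l * R = B * (l * \<delta>) + T powr a * R * (1 / l)"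
        by (simp add: mult_ac)
      ultimately show ?thesis by (simp only: ring_distribs mult_ac)
    qed
    finally show ?thesis by (simp add: \<delta>_def)
  qed
  then show ?thesis by blast
qed

text \<open>To hit the primitive of \<open>f\<close> it suffices to solve an Abel equation for \<open>v(s) = s\<^sup>-\<^sup>a u(s)\<close>; the
  bound on \<open>v\<close> makes \<open>u\<close> square integrable because \<open>a < 1/2\<close>.\<close>

lemma V_frac_range_core:
  fixes f v :: "real \<Rightarrow> 'a::euclidean_space"
  assumes a: "-1/2 < a" "a < 1/2" and T: "0 \<le> T"
    and [measurable]: "f \<in> borel_measurable borel" "v \<in> borel_measurable borel"
    and f: "\<And>t. t \<in> {0..T} \<Longrightarrow> norm (f t) \<le> B"
    and v: "\<And>t. 0 < t \<Longrightarrow> t \<le> T \<Longrightarrow> norm (v t) \<le> C * t powr (- 2 * a)"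
    and R: "\<And>t. 0 \<le> t \<Longrightarrow> t \<le> T \<Longrightarrow> RL (a + 1) v t = (LINT q:{0..t}|lborel. q powr (- a) *\<^sub>R f q)"
  shows "\<exists>u. u \<in> borel_measurable borel \<and> set_integrable lborel {0..T} (\<lambda>t. (norm (u t))\<^sup>2) \<and>
     (\<forall>t\<in>{0..T}. V_frac a u t = (LINT q:{0..t}|lborel. f q))"
proof (intro exI conjI ballI)
  define u where "u s = s powr a *\<^sub>R v s" for s
  show um [measurable]: "u \<in> borel_measurable borel" unfolding u_def by measurable
  have pI: "set_integrable lborel {0..T} (\<lambda>s. s powr c)" if "-1 < c" for c
    using integral_powr_from_zero(1)[OF that T] .
  show "set_integrable lborel {0..T} (\<lambda>t. (norm (u t))\<^sup>2)"
  proof (rule set_integrable_bound)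
    show "set_integrable lborel {0..T} (\<lambda>s. C\<^sup>2 * s powr (- 2 * a))"
      by (intro set_integrable_mult_right pI) (use a in auto)
    show "set_borel_measurable lborel {0..T} (\<lambda>t. (norm (u t))\<^sup>2)"
      unfolding set_borel_measurable_def by measurable
    show "AE s in lborel. s \<in> {0..T} \<longrightarrow> norm ((norm (u s))\<^sup>2) \<le> norm (C\<^sup>2 * s powr (- 2 * a))"
      using AE_lborel_neq[of 0]
    proof eventually_elim
      fix s :: real assume s0: "s \<noteq> 0"
      show "s \<in> {0..T} \<longrightarrow> norm ((norm (u s))\<^sup>2) \<le> norm (C\<^sup>2 * s powr (- 2 * a))"
      proof
        assume s: "s \<in> {0..T}"
        with s0 have s': "0 < s" "s \<le> T" by auto
        have "norm (u s) \<le> s powr a * (C * s powr (- 2 * a))"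
          unfolding u_def using v[OF s'] by (auto intro!: mult_left_mono)
        also have "\<dots> = C * s powr (- a)"
        proof -
          have "s powr a * s powr (- 2 * a) = s powr (- a)" by (simp add: powr_add[symmetric])
          then show ?thesis by (simp add: mult_ac)
        qed
        finally have "(norm (u s))\<^sup>2 \<le> (C * s powr (- a))\<^sup>2" by (rule power_mono) simp
        then show "norm ((norm (u s))\<^sup>2) \<le> norm (C\<^sup>2 * s powr (- 2 * a))"
          by (simp add: power_mult_distrib powr_square)
      qed
    qed
  qed
  define \<Psi> where "\<Psi> q = q powr (- a) *\<^sub>R f q" for q
  have [measurable]: "\<Psi> \<in> borel_measurable borel" unfolding \<Psi>_def by measurable
  have \<Psi>: "set_integrable lborel {0..T} \<Psi>"
  proof (rule set_integrable_bound)
    show "set_integrable lborel {0..T} (\<lambda>s. B * s powr (- a))"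
      by (intro set_integrable_mult_right pI) (use a in auto)
    show "set_borel_measurable lborel {0..T} \<Psi>"
      unfolding set_borel_measurable_def by measurable
    have "norm (\<Psi> s) \<le> B * s powr (- a)" if "s \<in> {0..T}" for s
      using f[OF that] by (simp add: \<Psi>_def mult.commute mult_right_mono)
    then show "AE s in lborel. s \<in> {0..T} \<longrightarrow> norm (\<Psi> s) \<le> norm (B * s powr (- a))"
      by (intro AE_I2 impI) force
  qed
  have eq: "AE q in lborel. q \<in> {0..t} \<longrightarrow> q powr a *\<^sub>R \<Psi> q = f q" for t
    using AE_lborel_neq[of 0] by eventually_elim (auto simp: \<Psi>_def powr_minus)
  have fI: "set_integrable lborel {0..T} f"
  proof (rule set_integrable_bound)
    show "set_integrable lborel {0..T} (\<lambda>s. B)"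
      by (intro borel_integrable_atLeastAtMost' continuous_intros)
    show "set_borel_measurable lborel {0..T} f"
      unfolding set_borel_measurable_def by measurable
    show "AE s in lborel. s \<in> {0..T} \<longrightarrow> norm (f s) \<le> norm B"
      using f by (intro AE_I2 impI) force
  qed
  have \<Psi>a: "set_integrable lborel {0..T} (\<lambda>q. q powr a *\<^sub>R \<Psi> q)"
    by (subst set_integrable_cong_AE[where g = f]) (use eq fI in auto)
  fix t assume t: "t \<in> {0..T}"
  have "V_frac a u t = (LINT q:{0..t}|lborel. q powr a *\<^sub>R \<Psi> q)"
  proof (rule V_frac_of_primitive[OF _ \<Psi> \<Psi>a])
    fix t assume t: "0 \<le> t" "t \<le> T"
    have "AE s in lborel. s \<in> {0..t} \<longrightarrow> (t - s) powr (a + 1 - 1) *\<^sub>R s powr (- a) *\<^sub>R u s = (t - s) powr (a + 1 - 1) *\<^sub>R v s"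
      using AE_lborel_neq[of 0] by eventually_elim (auto simp: u_def powr_minus)
    then have "W_frac a u t = RL (a + 1) v t"
      unfolding W_frac_def RL_def by (intro set_lebesgue_integral_cong_AE) auto
    then show "W_frac a u t = (LINT q:{0..t}|lborel. \<Psi> q)"
      using R[OF t] by (simp add: \<Psi>_def)
  qed (use t in auto)
  also have "\<dots> = (LINT q:{0..t}|lborel. f q)"
    by (rule set_lebesgue_integral_cong_AE) (use eq in auto)
  finally show "V_frac a u t = (LINT q:{0..t}|lborel. f q)" .
qed

text \<open>Here \<open>- a > 0\<close>, so the Abel equation is solved by a fractional integral of
  order \<open>- a\<close>: the orders \<open>a + 1\<close> and \<open>- a\<close> add up to 1, and
  \<open>\<kappa>\<close> removes the Beta factor. The growth \<open>t powr (- 2 * a)\<close> is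
  that of a Beta integral with exponents \<open>- a\<close> and \<open>1 - a\<close>.\<close>

lemma V_frac_range_neg:
  fixes f :: "real \<Rightarrow> 'a::euclidean_space"
  assumes a: "-1/2 < a" "a < 0" and T: "0 \<le> T"
    and [measurable]: "f \<in> borel_measurable borel"
    and f: "\<And>t. t \<in> {0..T} \<Longrightarrow> norm (f t) \<le> B"
  shows "\<exists>u. u \<in> borel_measurable borel \<and> set_integrable lborel {0..T} (\<lambda>t. (norm (u t))\<^sup>2) \<and>
     (\<forall>t\<in>{0..T}. V_frac a u t = (LINT q:{0..t}|lborel. f q))"
proof -
  define F where "F q = q powr (- a) *\<^sub>R f q" for q
  have [measurable]: "F \<in> borel_measurable borel" unfolding F_def by measurable
  define \<kappa> where "\<kappa> = 1 / Beta (a + 1) (- a)"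
  have Bp: "0 < Beta (a + 1) (- a)" using Beta_real_pos[of "a + 1" "- a"] a by auto
  define v where "v s = \<kappa> *\<^sub>R RL (- a) F s" for s
  have vm: "v \<in> borel_measurable borel" unfolding v_def by measurable
  have B0: "0 \<le> B" using f[of 0] T norm_ge_zero order_trans by (metis atLeastAtMost_iff order_refl)
  have Fb: "norm (F s) \<le> B * s powr (- a)" if "s \<in> {0..T}" for s
    using f[OF that] by (simp add: F_def mult.commute mult_right_mono)
  have FI: "set_integrable lborel {0..t} F" if t: "0 \<le> t" "t \<le> T" for t
  proof (rule set_integrable_bound)
    show "set_integrable lborel {0..t} (\<lambda>s. B * s powr (- a))"
      by (intro set_integrable_mult_right integral_powr_from_zero) (use a t in auto)
    show "set_borel_measurable lborel {0..t} F"
      unfolding set_borel_measurable_def by measurable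
    show "AE s in lborel. s \<in> {0..t} \<longrightarrow> norm (F s) \<le> norm (B * s powr (- a))"
      by (intro AE_I2 impI order.trans[OF Fb]) (use t in auto)
  qed
  show ?thesis
  proof (rule V_frac_range_core[where v = v and C = "\<kappa> * (B * Beta (- a) (1 - a))"])
    fix t assume t: "0 < t" "t \<le> T"
    have "norm (RL (- a) F t) \<le> B * (Beta (- a) (1 - a) * (t - 0) powr (- a + (1 - a) - 1))"
      unfolding RL_def
    proof (rule set_integral_norm_le_nn)
      have "(\<integral>\<^sup>+s\<in>{0..t}. ennreal (norm ((t - s) powr (- a - 1) *\<^sub>R F s)) \<partial>lborel)
         \<le> (\<integral>\<^sup>+s. ennreal B * (ennreal ((t - s) powr (- a - 1) * (s - 0) powr ((1 - a) - 1)) * indicator {0..t} s) \<partial>lborel)"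
      proof (rule nn_integral_mono)
        fix s
        have "norm ((t - s) powr (- a - 1) *\<^sub>R F s) \<le> B * ((t - s) powr (- a - 1) * s powr (- a))" if "s \<in> {0..t}"
          using mult_left_mono[OF Fb[of s], of "(t - s) powr (- a - 1)"] that t by (simp add: mult_ac)
        then show "ennreal (norm ((t - s) powr (- a - 1) *\<^sub>R F s)) * indicator {0..t} s
         \<le> ennreal B * (ennreal ((t - s) powr (- a - 1) * (s - 0) powr ((1 - a) - 1)) * indicator {0..t} s)"
          using B0 by (auto simp: indicator_def ennreal_mult[symmetric] intro!: ennreal_leI)
      qed
      also have "\<dots> = ennreal B * ennreal (Beta (- a) (1 - a) * (t - 0) powr (- a + (1 - a) - 1))"
        using nn_integral_Beta_Icc[of "- a" "1 - a" 0 t] a t by (subst nn_integral_cmult) auto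
      also have "\<dots> = ennreal (B * (Beta (- a) (1 - a) * (t - 0) powr (- a + (1 - a) - 1)))"
        using B0 Beta_real_pos[of "- a" "1 - a"] a by (subst ennreal_mult) auto
      finally show "(\<integral>\<^sup>+s\<in>{0..t}. ennreal (norm ((t - s) powr (- a - 1) *\<^sub>R F s)) \<partial>lborel)
         \<le> ennreal (B * (Beta (- a) (1 - a) * (t - 0) powr (- a + (1 - a) - 1)))" .
      show "0 \<le> B * (Beta (- a) (1 - a) * (t - 0) powr (- a + (1 - a) - 1))"
        using B0 Beta_real_pos[of "- a" "1 - a"] a by auto
    qed
    then have "\<kappa> * norm (RL (- a) F t) \<le> \<kappa> * (B * (Beta (- a) (1 - a) * (t - 0) powr (- a + (1 - a) - 1)))"
      using Bp by (intro mult_left_mono) (auto simp: \<kappa>_def)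
    then show "norm (v t) \<le> \<kappa> * (B * Beta (- a) (1 - a)) * t powr (- 2 * a)"
      using Bp by (simp add: v_def \<kappa>_def mult_ac)
  next
    fix t assume t: "0 \<le> t" "t \<le> T"
    have "RL (a + 1) v t = \<kappa> *\<^sub>R RL (a + 1) (RL (- a) F) t"
      unfolding RL_def[of "a + 1"] v_def by (simp add: scaleR_left_commute del: scaleR_scaleR)
    also have "RL (a + 1) (RL (- a) F) t = Beta (a + 1) (- a) *\<^sub>R RL ((a + 1) + (- a)) F t"
      by (rule RL_RL(2)) (use a FI t in auto)
    finally show "RL (a + 1) v t = (LINT q:{0..t}|lborel. q powr (- a) *\<^sub>R f q)"
      using Bp by (simp add: \<kappa>_def RL_one F_def[abs_def])
  qed (use a T f vm in auto)
qed

text \<open>At \<open>a = 0\<close> the density solves the Abel equation itself; only the value of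
  \<open>q powr 0\<close> at 0 has to be repaired.\<close>

lemma V_frac_range_zero:
  fixes f :: "real \<Rightarrow> 'a::euclidean_space"
  assumes T: "0 \<le> T"
    and [measurable]: "f \<in> borel_measurable borel"
    and f: "\<And>t. t \<in> {0..T} \<Longrightarrow> norm (f t) \<le> B"
  shows "\<exists>u. u \<in> borel_measurable borel \<and> set_integrable lborel {0..T} (\<lambda>t. (norm (u t))\<^sup>2) \<and>
     (\<forall>t\<in>{0..T}. V_frac 0 u t = (LINT q:{0..t}|lborel. f q))"
proof (rule V_frac_range_core[where v = f and C = B])
  fix t assume t: "0 \<le> t" "t \<le> T"
  have ae: "AE q in lborel. q \<in> {0..t} \<longrightarrow> f q = q powr (- 0) *\<^sub>R f q"
    using AE_lborel_neq[of 0] by eventually_elim auto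
  have "RL (0 + 1) f t = (LINT q:{0..t}|lborel. f q)" by (simp add: RL_one)
  also have "\<dots> = (LINT q:{0..t}|lborel. q powr (- 0) *\<^sub>R f q)"
    by (rule set_lebesgue_integral_cong_AE) (use ae in auto)
  finally show "RL (0 + 1) f t = (LINT q:{0..t}|lborel. q powr (- 0) *\<^sub>R f q)" .
qed (use T f in auto)

section \<open>Fractional derivatives for positive order\<close>

text \<open>For \<open>0 < a\<close> the Abel equation is solved by the Marchaud derivative of \<open>F\<close>. Its primitive is
  computed by replacing the singular kernel \<open>(s - r)\<^sup>-\<^sup>1\<^sup>-\<^sup>a\<close> with \<open>(s - r + \<delta>)\<^sup>-\<^sup>1\<^sup>-\<^sup>a\<close>: then Fubini
  applies to \<open>F s\<close> and \<open>F r\<close> separately, and the divergent terms \<open>\<delta>\<^sup>-\<^sup>a\<close> cancel.\<close>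

lemma shifted_power_integrals:
  fixes a \<delta> x y :: real
  assumes a: "0 < a" and \<delta>: "0 < \<delta>" and xy: "x \<le> y"
  shows "has_bochner_integral lborel (\<lambda>r. (y - r + \<delta>) powr (- 1 - a) * indicator {x..y} r)
           ((\<delta> powr (- a) - (y - x + \<delta>) powr (- a)) / a)"
    and "has_bochner_integral lborel (\<lambda>s. (s - x + \<delta>) powr (- 1 - a) * indicator {x..y} s)
           ((\<delta> powr (- a) - (y - x + \<delta>) powr (- a)) / a)"
proof -
  have e: "- 1 - a = - a - 1" by simp
  have d1: "((\<lambda>r. (y - r + \<delta>) powr (- a) / a) has_real_derivative (y - r + \<delta>) powr (- 1 - a)) (at r)"
    if "r \<in> {x..y}" for r
    unfolding e using that \<delta> a by (auto intro!: derivative_eq_intros simp: field_simps)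
  have d2: "((\<lambda>s. - ((s - x + \<delta>) powr (- a) / a)) has_real_derivative (s - x + \<delta>) powr (- 1 - a)) (at s)"
    if "s \<in> {x..y}" for s
    unfolding e using that \<delta> a by (auto intro!: derivative_eq_intros simp: field_simps)
  show "has_bochner_integral lborel (\<lambda>r. (y - r + \<delta>) powr (- 1 - a) * indicator {x..y} r)
           ((\<delta> powr (- a) - (y - x + \<delta>) powr (- a)) / a)"
    using has_bochner_integral_FTC_Icc_nonneg[OF _ d1 _ xy] by (simp add: diff_divide_distrib)
  show "has_bochner_integral lborel (\<lambda>s. (s - x + \<delta>) powr (- 1 - a) * indicator {x..y} s)
           ((\<delta> powr (- a) - (y - x + \<delta>) powr (- a)) / a)"
    using has_bochner_integral_FTC_Icc_nonneg[OF _ d2 _ xy] by (simp add: diff_divide_distrib)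
qed

lemma Marchaud_regularised:
  fixes F :: "real \<Rightarrow> 'a::{banach, second_countable_topology}"
  assumes a: "0 < a" and \<delta>: "0 < \<delta>"
    and [measurable]: "F \<in> borel_measurable borel"
    and F: "set_integrable lborel {0..t} F" and t: "0 \<le> t"
  shows "a *\<^sub>R (LINT s:{0..t}|lborel. LINT r:{0..s}|lborel. (s - r + \<delta>) powr (- 1 - a) *\<^sub>R (F s - F r))
    = (LINT r:{0..t}|lborel. (t - r + \<delta>) powr (- a) *\<^sub>R F r) - (LINT s:{0..t}|lborel. (s + \<delta>) powr (- a) *\<^sub>R F s)"
proof -
  define kB where "kB r s = (s - r + \<delta>) powr (- 1 - a) *\<^sub>R F r" for r s :: real
  \<comment> \<open>The integral of the regularised kernel over an interval of length
    \<open>x\<close>. Its divergent part \<open>\<delta> powr (- a) / a\<close> does not depend on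
    \<open>x\<close> and so drops out of \<open>P s - P (t - s)\<close>.\<close>
  define P where "P x = (\<delta> powr (- a) - (x + \<delta>) powr (- a)) / a" for x
  have I1: "has_bochner_integral lborel (\<lambda>r. (y - r + \<delta>) powr (- 1 - a) * indicator {x..y} r) (P (y - x))"
    and I2: "has_bochner_integral lborel (\<lambda>s. (s - x + \<delta>) powr (- 1 - a) * indicator {x..y} s) (P (y - x))"
    if "x \<le> y" for x y
    unfolding P_def using shifted_power_integrals[OF a \<delta> that] .
  have sI: "set_integrable lborel {x..y} (\<lambda>r. f r *\<^sub>R z)" "(LINT r:{x..y}|lborel. f r *\<^sub>R z) = c *\<^sub>R z"
    if "has_bochner_integral lborel (\<lambda>r. f r * indicator {x..y} r) c" for x y c and f :: "real \<Rightarrow> real" and z :: 'a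
  proof -
    have "has_bochner_integral lborel (\<lambda>r. (f r * indicator {x..y} r) *\<^sub>R z) (c *\<^sub>R z)"
      using that by (rule has_bochner_integral_scaleR_left)
    then show "set_integrable lborel {x..y} (\<lambda>r. f r *\<^sub>R z)" "(LINT r:{x..y}|lborel. f r *\<^sub>R z) = c *\<^sub>R z"
      by (simp_all add: set_integrable_def set_lebesgue_integral_def has_bochner_integral_iff mult_ac)
  qed
  have bdd: "set_integrable lborel {0..t} (\<lambda>s. g s *\<^sub>R F s)"
    if [measurable]: "g \<in> borel_measurable borel" and "\<And>s. s \<in> {0..t} \<Longrightarrow> \<bar>g s\<bar> \<le> M" for g :: "real \<Rightarrow> real" and M
  proof (rule set_integrable_bound)
    show "set_integrable lborel {0..t} (\<lambda>s. M *\<^sub>R F s)" by (intro set_integrable_scaleR_right F)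
    show "set_borel_measurable lborel {0..t} (\<lambda>s. g s *\<^sub>R F s)"
      unfolding set_borel_measurable_def by measurable
    show "AE s in lborel. s \<in> {0..t} \<longrightarrow> norm (g s *\<^sub>R F s) \<le> norm (M *\<^sub>R F s)"
      using that(2) by (intro AE_I2 impI) (fastforce intro!: mult_right_mono)
  qed
  have kb: "(x + \<delta>) powr c \<le> \<delta> powr c" if "0 \<le> x" "c \<le> 0" for x c
    using that \<delta> by (intro powr_mono2') auto
  have s1: "set_integrable lborel {0..t} (\<lambda>s. (s + \<delta>) powr (- a) *\<^sub>R F s)"
    by (rule bdd[where M = "\<delta> powr (- a)"]) (use kb a in auto)
  have s2: "set_integrable lborel {0..t} (\<lambda>r. (t - r + \<delta>) powr (- a) *\<^sub>R F r)"
    by (rule bdd[where M = "\<delta> powr (- a)"]) (use kb a in auto)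
  have sA: "set_integrable lborel {0..t} (\<lambda>s. P s *\<^sub>R F s)"
  proof -
    have "set_integrable lborel {0..t} (\<lambda>s. (\<delta> powr (- a) / a) *\<^sub>R F s - (1 / a) *\<^sub>R ((s + \<delta>) powr (- a) *\<^sub>R F s))"
      by (intro set_integral_diff set_integrable_scaleR_right F s1)
    then show ?thesis by (simp add: P_def diff_divide_distrib scaleR_diff_left)
  qed
  have sB: "set_integrable lborel {0..t} (\<lambda>r. P (t - r) *\<^sub>R F r)"
  proof -
    have "set_integrable lborel {0..t} (\<lambda>r. (\<delta> powr (- a) / a) *\<^sub>R F r - (1 / a) *\<^sub>R ((t - r + \<delta>) powr (- a) *\<^sub>R F r))"
      by (intro set_integral_diff set_integrable_scaleR_right F s2)
    then show ?thesis by (simp add: P_def diff_divide_distrib scaleR_diff_left)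
  qed
  have intB: "integrable (lborel \<Otimes>\<^sub>M lborel)
      (\<lambda>(r, s). indicator {0..t} s *\<^sub>R indicator {0..s} r *\<^sub>R kB r s)"
  proof (rule triangle_integrable_fstI)
    show "(\<lambda>(r, s). kB r s) \<in> borel_measurable (borel \<Otimes>\<^sub>M borel)"
      unfolding kB_def by measurable
    fix r assume r: "0 < r" "r < t"
    have i2: "has_bochner_integral lborel (\<lambda>s. (s - r + \<delta>) powr (- 1 - a) * indicator {r..t} s) (P (t - r))"
      by (rule I2) (use r in simp)
    have "(\<integral>\<^sup>+s\<in>{r..t}. ennreal (norm (kB r s)) \<partial>lborel)
       = (\<integral>\<^sup>+s. ennreal (norm (F r)) * ennreal ((s - r + \<delta>) powr (- 1 - a) * indicator {r..t} s) \<partial>lborel)"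
      by (intro nn_integral_cong) (auto simp: kB_def indicator_def ennreal_mult[symmetric] mult_ac)
    also have "\<dots> = ennreal (norm (F r)) * ennreal (P (t - r))"
      by (subst nn_integral_cmult, simp, subst nn_integral_eq_integral)
         (use i2 in \<open>auto simp: has_bochner_integral_iff indicator_def\<close>)
    also have "\<dots> = ennreal (norm (P (t - r) *\<^sub>R F r))"
    proof -
      have "0 \<le> P (t - r)" unfolding has_bochner_integral_integral_eq[OF i2, symmetric]
        by (intro integral_nonneg_AE) auto
      then show ?thesis by (simp add: ennreal_mult[symmetric] mult_ac)
    qed
    finally show "(\<integral>\<^sup>+s\<in>{r..t}. ennreal (norm (kB r s)) \<partial>lborel) \<le> ennreal (norm (P (t - r) *\<^sub>R F r))" by simp
  next
    show "set_integrable lborel {0..t} (\<lambda>r. norm (P (t - r) *\<^sub>R F r))"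
      by (rule set_integrable_norm[OF sB])
  qed
  have L: "(LINT s:{r..t}|lborel. kB r s) = P (t - r) *\<^sub>R F r" if "r \<in> {0..t}" for r
    unfolding kB_def by (rule sI(2)[OF I2]) (use that in auto)
  have outerB: "set_integrable lborel {0..t} (\<lambda>s. LINT r:{0..s}|lborel. kB r s)"
    by (rule triangle_Fubini(1)[OF intB])
  have "(LINT s:{0..t}|lborel. LINT r:{0..s}|lborel. kB r s) = (LINT r:{0..t}|lborel. LINT s:{r..t}|lborel. kB r s)"
    by (rule triangle_Fubini(3)[OF intB])
  also have "\<dots> = (LINT r:{0..t}|lborel. P (t - r) *\<^sub>R F r)"
    by (intro set_lebesgue_integral_cong) (use L in auto)
  finally have VB: "(LINT s:{0..t}|lborel. LINT r:{0..s}|lborel. kB r s) = (LINT r:{0..t}|lborel. P (t - r) *\<^sub>R F r)" .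
  define kk where "kk s = (LINT r:{0..s}|lborel. (s - r + \<delta>) powr (- 1 - a) *\<^sub>R (F s - F r))" for s
  have kkm: "kk \<in> borel_measurable borel"
  proof -
    have "kk = (\<lambda>s. LINT r|lborel. (if 0 \<le> r \<and> r \<le> s then 1 else 0) *\<^sub>R ((s - r + \<delta>) powr (- 1 - a) *\<^sub>R (F s - F r)))"
      unfolding kk_def set_lebesgue_integral_def
      by (intro ext Bochner_Integration.integral_cong) (auto simp: indicator_def)
    then show ?thesis by simp
  qed
  define D where "D s = P s *\<^sub>R F s - (LINT r:{0..s}|lborel. kB r s)" for s
  have DI: "set_integrable lborel {0..t} D"
    unfolding D_def by (intro set_integral_diff sA outerB)
  \<comment> \<open>Fubini makes \<open>kB\<close> integrable in \<open>r\<close> for almost every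
    \<open>s\<close> only, so the inner integral of the difference is split almost
    everywhere.\<close>
  have ae: "AE s in lborel. indicator {0..t} s *\<^sub>R kk s = indicator {0..t} s *\<^sub>R D s"
    using triangle_Fubini(4)[OF intB]
  proof eventually_elim
    fix s assume s: "s \<in> {0..t} \<longrightarrow> set_integrable lborel {0..s} (\<lambda>r. kB r s)"
    have "kk s = D s" if st: "s \<in> {0..t}"
    proof -
      have A: "set_integrable lborel {0..s} (\<lambda>r. (s - r + \<delta>) powr (- 1 - a) *\<^sub>R F s)"
        "(LINT r:{0..s}|lborel. (s - r + \<delta>) powr (- 1 - a) *\<^sub>R F s) = P (s - 0) *\<^sub>R F s"
        using sI[OF I1[of 0 s]] st by auto
      have "kk s = (LINT r:{0..s}|lborel. (s - r + \<delta>) powr (- 1 - a) *\<^sub>R F s - kB r s)"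
        by (simp add: kk_def kB_def scaleR_diff_right)
      also have "\<dots> = P (s - 0) *\<^sub>R F s - (LINT r:{0..s}|lborel. kB r s)"
        by (subst set_integral_diff) (use A s st in auto)
      finally show ?thesis by (simp add: D_def)
    qed
    then show "indicator {0..t} s *\<^sub>R kk s = indicator {0..t} s *\<^sub>R D s"
      by (cases "s \<in> {0..t}") simp_all
  qed
  have "(LINT s:{0..t}|lborel. kk s) = (LINT s:{0..t}|lborel. D s)"
    unfolding set_lebesgue_integral_def
  proof (rule integral_cong_AE[OF _ _ ae])
    show "(\<lambda>s. indicator {0..t} s *\<^sub>R kk s) \<in> borel_measurable lborel" using kkm by measurable
    show "(\<lambda>s. indicator {0..t} s *\<^sub>R D s) \<in> borel_measurable lborel"
      using DI unfolding set_integrable_def by (rule borel_measurable_integrable)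
  qed
  also have "\<dots> = (LINT s:{0..t}|lborel. P s *\<^sub>R F s) - (LINT r:{0..t}|lborel. P (t - r) *\<^sub>R F r)"
    unfolding D_def by (subst set_integral_diff) (use sA outerB VB in auto)
  also have "\<dots> = (LINT s:{0..t}|lborel. P s *\<^sub>R F s - P (t - s) *\<^sub>R F s)"
    by (subst set_integral_diff) (use sA sB in auto)
  also have "a *\<^sub>R \<dots> = (LINT s:{0..t}|lborel. a *\<^sub>R (P s *\<^sub>R F s - P (t - s) *\<^sub>R F s))"
    by simp
  also have "\<dots> = (LINT s:{0..t}|lborel. (t - s + \<delta>) powr (- a) *\<^sub>R F s - (s + \<delta>) powr (- a) *\<^sub>R F s)"
  proof -
    have "a *\<^sub>R (P s *\<^sub>R F s - P (t - s) *\<^sub>R F s) = (a * (P s - P (t - s))) *\<^sub>R F s" for s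
      by (simp add: algebra_simps)
    moreover have "a * (P s - P (t - s)) = (t - s + \<delta>) powr (- a) - (s + \<delta>) powr (- a)" for s
      using a by (simp add: P_def field_simps)
    ultimately show ?thesis by (simp add: scaleR_diff_left)
  qed
  also have "\<dots> = (LINT r:{0..t}|lborel. (t - r + \<delta>) powr (- a) *\<^sub>R F r) - (LINT s:{0..t}|lborel. (s + \<delta>) powr (- a) *\<^sub>R F s)"
    by (subst set_integral_diff) (use s1 s2 in auto)
  finally show ?thesis unfolding kk_def .
qed

text \<open>A rearrangement of r^(1-a) \<le> s^(1-a). The factor \<open>s - r\<close> it produces
  lowers the singularity of the Marchaud kernel by one order.\<close>

lemma powr_neg_diff_le:
  fixes a r s :: real
  assumes "0 < a" "a < 1" "0 < r" "r \<le> s"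
  shows "r powr (- a) - s powr (- a) \<le> r powr (- a) * (s - r) / s"
proof -
  have s: "0 < s" using assms by simp
  have "r powr (1 - a) \<le> s powr (1 - a)" using assms by (intro powr_mono2) auto
  then have "r * r powr (- a) \<le> s * s powr (- a)"
    using assms s by (simp add: powr_mult_base)
  then show ?thesis using s by (simp add: field_simps)
qed

text \<open>\<open>v\<close> is \<Gamma>(1 - a) times the Marchaud derivative of order
  \<open>a\<close>. Hoelder exponent 1/2 is enough because (s - r)^(-1-a) sqrt(s - r) has exponent
  -1/2 - a > -1. The weight \<open>q powr (- a)\<close> makes \<open>F\<close> singular at 0; its
  increments are handled separately and cost the growth \<open>s powr (- 2 * a)\<close>.\<close>

lemma Marchaud_primitive:
  fixes f :: "real \<Rightarrow> 'a::{banach, second_countable_topology}"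
  assumes a: "0 < a" "a < 1/2" and T: "0 < T"
    and [measurable]: "f \<in> borel_measurable borel"
    and f: "\<And>t. t \<in> {0..T} \<Longrightarrow> norm (f t) \<le> B"
    and H: "\<And>r s. 0 \<le> r \<Longrightarrow> r < s \<Longrightarrow> s \<le> T \<Longrightarrow> norm (f s - f r) \<le> Cf * sqrt (s - r)"
  defines "F \<equiv> \<lambda>q. q powr (- a) *\<^sub>R f q"
  defines "v \<equiv> \<lambda>s. s powr (- a) *\<^sub>R F s + a *\<^sub>R (LINT r:{0..s}|lborel. (s - r) powr (- 1 - a) *\<^sub>R (F s - F r))"
  shows "v \<in> borel_measurable borel"
    and "\<exists>C. \<forall>s. 0 < s \<longrightarrow> s \<le> T \<longrightarrow> norm (v s) \<le> C * s powr (- 2 * a)"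
    and "\<And>t. 0 \<le> t \<Longrightarrow> t \<le> T \<Longrightarrow> (LINT s:{0..t}|lborel. v s) = RL (1 - a) F t"
proof -
  have [measurable]: "F \<in> borel_measurable borel" unfolding F_def by measurable
  define k where "k r s = (s - r) powr (- 1 - a) *\<^sub>R (F s - F r)" for r s :: real
  have km [measurable]: "(\<lambda>(r, s). k r s) \<in> borel_measurable (borel \<Otimes>\<^sub>M borel)"
    unfolding k_def by measurable
  have B0: "0 \<le> B"
    by (rule order_trans[OF norm_ge_zero[of "f 0"]], rule f) (use T in simp)
  have C0: "0 \<le> Cf"
  proof -
    have "norm (f T - f 0) \<le> Cf * sqrt (T - 0)" by (rule H) (use T in auto)
    then have "0 \<le> Cf * sqrt T" by (intro order_trans[OF norm_ge_zero[of "f T - f 0"]]) simp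
    then show ?thesis using T by (simp add: zero_le_mult_iff)
  qed
  define b1 where "b1 = Beta (1 - a) (1 - a)"
  define b2 where "b2 = Beta (1/2 - a) (1 - a)"
  have b0: "0 < b1" "0 < b2" using a by (auto simp: b1_def b2_def intro!: Beta_real_pos)
  \<comment> \<open>Integrated over \<open>{0..s}\<close>, the two terms of the kernel bound scale
    as s^(1-2a) / s and s^(1/2-2a); the spare \<open>sqrt s\<close> of the second is absorbed as
    \<open>sqrt T\<close>.\<close>
  define C1 where "C1 = B * b1 + Cf * b2 * sqrt T"
  have C10: "0 \<le> C1" using B0 C0 b0 T by (simp add: C1_def)
  define e where "e p r s = (s - r) powr (p - 1) * (r - 0) powr ((1 - a) - 1)" for p r s :: real
  \<comment> \<open>The increment of \<open>F\<close> is split into the increment of the weight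
    times \<open>f s\<close> and the weight times the increment of \<open>f\<close>. After
    multiplication by the kernel both are Beta integrands.\<close>
  have kb: "norm (k r s) \<le> B / s * e (1 - a) r s + Cf * e (1/2 - a) r s" if rs: "0 < r" "r < s" "s \<le> T" for r s
  proof -
    have "norm (F s - F r) = norm ((s powr (- a) - r powr (- a)) *\<^sub>R f s + r powr (- a) *\<^sub>R (f s - f r))"
      by (simp add: F_def algebra_simps)
    also have "\<dots> \<le> \<bar>s powr (- a) - r powr (- a)\<bar> * norm (f s) + r powr (- a) * norm (f s - f r)"
      by (rule order.trans[OF norm_triangle_ineq]) simp
    also have "\<dots> \<le> (r powr (- a) * (s - r) / s) * B + r powr (- a) * (Cf * sqrt (s - r))"
    proof (intro add_mono mult_mono mult_left_mono)
      have "s powr (- a) \<le> r powr (- a)" using rs a by (intro powr_mono2') auto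
      then show "\<bar>s powr (- a) - r powr (- a)\<bar> \<le> r powr (- a) * (s - r) / s"
        using powr_neg_diff_le[of a r s] rs a by simp
      show "norm (f s - f r) \<le> Cf * sqrt (s - r)" using H[of r s] rs by simp
      show "norm (f s) \<le> B" using f[of s] rs by simp
    qed (use rs in auto)
    finally have "norm (k r s) \<le> (s - r) powr (- 1 - a) * ((r powr (- a) * (s - r) / s) * B + r powr (- a) * (Cf * sqrt (s - r)))"
      by (simp add: k_def mult_left_mono)
    also have "\<dots> = B / s * (((s - r) powr (- 1 - a) * (s - r)) * r powr (- a)) + Cf * (((s - r) powr (- 1 - a) * sqrt (s - r)) * r powr (- a))"
    proof -
      have "x * ((p * d / s) * B + p * (Cf * q)) = B / s * ((x * d) * p) + Cf * ((x * q) * p)" for x p d q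
        by (simp add: algebra_simps)
      then show ?thesis .
    qed
    also have "(s - r) powr (- 1 - a) * (s - r) = (s - r) powr ((1 - a) - 1)"
      using rs powr_add[of "s - r" "- 1 - a" 1] by simp
    also have "(s - r) powr (- 1 - a) * sqrt (s - r) = (s - r) powr ((1/2 - a) - 1)"
      using rs powr_add[of "s - r" "- 1 - a" "1/2"] by (simp add: powr_half_sqrt)
    finally show ?thesis by (simp add: e_def)
  qed
  have kn: "(\<integral>\<^sup>+r\<in>{0..s}. ennreal (norm (k r s)) \<partial>lborel) \<le> ennreal (C1 * s powr (- 2 * a))" if s: "0 < s" "s \<le> T" for s
  proof -
    have [measurable]: "(\<lambda>r. e p r s) \<in> borel_measurable borel" for p unfolding e_def by measurable
    have e0: "0 \<le> e p r s" for p r by (simp add: e_def)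
    have "(\<integral>\<^sup>+r\<in>{0..s}. ennreal (norm (k r s)) \<partial>lborel)
      \<le> (\<integral>\<^sup>+r. ennreal (B / s) * (ennreal (e (1 - a) r s) * indicator {0..s} r) + ennreal Cf * (ennreal (e (1/2 - a) r s) * indicator {0..s} r) \<partial>lborel)"
    proof (rule nn_integral_mono_AE)
      show "AE r in lborel. ennreal (norm (k r s)) * indicator {0..s} r
        \<le> ennreal (B / s) * (ennreal (e (1 - a) r s) * indicator {0..s} r) + ennreal Cf * (ennreal (e (1/2 - a) r s) * indicator {0..s} r)"
        using AE_lborel_neq[of 0] AE_lborel_neq[of s]
      proof eventually_elim
        fix r :: real assume "r \<noteq> 0" "r \<noteq> s"
        then consider "r \<notin> {0..s}" | "0 < r" "r < s" by force
        then show "ennreal (norm (k r s)) * indicator {0..s} r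
        \<le> ennreal (B / s) * (ennreal (e (1 - a) r s) * indicator {0..s} r) + ennreal Cf * (ennreal (e (1/2 - a) r s) * indicator {0..s} r)"
        proof cases
          case 2
          have "ennreal (norm (k r s)) \<le> ennreal (B / s * e (1 - a) r s + Cf * e (1/2 - a) r s)"
            by (intro ennreal_leI kb) (use 2 s in auto)
          also have "\<dots> = ennreal (B / s) * ennreal (e (1 - a) r s) + ennreal Cf * ennreal (e (1/2 - a) r s)"
            using B0 C0 s e0 by (simp only: ennreal_plus ennreal_mult mult_nonneg_nonneg divide_nonneg_nonneg less_imp_le)
          finally show ?thesis using 2 by (simp add: indicator_def)
        qed simp
      qed
    qed
    also have "\<dots> = ennreal (B / s) * ennreal (b1 * (s - 0) powr ((1 - a) + (1 - a) - 1))
         + ennreal Cf * ennreal (b2 * (s - 0) powr ((1/2 - a) + (1 - a) - 1))"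
      unfolding b1_def b2_def
      using nn_integral_Beta_Icc[of "1 - a" "1 - a" 0 s] nn_integral_Beta_Icc[of "1/2 - a" "1 - a" 0 s] a s
      by (subst nn_integral_add, simp, simp, subst (1 2) nn_integral_cmult) (auto simp: e_def)
    also have "\<dots> = ennreal (B / s * (b1 * s powr (1 - 2 * a)) + Cf * (b2 * s powr (1/2 - 2 * a)))"
    proof -
      have "(1 - a) + (1 - a) - 1 = 1 - 2 * a" "(1/2 - a) + (1 - a) - 1 = 1/2 - 2 * a" by simp_all
      moreover have "0 \<le> B / s" "0 \<le> b1 * s powr (1 - 2 * a)" "0 \<le> b2 * s powr (1/2 - 2 * a)"
        using B0 b0 s by auto
      ultimately show ?thesis using C0
        by (simp only: ennreal_plus ennreal_mult mult_nonneg_nonneg diff_zero)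
    qed
    also have "\<dots> \<le> ennreal (C1 * s powr (- 2 * a))"
    proof (rule ennreal_leI)
      have "s powr (1 - 2 * a) = s * s powr (- 2 * a)" using s powr_add[of s 1 "- 2 * a"] by simp
      moreover have "s powr (1/2 - 2 * a) = sqrt s * s powr (- 2 * a)"
        using s powr_add[of s "1/2" "- 2 * a"] by (simp add: powr_half_sqrt)
      moreover have "Cf * (b2 * (sqrt s * s powr (- 2 * a))) \<le> Cf * (b2 * (sqrt T * s powr (- 2 * a)))"
        using s C0 b0 by (intro mult_left_mono mult_right_mono) auto
      ultimately show "B / s * (b1 * s powr (1 - 2 * a)) + Cf * (b2 * s powr (1/2 - 2 * a)) \<le> C1 * s powr (- 2 * a)"
        using s by (simp add: C1_def algebra_simps)
    qed
    finally show ?thesis .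
  qed
  define K where "K s = (LINT r:{0..s}|lborel. k r s)" for s
  have Kb: "norm (K s) \<le> C1 * s powr (- 2 * a)" if "0 < s" "s \<le> T" for s
    unfolding K_def by (rule set_integral_norm_le_nn[OF kn[OF that]]) (use C10 in simp)
  have vK: "v s = s powr (- a) *\<^sub>R F s + a *\<^sub>R K s" for s
    by (simp add: v_def K_def k_def)
  have Km [measurable]: "K \<in> borel_measurable borel"
  proof -
    have "K = (\<lambda>s. LINT r|lborel. (if 0 \<le> r \<and> r \<le> s then 1 else 0) *\<^sub>R ((s - r) powr (- 1 - a) *\<^sub>R (F s - F r)))"
      unfolding K_def k_def set_lebesgue_integral_def
      by (intro ext Bochner_Integration.integral_cong) (auto simp: indicator_def)
    then show ?thesis by simp
  qed
  show "v \<in> borel_measurable borel"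
    unfolding vK[abs_def] by measurable
  have Fb: "norm (F s) \<le> B * s powr (- a)" if "s \<in> {0..T}" for s
    using f[OF that] by (simp add: F_def mult.commute mult_right_mono)
  have F2b: "norm (s powr (- a) *\<^sub>R F s) \<le> B * s powr (- 2 * a)" if "s \<in> {0..T}" for s
  proof -
    have "norm (s powr (- a) *\<^sub>R F s) \<le> s powr (- a) * (B * s powr (- a))"
      using Fb[OF that] by (auto intro!: mult_left_mono)
    also have "\<dots> = B * (s powr (- a) * s powr (- a))" by simp
    also have "s powr (- a) * s powr (- a) = s powr (- 2 * a)" by (simp add: powr_add[symmetric])
    finally show ?thesis .
  qed
  show "\<exists>C. \<forall>s. 0 < s \<longrightarrow> s \<le> T \<longrightarrow> norm (v s) \<le> C * s powr (- 2 * a)"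
  proof (intro exI allI impI)
    fix s assume s: "0 < s" "s \<le> T"
    have "norm (v s) \<le> norm (s powr (- a) *\<^sub>R F s) + a * norm (K s)"
      unfolding vK using a norm_triangle_ineq[of "s powr (- a) *\<^sub>R F s" "a *\<^sub>R K s"] by simp
    also have "\<dots> \<le> B * s powr (- 2 * a) + a * (C1 * s powr (- 2 * a))"
      using F2b[of s] Kb[of s] s a by (intro add_mono mult_left_mono) auto
    finally show "norm (v s) \<le> (B + a * C1) * s powr (- 2 * a)" by (simp add: algebra_simps)
  qed
  fix t assume t: "0 \<le> t" "t \<le> T"
  have p2I: "set_integrable lborel {0..t} (\<lambda>s. C * s powr (- 2 * a))" for C
    by (intro set_integrable_mult_right integral_powr_from_zero) (use a t in auto)
  have FI: "set_integrable lborel {0..t} F"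
  proof (rule set_integrable_bound)
    show "set_integrable lborel {0..t} (\<lambda>s. B * s powr (- a))"
      by (intro set_integrable_mult_right integral_powr_from_zero) (use a t in auto)
    show "set_borel_measurable lborel {0..t} F"
      unfolding set_borel_measurable_def by measurable
    show "AE s in lborel. s \<in> {0..t} \<longrightarrow> norm (F s) \<le> norm (B * s powr (- a))"
      by (intro AE_I2 impI order.trans[OF Fb]) (use t in auto)
  qed
  define \<delta> where "\<delta> n = 1 / real (Suc n)" for n
  have \<delta>0: "0 < \<delta> n" for n by (simp add: \<delta>_def)
  have \<delta>lim: "\<delta> \<longlonglongrightarrow> 0" unfolding \<delta>_def by (rule LIMSEQ_Suc) (rule lim_1_over_n)
  have pw: "(\<lambda>n. (x + \<delta> n) powr c) \<longlonglongrightarrow> x powr c" if "0 < x" for x c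
  proof -
    have "(\<lambda>n. (x + \<delta> n) powr c) \<longlonglongrightarrow> (x + 0) powr c"
      using that by (intro tendsto_intros \<delta>lim) auto
    then show ?thesis by simp
  qed
  have pm: "(x + \<delta> n) powr c \<le> x powr c" if "0 < x" "c \<le> 0" for x c n
    using that \<delta>0[of n] by (intro powr_mono2') auto
  define k' where "k' n r s = (s - r + \<delta> n) powr (- 1 - a) *\<^sub>R (F s - F r)" for n and r s :: real
  have k'm: "(\<lambda>(r, s). k' n r s) \<in> borel_measurable (borel \<Otimes>\<^sub>M borel)" for n
    unfolding k'_def by measurable
  let ?g = "\<lambda>h (r, s). indicator {0..t} s *\<^sub>R indicator {0..s} r *\<^sub>R h r s"
  \<comment> \<open>A positive shift only decreases a negative power, so the singular kernel itself
    dominates all regularised ones; at \<open>r = s\<close> both sides vanish with the increment of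
    \<open>F\<close>.\<close>
  have k'k: "norm (k' n r s) \<le> norm (k r s)" if "r \<le> s" for n r s
    unfolding k'_def k_def using that pm[of "s - r" "- 1 - a" n] a
    by (cases "r = s") (auto intro!: mult_right_mono)
  have int0: "integrable (lborel \<Otimes>\<^sub>M lborel) (?g k)"
    by (rule triangle_integrable_sndI[OF km _ p2I[of C1]], rule kn) (use t in auto)
  have int': "integrable (lborel \<Otimes>\<^sub>M lborel) (?g (k' n))" for n
  proof (rule triangle_integrable_sndI[OF k'm _ p2I[of C1]])
    fix s assume s: "0 < s" "s < t"
    have "(\<integral>\<^sup>+r\<in>{0..s}. ennreal (norm (k' n r s)) \<partial>lborel) \<le> (\<integral>\<^sup>+r\<in>{0..s}. ennreal (norm (k r s)) \<partial>lborel)"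
      using k'k by (intro nn_integral_mono) (auto simp: indicator_def intro!: ennreal_leI)
    also have "\<dots> \<le> ennreal (C1 * s powr (- 2 * a))" by (rule kn) (use s t in auto)
    finally show "(\<integral>\<^sup>+r\<in>{0..s}. ennreal (norm (k' n r s)) \<partial>lborel) \<le> ennreal (C1 * s powr (- 2 * a))" .
  qed
  have lim1: "(\<lambda>n. integral\<^sup>L (lborel \<Otimes>\<^sub>M lborel) (?g (k' n))) \<longlonglongrightarrow> integral\<^sup>L (lborel \<Otimes>\<^sub>M lborel) (?g k)"
  proof (rule integral_dominated_convergence[where w = "\<lambda>x. norm (?g k x)"])
    show "?g k \<in> borel_measurable (lborel \<Otimes>\<^sub>M lborel)" using int0 by (rule borel_measurable_integrable)
    show "?g (k' n) \<in> borel_measurable (lborel \<Otimes>\<^sub>M lborel)" for n using int' by (rule borel_measurable_integrable)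
    show "integrable (lborel \<Otimes>\<^sub>M lborel) (\<lambda>x. norm (?g k x))" using int0 by (rule integrable_norm)
    show "AE x in lborel \<Otimes>\<^sub>M lborel. norm (?g (k' n) x) \<le> norm (?g k x)" for n
      using k'k by (intro AE_I2) (auto simp: indicator_def)
    have "(\<lambda>n. k' n r s) \<longlonglongrightarrow> k r s" if "r \<le> s" for r s
    proof (cases "r = s")
      case False
      with that have "0 < s - r" by simp
      then show ?thesis unfolding k'_def k_def by (intro tendsto_intros pw)
    qed (simp add: k'_def k_def)
    then show "AE x in lborel \<Otimes>\<^sub>M lborel. (\<lambda>n. ?g (k' n) x) \<longlonglongrightarrow> ?g k x"
      by (intro AE_I2) (auto simp: indicator_def)
  qed
  have e0: "integral\<^sup>L (lborel \<Otimes>\<^sub>M lborel) (?g k) = (LINT s:{0..t}|lborel. K s)"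
    using triangle_Fubini(5)[OF int0] by (simp add: K_def)
  define A where "A n = (LINT r:{0..t}|lborel. (t - r + \<delta> n) powr (- a) *\<^sub>R F r)" for n
  define D where "D n = (LINT s:{0..t}|lborel. (s + \<delta> n) powr (- a) *\<^sub>R F s)" for n
  have e': "a *\<^sub>R integral\<^sup>L (lborel \<Otimes>\<^sub>M lborel) (?g (k' n)) = A n - D n" for n
    using triangle_Fubini(5)[OF int'[of n]] Marchaud_regularised[OF a(1) \<delta>0[of n] _ FI t(1)]
    by (simp add: k'_def A_def D_def)
  \<comment> \<open>Unlike the kernel of order -1 - a, the weight (t - r)^(-a) left after the
    cancellation is integrable, and |F r| \<le> B r^(-a) gives a Beta integrand as majorant.\<close>
  have Alim: "A \<longlonglongrightarrow> RL (1 - a) F t"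
    unfolding A_def RL_def set_lebesgue_integral_def
  proof (rule integral_dominated_convergence[where w = "\<lambda>r. indicator {0..t} r *\<^sub>R (B * ((t - r) powr ((1 - a) - 1) * (r - 0) powr ((1 - a) - 1)))"])
    have "set_integrable lborel {0..t} (\<lambda>r. B * ((t - r) powr ((1 - a) - 1) * (r - 0) powr ((1 - a) - 1)))"
      by (intro set_integrable_mult_right Beta_Icc) (use a t in auto)
    then show "integrable lborel (\<lambda>r. indicator {0..t} r *\<^sub>R (B * ((t - r) powr ((1 - a) - 1) * (r - 0) powr ((1 - a) - 1))))"
      by (simp add: set_integrable_def)
    show "AE r in lborel. (\<lambda>n. indicator {0..t} r *\<^sub>R (t - r + \<delta> n) powr (- a) *\<^sub>R F r)
        \<longlonglongrightarrow> indicator {0..t} r *\<^sub>R (t - r) powr (1 - a - 1) *\<^sub>R F r"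
      using AE_lborel_neq[of t]
    proof eventually_elim
      fix r assume "r \<noteq> t"
      then have "r \<in> {0..t} \<Longrightarrow> 0 < t - r" by auto
      then have "r \<in> {0..t} \<Longrightarrow> (\<lambda>n. (t - r + \<delta> n) powr (- a) *\<^sub>R F r) \<longlonglongrightarrow> (t - r) powr (- a) *\<^sub>R F r"
        by (intro tendsto_intros pw) auto
      then show "(\<lambda>n. indicator {0..t} r *\<^sub>R (t - r + \<delta> n) powr (- a) *\<^sub>R F r)
        \<longlonglongrightarrow> indicator {0..t} r *\<^sub>R (t - r) powr (1 - a - 1) *\<^sub>R F r"
        by (cases "r \<in> {0..t}") simp_all
    qed
    show "AE r in lborel. norm (indicator {0..t} r *\<^sub>R (t - r + \<delta> n) powr (- a) *\<^sub>R F r)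
       \<le> indicator {0..t} r *\<^sub>R (B * ((t - r) powr ((1 - a) - 1) * (r - 0) powr ((1 - a) - 1)))" for n
      using AE_lborel_neq[of t]
    proof eventually_elim
      fix r assume r: "r \<noteq> t"
      have "(t - r + \<delta> n) powr (- a) * norm (F r) \<le> (t - r) powr (- a) * (B * r powr (- a))" if "r \<in> {0..t}"
        using that r t a by (intro mult_mono pm Fb) auto
      then show "norm (indicator {0..t} r *\<^sub>R (t - r + \<delta> n) powr (- a) *\<^sub>R F r)
       \<le> indicator {0..t} r *\<^sub>R (B * ((t - r) powr ((1 - a) - 1) * (r - 0) powr ((1 - a) - 1)))"
        by (cases "r \<in> {0..t}") (simp_all add: mult_ac)
    qed
  qed measurable
  have Dlim: "D \<longlonglongrightarrow> (LINT s:{0..t}|lborel. s powr (- a) *\<^sub>R F s)"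
    unfolding D_def set_lebesgue_integral_def
  proof (rule integral_dominated_convergence[where w = "\<lambda>s. indicator {0..t} s *\<^sub>R (B * s powr (- 2 * a))"])
    show "integrable lborel (\<lambda>s. indicator {0..t} s *\<^sub>R (B * s powr (- 2 * a)))"
      using p2I[of B] by (simp add: set_integrable_def)
    show "AE r in lborel. (\<lambda>n. indicator {0..t} r *\<^sub>R (r + \<delta> n) powr (- a) *\<^sub>R F r)
        \<longlonglongrightarrow> indicator {0..t} r *\<^sub>R r powr (- a) *\<^sub>R F r"
      using AE_lborel_neq[of 0]
    proof eventually_elim
      fix r :: real assume "r \<noteq> 0"
      then have "r \<in> {0..t} \<Longrightarrow> 0 < r" by auto
      then have "r \<in> {0..t} \<Longrightarrow> (\<lambda>n. (r + \<delta> n) powr (- a) *\<^sub>R F r) \<longlonglongrightarrow> r powr (- a) *\<^sub>R F r"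
        by (intro tendsto_intros pw) auto
      then show "(\<lambda>n. indicator {0..t} r *\<^sub>R (r + \<delta> n) powr (- a) *\<^sub>R F r)
        \<longlonglongrightarrow> indicator {0..t} r *\<^sub>R r powr (- a) *\<^sub>R F r"
        by (cases "r \<in> {0..t}") simp_all
    qed
    show "AE r in lborel. norm (indicator {0..t} r *\<^sub>R (r + \<delta> n) powr (- a) *\<^sub>R F r)
       \<le> indicator {0..t} r *\<^sub>R (B * r powr (- 2 * a))" for n
      using AE_lborel_neq[of 0]
    proof eventually_elim
      fix r :: real assume r: "r \<noteq> 0"
      have "(r + \<delta> n) powr (- a) * norm (F r) \<le> B * r powr (- 2 * a)" if "r \<in> {0..t}"
      proof -
        have "(r + \<delta> n) powr (- a) * norm (F r) \<le> r powr (- a) * norm (F r)"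
          using that r a by (intro mult_right_mono pm) auto
        also have "\<dots> \<le> B * r powr (- 2 * a)" using F2b[of r] that t by simp
        finally show ?thesis .
      qed
      then show "norm (indicator {0..t} r *\<^sub>R (r + \<delta> n) powr (- a) *\<^sub>R F r)
       \<le> indicator {0..t} r *\<^sub>R (B * r powr (- 2 * a))"
        by (cases "r \<in> {0..t}") simp_all
    qed
  qed measurable
  have "(\<lambda>n. a *\<^sub>R integral\<^sup>L (lborel \<Otimes>\<^sub>M lborel) (?g (k' n))) \<longlonglongrightarrow> a *\<^sub>R (LINT s:{0..t}|lborel. K s)"
    using lim1 unfolding e0 by (rule tendsto_scaleR[OF tendsto_const])
  moreover have "(\<lambda>n. a *\<^sub>R integral\<^sup>L (lborel \<Otimes>\<^sub>M lborel) (?g (k' n)))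
      \<longlonglongrightarrow> RL (1 - a) F t - (LINT s:{0..t}|lborel. s powr (- a) *\<^sub>R F s)"
    unfolding e' by (rule tendsto_diff[OF Alim Dlim])
  ultimately have "a *\<^sub>R (LINT s:{0..t}|lborel. K s) = RL (1 - a) F t - (LINT s:{0..t}|lborel. s powr (- a) *\<^sub>R F s)"
    by (rule LIMSEQ_unique)
  moreover have "(LINT s:{0..t}|lborel. v s) = (LINT s:{0..t}|lborel. s powr (- a) *\<^sub>R F s) + a *\<^sub>R (LINT s:{0..t}|lborel. K s)"
  proof -
    have "set_integrable lborel {0..t} (\<lambda>s. s powr (- a) *\<^sub>R F s)"
    proof (rule set_integrable_bound[OF p2I[of B]])
      show "set_borel_measurable lborel {0..t} (\<lambda>s. s powr (- a) *\<^sub>R F s)"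
        unfolding set_borel_measurable_def by measurable
      show "AE s in lborel. s \<in> {0..t} \<longrightarrow> norm (s powr (- a) *\<^sub>R F s) \<le> norm (B * s powr (- 2 * a))"
        by (intro AE_I2 impI order.trans[OF F2b]) (use t in auto)
    qed
    moreover have "set_integrable lborel {0..t} (\<lambda>s. a *\<^sub>R K s)"
      unfolding K_def by (intro set_integrable_scaleR_right triangle_Fubini(1)[OF int0])
    ultimately show ?thesis unfolding vK by (subst set_integral_add) auto
  qed
  ultimately show "(LINT s:{0..t}|lborel. v s) = RL (1 - a) F t" by simp
qed

text \<open>Order \<open>a + 1\<close> is split as order \<open>a\<close> after a primitive. The
  primitive of \<open>w\<close> is \<open>RL (1 - a) F\<close>, and the complementary orders
  \<open>a\<close> and \<open>1 - a\<close> compose to a plain primitive of \<open>F\<close>;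
  \<open>\<kappa>\<close> removes the factor \<open>a * Beta a (1 - a)\<close>.\<close>

lemma V_frac_range_pos:
  fixes f :: "real \<Rightarrow> 'a::euclidean_space"
  assumes a: "0 < a" "a < 1/2" and T: "0 < T"
    and [measurable]: "f \<in> borel_measurable borel"
    and f: "\<And>t. t \<in> {0..T} \<Longrightarrow> norm (f t) \<le> B"
    and H: "\<And>r s. 0 \<le> r \<Longrightarrow> r < s \<Longrightarrow> s \<le> T \<Longrightarrow> norm (f s - f r) \<le> Cf * sqrt (s - r)"
  shows "\<exists>u. u \<in> borel_measurable borel \<and> set_integrable lborel {0..T} (\<lambda>t. (norm (u t))\<^sup>2) \<and>
     (\<forall>t\<in>{0..T}. V_frac a u t = (LINT q:{0..t}|lborel. f q))"
proof -
  define F where "F q = q powr (- a) *\<^sub>R f q" for q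
  define w where "w s = s powr (- a) *\<^sub>R F s + a *\<^sub>R (LINT r:{0..s}|lborel. (s - r) powr (- 1 - a) *\<^sub>R (F s - F r))" for s
  have [measurable]: "F \<in> borel_measurable borel" unfolding F_def by measurable
  note M = Marchaud_primitive[OF a T assms(4), where B = B and Cf = Cf, folded F_def, folded w_def]
  have wm [measurable]: "w \<in> borel_measurable borel"
    using M(1) f H by (simp add: w_def[abs_def])
  have "\<exists>C. \<forall>s. 0 < s \<longrightarrow> s \<le> T \<longrightarrow> norm (w s) \<le> C * s powr (- 2 * a)"
    by (rule M(2)) (use f H in auto)
  then obtain C where C: "\<And>s. 0 < s \<Longrightarrow> s \<le> T \<Longrightarrow> norm (w s) \<le> C * s powr (- 2 * a)"
    by blast
  have wI: "(LINT s:{0..t}|lborel. w s) = RL (1 - a) F t" if "0 \<le> t" "t \<le> T" for t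
    by (rule M(3)) (use f H that in auto)
  define \<kappa> where "\<kappa> = 1 / (a * Beta a (1 - a))"
  have Bp: "0 < Beta a (1 - a)" using a by (intro Beta_real_pos) auto
  have \<kappa>0: "0 < \<kappa>" using Bp a by (simp add: \<kappa>_def)
  show ?thesis
  proof (rule V_frac_range_core[where v = "\<lambda>s. \<kappa> *\<^sub>R w s" and C = "\<kappa> * C"])
    fix t assume t: "0 < t" "t \<le> T"
    show "norm (\<kappa> *\<^sub>R w t) \<le> \<kappa> * C * t powr (- 2 * a)"
      using C[OF t] \<kappa>0 by (simp add: mult.assoc)
  next
    fix t assume t: "0 \<le> t" "t \<le> T"
    have FI: "set_integrable lborel {0..t} F"
    proof (rule set_integrable_bound)
      show "set_integrable lborel {0..t} (\<lambda>s. B * s powr (- a))"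
        by (intro set_integrable_mult_right integral_powr_from_zero) (use a t in auto)
      show "set_borel_measurable lborel {0..t} F"
        unfolding set_borel_measurable_def by measurable
      have Fb: "norm (F s) \<le> B * s powr (- a)" if "s \<in> {0..T}" for s
        using f[OF that] by (simp add: F_def mult.commute mult_right_mono)
      show "AE s in lborel. s \<in> {0..t} \<longrightarrow> norm (F s) \<le> norm (B * s powr (- a))"
        by (intro AE_I2 impI order.trans[OF Fb]) (use t in auto)
    qed
    have wint: "set_integrable lborel {0..t} w"
    proof (rule set_integrable_bound)
      show "set_integrable lborel {0..t} (\<lambda>s. C * s powr (- 2 * a))"
        by (intro set_integrable_mult_right integral_powr_from_zero) (use a t in auto)
      show "set_borel_measurable lborel {0..t} w"
        unfolding set_borel_measurable_def by measurable
      show "AE s in lborel. s \<in> {0..t} \<longrightarrow> norm (w s) \<le> norm (C * s powr (- 2 * a))"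
        using AE_lborel_neq[of 0]
      proof eventually_elim
        fix s :: real assume "s \<noteq> 0"
        then show "s \<in> {0..t} \<longrightarrow> norm (w s) \<le> norm (C * s powr (- 2 * a))"
          using C[of s] t by (intro impI order.trans[OF C]) auto
      qed
    qed
    have "RL (a + 1) w t = a *\<^sub>R RL a (\<lambda>r. LINT s:{0..r}|lborel. w s) t"
      using RL_of_integral[of w a t] a wint by simp
    also have "RL a (\<lambda>r. LINT s:{0..r}|lborel. w s) t = RL a (RL (1 - a) F) t"
      unfolding RL_def[of a] by (intro set_lebesgue_integral_cong) (use wI t in auto)
    also have "\<dots> = Beta a (1 - a) *\<^sub>R RL (a + (1 - a)) F t"
      by (rule RL_RL(2)) (use a FI in auto)
    finally have "RL (a + 1) w t = (a * Beta a (1 - a)) *\<^sub>R (LINT q:{0..t}|lborel. F q)"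
      by (simp add: RL_one)
    moreover have "RL (a + 1) (\<lambda>s. \<kappa> *\<^sub>R w s) t = \<kappa> *\<^sub>R RL (a + 1) w t"
      unfolding RL_def by (simp add: scaleR_left_commute del: scaleR_scaleR)
    ultimately show "RL (a + 1) (\<lambda>s. \<kappa> *\<^sub>R w s) t = (LINT q:{0..t}|lborel. q powr (- a) *\<^sub>R f q)"
      using Bp a by (simp add: \<kappa>_def F_def)
  qed (use a T f wm in auto)
qed

section \<open>The Young integral of a continuously differentiable integrand\<close>

text \<open>The action of a diagonal matrix as a bounded bilinear map, so that continuity and the
  product rule become available.\<close>

definition hadamard :: "real^'n \<Rightarrow> real^'n \<Rightarrow> real^'n" where
  "hadamard x y = (\<chi> i. x $ i * y $ i)"

lemma diag_mat_mult: "diag_mat x *v y = hadamard x y"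
  by (simp add: diag_mat_def hadamard_def matrix_vector_mult_def vec_eq_iff if_distrib[of "\<lambda>z. z * _"] cong: if_cong)

lemma norm_hadamard: "norm (hadamard x y) \<le> norm x * norm y"
proof -
  have "(norm (hadamard x y))\<^sup>2 = (\<Sum>i\<in>UNIV. (x $ i)\<^sup>2 * (y $ i)\<^sup>2)"
    unfolding power2_norm_eq_inner by (simp add: inner_vec_def hadamard_def power2_eq_square mult_ac)
  also have "\<dots> \<le> (\<Sum>i\<in>UNIV. (norm x)\<^sup>2 * (y $ i)\<^sup>2)"
  proof (intro sum_mono mult_right_mono)
    show "(x $ i)\<^sup>2 \<le> (norm x)\<^sup>2" for i
      using component_le_norm_cart[of x i] by (metis abs_le_square_iff abs_norm_cancel)
  qed simp
  also have "\<dots> = (norm x * norm y)\<^sup>2"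
    unfolding power_mult_distrib power2_norm_eq_inner[of y]
    by (simp add: inner_vec_def power2_eq_square sum_distrib_left)
  finally show ?thesis by (rule power2_le_imp_le) simp
qed

interpretation hadamard: bounded_bilinear hadamard
proof
  show "\<exists>K. \<forall>a b. norm (hadamard a b) \<le> norm a * norm b * K"
    using norm_hadamard by (intro exI[of _ 1]) auto
qed (auto simp: hadamard_def vec_eq_iff algebra_simps)

text \<open>A gauge finer than both mesh bounds still admits a tagged division, so the limits agree.
  This gives meaning to the description in \<open>young_integral\<close>.\<close>

lemma has_young_integral_unique:
  assumes "has_young_integral A g a b I" "has_young_integral A g a b J"
  shows "I = J"
proof (rule ccontr)
  assume "I \<noteq> J"
  define e where "e = norm (I - J) / 2"
  have e: "0 < e" using \<open>I \<noteq> J\<close> by (simp add: e_def)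
  let ?S = "\<lambda>p. \<Sum>(x, K)\<in>p. A x *v (g (Sup K) - g (Inf K))"
  obtain d1 where d1: "0 < d1" "\<And>p. p tagged_division_of {a..b} \<Longrightarrow> (\<lambda>x. ball x d1) fine p \<Longrightarrow> norm (?S p - I) < e"
    using assms(1) e unfolding has_young_integral_def by meson
  obtain d2 where d2: "0 < d2" "\<And>p. p tagged_division_of {a..b} \<Longrightarrow> (\<lambda>x. ball x d2) fine p \<Longrightarrow> norm (?S p - J) < e"
    using assms(2) e unfolding has_young_integral_def by meson
  have "gauge (\<lambda>x::real. ball x (min d1 d2))" using d1 d2 by (intro gauge_ball) auto
  then obtain p where p: "p tagged_division_of {a..b}" "(\<lambda>x. ball x (min d1 d2)) fine p"
    by (rule fine_division_exists_real)
  have "norm (?S p - I) < e" "norm (?S p - J) < e"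
    by (rule d1(2) d2(2); use p in \<open>fastforce simp: fine_def\<close>)+
  then have "norm ((?S p - J) - (?S p - I)) < e + e"
    using norm_triangle_ineq4[of "?S p - J" "?S p - I"] by linarith
  then show False by (simp add: e_def)
qed

lemma young_integral_eq:
  "has_young_integral A g a b I \<Longrightarrow> young_integral A g a b = I"
  unfolding young_integral_def using has_young_integral_unique by blast

text \<open>With \<open>g\<close> frozen at a value \<open>c\<close>, the term
  \<open>hadamard (\<sigma> v - \<sigma> x) c\<close> is itself an integral of
  \<open>\<sigma>'\<close>, so the error is \<integral> \<sigma>'(c - g). It measures the local
  defect of summation by parts.\<close>

lemma hadamard_increment_bound:
  fixes \<sigma> \<sigma>' g :: "real \<Rightarrow> real^'n"
  assumes \<sigma>: "\<And>s. s \<in> {0..T} \<Longrightarrow> (\<sigma> has_vector_derivative \<sigma>' s) (at s within {0..T})"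
    and \<sigma>': "continuous_on {0..T} \<sigma>'" and M: "\<And>s. s \<in> {0..T} \<Longrightarrow> norm (\<sigma>' s) \<le> M"
    and g: "continuous_on {0..T} g"
    and xv: "0 \<le> x" "x \<le> v" "v \<le> T" and \<eta>: "\<And>s. s \<in> {x..v} \<Longrightarrow> norm (c - g s) \<le> \<eta>"
  shows "norm (hadamard (\<sigma> v - \<sigma> x) c - integral {x..v} (\<lambda>s. hadamard (\<sigma>' s) (g s))) \<le> M * \<eta> * (v - x)"
proof -
  have sub: "{x..v} \<subseteq> {0..T}" using xv by auto
  have M0: "0 \<le> M" using M[of x] norm_ge_zero[of "\<sigma>' x"] xv by (meson atLeastAtMost_iff order_trans)
  have \<eta>0: "0 \<le> \<eta>" using \<eta>[of x] norm_ge_zero[of "c - g x"] xv by (meson atLeastAtMost_iff order_refl order_trans)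
  have "((\<lambda>s. hadamard (\<sigma>' s) c) has_integral hadamard (\<sigma> v) c - hadamard (\<sigma> x) c) {x..v}"
  proof (rule fundamental_theorem_of_calculus)
    fix s assume "s \<in> {x..v}"
    then have "(\<sigma> has_vector_derivative \<sigma>' s) (at s within {x..v})"
      using \<sigma>[of s] sub by (auto intro: has_vector_derivative_within_subset)
    then show "((\<lambda>s. hadamard (\<sigma> s) c) has_vector_derivative hadamard (\<sigma>' s) c) (at s within {x..v})"
      by (rule bounded_linear.has_vector_derivative[OF hadamard.bounded_linear_left])
  qed (use xv in simp)
  moreover have "continuous_on {x..v} (\<lambda>s. hadamard (\<sigma>' s) (g s))"
    by (intro hadamard.continuous_on continuous_on_subset[OF \<sigma>' sub] continuous_on_subset[OF g sub])
  then have "((\<lambda>s. hadamard (\<sigma>' s) (g s)) has_integral integral {x..v} (\<lambda>s. hadamard (\<sigma>' s) (g s))) {x..v}"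
    by (intro integrable_integral integrable_continuous_real)
  ultimately have "((\<lambda>s. hadamard (\<sigma>' s) c - hadamard (\<sigma>' s) (g s)) has_integral
      (hadamard (\<sigma> v) c - hadamard (\<sigma> x) c) - integral {x..v} (\<lambda>s. hadamard (\<sigma>' s) (g s))) {x..v}"
    by (rule has_integral_diff)
  then have hi: "((\<lambda>s. hadamard (\<sigma>' s) (c - g s)) has_integral
      hadamard (\<sigma> v - \<sigma> x) c - integral {x..v} (\<lambda>s. hadamard (\<sigma>' s) (g s))) (cbox x v)"
    by (simp add: hadamard.diff_left hadamard.diff_right)
  have "norm (hadamard (\<sigma>' s) (c - g s)) \<le> M * \<eta>" if "s \<in> cbox x v" for s
    using order_trans[OF norm_hadamard mult_mono[OF M[of s] \<eta>[of s]]] that sub M0 by auto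
  then show ?thesis
    using has_integral_bound[OF _ hi, of "M * \<eta>"] M0 \<eta>0 xv by simp
qed

text \<open>Only continuity of \<open>g\<close> is available, so all differentiation falls on
  \<open>\<sigma>\<close>. On a piece \<open>{u..v}\<close> with tag \<open>x\<close>, the
  Riemann--Stieltjes term differs from the increment of \<open>P\<close> by two frozen errors, with
  \<open>c = g v\<close> on \<open>{x..v}\<close> and \<open>c = g u\<close> on
  \<open>{u..x}\<close>; this works for any tag.\<close>

lemma has_young_integral_C1:
  fixes \<sigma> \<sigma>' g :: "real \<Rightarrow> real^'n"
  assumes \<sigma>: "\<And>s. s \<in> {0..T} \<Longrightarrow> (\<sigma> has_vector_derivative \<sigma>' s) (at s within {0..T})"
    and \<sigma>': "continuous_on {0..T} \<sigma>'" and g: "continuous_on {0..T} g" and t: "0 \<le> t" "t \<le> T"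
  shows "has_young_integral (\<lambda>s. diag_mat (\<sigma> s)) g 0 t
    (hadamard (\<sigma> t) (g t) - hadamard (\<sigma> 0) (g 0) - integral {0..t} (\<lambda>s. hadamard (\<sigma>' s) (g s)))"
  unfolding has_young_integral_def
proof (intro allI impI)
  fix e :: real assume e: "0 < e"
  have "compact (\<sigma>' ` {0..T})" by (intro compact_continuous_image \<sigma>') simp
  then obtain M where "\<forall>y\<in>\<sigma>' ` {0..T}. norm y \<le> M" using compact_imp_bounded bounded_iff by blast
  then have M: "norm (\<sigma>' s) \<le> M" if "s \<in> {0..T}" for s using that by auto
  have M0: "0 \<le> M" using M[of t] norm_ge_zero[of "\<sigma>' t"] t by (meson atLeastAtMost_iff order_trans)
  define h where "h s = hadamard (\<sigma>' s) (g s)" for s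
  have hI: "h integrable_on {x..y}" if "0 \<le> x" "y \<le> T" for x y
    unfolding h_def by (intro integrable_continuous_real hadamard.continuous_on
        continuous_on_subset[OF \<sigma>'] continuous_on_subset[OF g]) (use that in auto)
  \<comment> \<open>The candidate for the indefinite integral, up to a constant; its increments
    telescope over any tagged division.\<close>
  define P where "P s = hadamard (\<sigma> s) (g s) - integral {0..s} h" for s
  \<comment> \<open>Makes the total error at most \<open>M * T * \<eta> < e\<close>; the summand 1
    keeps the denominator positive when \<open>M * T = 0\<close>.\<close>
  define \<eta> where "\<eta> = e / (2 * (M * T + 1))"
  have MT: "0 \<le> M * T" using M0 t by simp
  have \<eta>: "0 < \<eta>" unfolding \<eta>_def using e MT by (intro divide_pos_pos) auto
  have "uniformly_continuous_on {0..T} g" by (intro compact_uniformly_continuous g) simp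
  then obtain d where d: "0 < d" "\<And>s r. s \<in> {0..T} \<Longrightarrow> r \<in> {0..T} \<Longrightarrow> dist r s < d \<Longrightarrow> dist (g r) (g s) < \<eta>"
    using \<eta> unfolding uniformly_continuous_on_def by meson
  show "\<exists>d>0. \<forall>p. p tagged_division_of {0..t} \<and> (\<lambda>x. ball x d) fine p \<longrightarrow>
        norm ((\<Sum>(x, K)\<in>p. diag_mat (\<sigma> x) *v (g (Sup K) - g (Inf K))) -
          (hadamard (\<sigma> t) (g t) - hadamard (\<sigma> 0) (g 0) - integral {0..t} (\<lambda>s. hadamard (\<sigma>' s) (g s)))) < e"
  \<comment> \<open>Two points of a piece both lie within \<open>d / 2\<close> of its tag, hence
    within \<open>d\<close> of each other.\<close>
  proof (intro exI[of _ "d / 2"] conjI allI impI)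
    show "0 < d / 2" using d by simp
    fix p assume "p tagged_division_of {0..t} \<and> (\<lambda>x. ball x (d / 2)) fine p"
    then have p: "p tagged_division_of {0..t}" "(\<lambda>x. ball x (d / 2)) fine p" by auto
    have est: "norm (hadamard (\<sigma> x) (g (Sup K) - g (Inf K)) - (P (Sup K) - P (Inf K))) \<le> M * \<eta> * (Sup K - Inf K)"
      if xK: "(x, K) \<in> p" for x K
    proof -
      obtain u v where K: "K = cbox u v" using tagged_division_ofD(4)[OF p(1) xK] by blast
      have x: "x \<in> K" using tagged_division_ofD(2)[OF p(1) xK] .
      have Kt: "K \<subseteq> {0..t}" using tagged_division_ofD(3)[OF p(1) xK] .
      have uv: "u \<le> x" "x \<le> v" using x K by auto
      have SI: "Sup K = v" "Inf K = u" using uv by (auto simp: K)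
      have u0: "0 \<le> u" and vT: "v \<le> T" using Kt uv t by (auto simp: K)
      have Kb: "K \<subseteq> ball x (d / 2)" using p(2) xK by (auto simp: fine_def)
      have osc: "norm (g r - g s) \<le> \<eta>" if "r \<in> {u..v}" "s \<in> {u..v}" for r s
      proof -
        have "dist x r < d / 2" "dist x s < d / 2" using Kb that by (auto simp: K subset_eq)
        then have "dist r s < d" using dist_triangle2[of r s x] by (simp add: dist_commute)
        then show ?thesis using d(2)[of s r] that u0 vT by (simp add: dist_norm less_imp_le)
      qed
      have I: "integral {0..v} h = integral {0..u} h + (integral {u..x} h + integral {x..v} h)"
        using Henstock_Kurzweil_Integration.integral_combine[of 0 u v h] Henstock_Kurzweil_Integration.integral_combine[of u x v h]
          hI u0 vT uv by auto
      have n1: "norm (hadamard (\<sigma> v - \<sigma> x) (g v) - integral {x..v} h) \<le> M * \<eta> * (v - x)"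
        unfolding h_def by (rule hadamard_increment_bound[OF \<sigma> \<sigma>' M g]) (use u0 vT uv osc in auto)
      have n2: "norm (hadamard (\<sigma> x - \<sigma> u) (g u) - integral {u..x} h) \<le> M * \<eta> * (x - u)"
        unfolding h_def by (rule hadamard_increment_bound[OF \<sigma> \<sigma>' M g]) (use u0 vT uv osc in auto)
      have "hadamard (\<sigma> x) (g v - g u) - (P v - P u)
          = - (hadamard (\<sigma> v - \<sigma> x) (g v) - integral {x..v} h) - (hadamard (\<sigma> x - \<sigma> u) (g u) - integral {u..x} h)"
        unfolding P_def I by (simp add: hadamard.diff_left hadamard.diff_right)
      also have "norm \<dots> \<le> M * \<eta> * (v - x) + M * \<eta> * (x - u)"
        by (rule order_trans[OF norm_triangle_ineq4], unfold norm_minus_cancel) (use n1 n2 in simp)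
      finally show ?thesis unfolding SI by (simp add: algebra_simps)
    qed
    have sP: "(\<Sum>(x, K)\<in>p. P (Sup K) - P (Inf K)) = P t - P 0"
      by (rule additive_tagged_division_1[OF t(1) p(1)])
    have sI: "(\<Sum>(x, K)\<in>p. Sup K - Inf K) = t - 0"
      using additive_tagged_division_1[OF t(1) p(1), of "\<lambda>x. x"] by simp
    have "(\<Sum>(x, K)\<in>p. diag_mat (\<sigma> x) *v (g (Sup K) - g (Inf K))) - (P t - P 0)
       = (\<Sum>(x, K)\<in>p. hadamard (\<sigma> x) (g (Sup K) - g (Inf K)) - (P (Sup K) - P (Inf K)))"
      unfolding sP[symmetric] by (simp add: diag_mat_mult sum_subtractf case_prod_unfold)
    also have "norm \<dots> \<le> (\<Sum>(x, K)\<in>p. M * \<eta> * (Sup K - Inf K))"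
      by (rule sum_norm_le) (use est in auto)
    also have "\<dots> = M * \<eta> * t"
      using sI by (simp add: sum_distrib_left[symmetric] case_prod_unfold)
    also have "\<dots> \<le> M * T * \<eta>" using M0 \<eta> t by (simp add: mult_left_mono mult_ac)
    also have "\<dots> < e"
    proof -
      have "M * T * e < 2 * (M * T + 1) * e" using e MT by (intro mult_strict_right_mono) auto
      then show ?thesis unfolding \<eta>_def using MT by (simp add: divide_less_eq mult_ac)
    qed
    finally show "norm ((\<Sum>(x, K)\<in>p. diag_mat (\<sigma> x) *v (g (Sup K) - g (Inf K))) -
          (hadamard (\<sigma> t) (g t) - hadamard (\<sigma> 0) (g 0) - integral {0..t} (\<lambda>s. hadamard (\<sigma>' s) (g s)))) < e"
      by (simp add: P_def h_def[abs_def] algebra_simps)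
  qed
qed

text \<open>The bound \<open>A + L * integral {0..t} y\<close>, damped by
  \<open>exp (- L * t)\<close>, has a nonpositive derivative: its sign is the hypothesis multiplied
  by \<open>L\<close>.\<close>

lemma gronwall:
  fixes y :: "real \<Rightarrow> real"
  assumes y: "continuous_on {0..T} y" and L: "0 \<le> L"
    and le: "\<And>t. t \<in> {0..T} \<Longrightarrow> y t \<le> A + L * integral {0..t} y" and t: "t \<in> {0..T}"
  shows "y t \<le> A * exp (L * t)"
proof -
  define G where "G t = (A + L * integral {0..t} y) * exp (- L * t)" for t
  have "G t \<le> G 0"
  proof (cases "t = 0")
    case False
    then have t0: "0 < t" using t by auto
    have Gc: "continuous_on {0..t} G"
      unfolding G_def
      by (intro continuous_intros indefinite_integral_continuous_1 integrable_continuous_real continuous_on_subset[OF y])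
         (use t in auto)
    show ?thesis
    proof (rule DERIV_nonpos_imp_decreasing_open[OF less_imp_le[OF t0] _ Gc])
      fix x assume x: "0 < x" "x < t"
      have "((\<lambda>t. integral {0..t} y) has_real_derivative y x) (at x within {0..T})"
        unfolding has_real_derivative_iff_has_vector_derivative
        by (rule integral_has_vector_derivative[OF y]) (use x t in auto)
      then have d: "((\<lambda>t. integral {0..t} y) has_real_derivative y x) (at x)"
        using x t by (simp add: at_within_Icc_at)
      have "(G has_real_derivative (L * y x - L * (A + L * integral {0..x} y)) * exp (- L * x)) (at x)"
        unfolding G_def by (auto intro!: derivative_eq_intros d simp: algebra_simps)
      moreover have "(L * y x - L * (A + L * integral {0..x} y)) * exp (- L * x) \<le> 0"
        using mult_left_mono[OF le[of x] L] x t by (intro mult_nonpos_nonneg) auto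
      ultimately show "\<exists>z. (G has_real_derivative z) (at x) \<and> z \<le> 0" by blast
    qed
  qed simp
  then have "A + L * integral {0..t} y \<le> A * exp (L * t)"
    by (simp add: G_def exp_minus field_simps)
  with le[OF t] show ?thesis by simp
qed

lemma c_const_pos: "0 < H \<Longrightarrow> H < 1 \<Longrightarrow> 0 < c_const H"
  unfolding c_const_def by (auto intro!: real_sqrt_gt_zero divide_pos_pos mult_pos_pos Gamma_real_pos)

section \<open>The Cameron--Martin operators\<close>

text \<open>Members of \<open>L2 T\<close> are measurable on \<open>{0..T}\<close> only; extension
  by zero supplies the globally Borel functions on which the fractional transforms are
  studied.\<close>

definition restrict_zero :: "real \<Rightarrow> (real \<Rightarrow> 'a::real_vector) \<Rightarrow> real \<Rightarrow> 'a" where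
  "restrict_zero T u s = indicator {0..T} s *\<^sub>R u s"

lemma restrict_zero_L2:
  assumes "u \<in> L2 T"
  shows "restrict_zero T u \<in> borel_measurable borel"
    and "set_integrable lborel {0..T} (\<lambda>t. (norm (restrict_zero T u t))\<^sup>2)"
    and "L2_norm_on T (restrict_zero T u) = L2_norm_on T u"
proof -
  show "restrict_zero T u \<in> borel_measurable borel"
    using assms by (simp add: L2_def set_borel_measurable_def restrict_zero_def[abs_def])
  have eq: "indicator {0..T} t *\<^sub>R (norm (restrict_zero T u t))\<^sup>2 = indicator {0..T} t *\<^sub>R (norm (u t))\<^sup>2" for t
    by (simp add: restrict_zero_def indicator_def)
  show "set_integrable lborel {0..T} (\<lambda>t. (norm (restrict_zero T u t))\<^sup>2)"
    using assms by (simp add: L2_def set_integrable_def eq del: real_scaleR_def)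
  show "L2_norm_on T (restrict_zero T u) = L2_norm_on T u"
    by (simp add: L2_norm_on_def set_lebesgue_integral_def eq del: real_scaleR_def)
qed

lemma V_frac_cong:
  assumes eq: "\<And>s. s \<in> {0..t} \<Longrightarrow> u s = u' s" and t: "0 \<le> t"
  shows "V_frac a u t = V_frac a u' t"
proof -
  have W: "W_frac a u r = W_frac a u' r" if "r \<in> {0..t}" for r
    unfolding W_frac_def RL_def by (intro set_lebesgue_integral_cong) (use eq that in auto)
  then have "(LINT r:{0..t}|lborel. r powr (a - 1) *\<^sub>R W_frac a u r) = (LINT r:{0..t}|lborel. r powr (a - 1) *\<^sub>R W_frac a u' r)"
    by (intro set_lebesgue_integral_cong) auto
  then show ?thesis using W[of t] t by (simp add: V_frac_def)
qed

lemma K_op_eq: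
  fixes u :: "real \<Rightarrow> real^'n"
  assumes H: "0 < H" "H < 1" and u: "u \<in> L2 T" and t: "t \<in> {0..T}"
  shows "set_integrable lborel {0..t} (\<lambda>s. K_kernel H t s *\<^sub>R u s)"
    and "K_op H u t = c_const H *\<^sub>R V_frac (H - 1/2) (restrict_zero T u) t"
proof -
  let ?a = "H - 1/2" and ?u = "restrict_zero T u"
  let ?k = "\<lambda>s. (t / s) powr ?a * (t - s) powr ?a
       - ?a * s powr (- ?a) * (LINT r:{s..t}|lborel. r powr (?a - 1) * (r - s) powr ?a)"
  have k: "K_kernel H t s = c_const H * ?k s" for s
    unfolding K_kernel_def by simp
  have eq: "indicator {0..t} s *\<^sub>R K_kernel H t s *\<^sub>R u s = indicator {0..t} s *\<^sub>R c_const H *\<^sub>R ?k s *\<^sub>R ?u s" for s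
    unfolding k restrict_zero_def using t by (auto simp: indicator_def)
  have I: "set_integrable lborel {0..t} (\<lambda>s. ?k s *\<^sub>R ?u s)"
    and V: "(LINT s:{0..t}|lborel. ?k s *\<^sub>R ?u s) = V_frac ?a ?u t"
    by (rule V_frac_eq_kernel_integral[where T = T]; use H t restrict_zero_L2[OF u] in auto)+
  have "set_integrable lborel {0..t} (\<lambda>s. c_const H *\<^sub>R ?k s *\<^sub>R ?u s)"
    using I by (rule set_integrable_scaleR_right)
  then show "set_integrable lborel {0..t} (\<lambda>s. K_kernel H t s *\<^sub>R u s)"
    unfolding set_integrable_def eq .
  have "K_op H u t = (LINT s:{0..t}|lborel. c_const H *\<^sub>R ?k s *\<^sub>R ?u s)"
    unfolding K_op_def set_lebesgue_integral_def eq ..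
  also have "\<dots> = c_const H *\<^sub>R V_frac ?a ?u t"
    unfolding V[symmetric] by (rule set_integral_scaleR_right)
  finally show "K_op H u t = c_const H *\<^sub>R V_frac ?a ?u t" .
qed

lemma L2_diff:
  assumes "u \<in> L2 T" "v \<in> L2 T"
  shows "(\<lambda>t. u t - v t) \<in> L2 T"
proof -
  note u = restrict_zero_L2[OF assms(1)] and v = restrict_zero_L2[OF assms(2)]
  have m: "set_borel_measurable lborel {0..T} (\<lambda>t. u t - v t)"
    using u(1) v(1) unfolding set_borel_measurable_def restrict_zero_def[abs_def] scaleR_diff_right by measurable
  have "set_integrable lborel {0..T} (\<lambda>t. (norm (u t - v t))\<^sup>2)"
  proof (rule set_integrable_bound)
    show "set_integrable lborel {0..T} (\<lambda>t. 2 * (norm (u t))\<^sup>2 + 2 * (norm (v t))\<^sup>2)"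
      using assms unfolding L2_def by (intro set_integral_add set_integrable_mult_right) auto
    have eq: "indicator {0..T} t *\<^sub>R (norm (u t - v t))\<^sup>2 = (norm (restrict_zero T u t - restrict_zero T v t))\<^sup>2" for t
      by (simp add: restrict_zero_def indicator_def)
    show "set_borel_measurable lborel {0..T} (\<lambda>t. (norm (u t - v t))\<^sup>2)"
      unfolding set_borel_measurable_def eq using u(1) v(1) by measurable
    have "(norm (u t - v t))\<^sup>2 \<le> 2 * (norm (u t))\<^sup>2 + 2 * (norm (v t))\<^sup>2" for t
    proof -
      have "(norm (u t - v t))\<^sup>2 \<le> (norm (u t) + norm (v t))\<^sup>2"
        by (intro power_mono norm_triangle_ineq4) simp
      also have "\<dots> \<le> 2 * (norm (u t))\<^sup>2 + 2 * (norm (v t))\<^sup>2"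
        using zero_le_power2[of "norm (u t) - norm (v t)"] unfolding power2_sum power2_diff by linarith
      finally show ?thesis .
    qed
    then show "AE t in lborel. t \<in> {0..T} \<longrightarrow> norm ((norm (u t - v t))\<^sup>2) \<le> norm (2 * (norm (u t))\<^sup>2 + 2 * (norm (v t))\<^sup>2)"
      by (intro AE_I2) simp
  qed
  with m show ?thesis by (simp add: L2_def)
qed

lemma K_op_diff:
  fixes u v :: "real \<Rightarrow> real^'n"
  assumes H: "0 < H" "H < 1" and "u \<in> L2 T" "v \<in> L2 T" "t \<in> {0..T}"
  shows "K_op H (\<lambda>t. u t - v t) t = K_op H u t - K_op H v t"
  unfolding K_op_def scaleR_diff_right using K_op_eq(1)[OF H] assms by (intro set_integral_diff(2)) auto

lemma K_op_continuous:
  fixes u :: "real \<Rightarrow> real^'n"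
  assumes H: "0 < H" "H < 1" and u: "u \<in> L2 T" and T: "0 \<le> T"
  shows "continuous_on {0..T} (K_op H u)"
proof -
  have "continuous_on {0..T} (\<lambda>t. c_const H *\<^sub>R V_frac (H - 1/2) (restrict_zero T u) t)"
    using V_frac_continuous[of "H - 1/2" "restrict_zero T u" T] restrict_zero_L2[OF u] H T
    by (intro continuous_intros) auto
  then show ?thesis
    by (rule continuous_on_eq) (simp add: K_op_eq(2)[OF H u])
qed

lemma K_op_bound:
  assumes H: "0 < H" "H < 1" and T: "0 < T"
  shows "\<exists>C\<ge>0. \<forall>u::real \<Rightarrow> real^'n. u \<in> L2 T \<longrightarrow> (\<forall>t\<in>{0..T}. norm (K_op H u t) \<le> C * L2_norm_on T u)"
proof (intro exI conjI allI impI ballI)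
  let ?a = "H - 1/2"
  let ?C = "W_bound ?a * (1 + \<bar>?a\<bar> / (?a + 1/2))"
  have "0 \<le> \<bar>?a\<bar> / (?a + 1/2)" by (rule divide_nonneg_nonneg) (use H in auto)
  then have W: "0 \<le> ?C" using W_bound_nonneg[of ?a] H by (intro mult_nonneg_nonneg) auto
  have c: "0 < c_const H" by (rule c_const_pos[OF H])
  show "0 \<le> c_const H * (?C * T powr (?a + 1/2))"
    by (rule mult_nonneg_nonneg[OF less_imp_le[OF c] mult_nonneg_nonneg[OF W powr_ge_zero]])
  fix u :: "real \<Rightarrow> real^'n" and t assume u: "u \<in> L2 T" and t: "t \<in> {0..T}"
  have "norm (V_frac ?a (restrict_zero T u) t) \<le> ?C * t powr (?a + 1/2) * L2_norm_on T (restrict_zero T u)"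
    by (rule V_frac_bound) (use H t restrict_zero_L2[OF u] in auto)
  also have "\<dots> \<le> ?C * T powr (?a + 1/2) * L2_norm_on T (restrict_zero T u)"
    using t H W by (intro mult_right_mono mult_left_mono powr_mono2 L2_norm_on_nonneg) auto
  finally have "c_const H * norm (V_frac ?a (restrict_zero T u) t) \<le> c_const H * (?C * T powr (?a + 1/2) * L2_norm_on T u)"
    unfolding restrict_zero_L2(3)[OF u] by (rule mult_left_mono) (use c in simp)
  then show "norm (K_op H u t) \<le> c_const H * (?C * T powr (?a + 1/2)) * L2_norm_on T u"
    using c by (simp add: K_op_eq(2)[OF H u t] mult.assoc)
qed

lemma K_op_injective:
  fixes u :: "real \<Rightarrow> real^'n"
  assumes H: "1/4 < H" "H < 1" and T: "0 < T" and u: "u \<in> L2 T"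
    and z: "\<And>t. t \<in> {0..T} \<Longrightarrow> K_op H u t = 0"
  shows "AE t in lborel. t \<in> {0..T} \<longrightarrow> u t = 0"
proof -
  have H0: "0 < H" using H by simp
  have "AE t in lborel. t \<in> {0..T} \<longrightarrow> restrict_zero T u t = 0"
    by (rule V_frac_injective[where a = "H - 1/2"])
       (use H T restrict_zero_L2[OF u] z K_op_eq(2)[OF H0 H(2) u] c_const_pos[OF H0 H(2)] in auto)
  then show ?thesis by eventually_elim (auto simp: restrict_zero_def)
qed

lemma K_op_Hoelder:
  fixes u :: "real \<Rightarrow> real^'n"
  assumes H: "1/2 < H" "H < 1" and T: "0 < T" and u: "u \<in> L2 T"
  shows "\<exists>C. \<forall>s t. 0 \<le> s \<longrightarrow> s < t \<longrightarrow> t \<le> T \<longrightarrow> norm (K_op H u t - K_op H u s) \<le> C * sqrt (t - s)"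
proof -
  let ?V = "V_frac (H - 1/2) (restrict_zero T u)"
  have H0: "0 < H" using H by simp
  have "\<exists>C. \<forall>s t. 0 \<le> s \<longrightarrow> s < t \<longrightarrow> t \<le> T \<longrightarrow> norm (?V t - ?V s) \<le> C * sqrt (t - s)"
    by (rule V_frac_Hoelder) (use H T restrict_zero_L2[OF u] in auto)
  then obtain C where C: "\<And>s t. 0 \<le> s \<Longrightarrow> s < t \<Longrightarrow> t \<le> T \<Longrightarrow> norm (?V t - ?V s) \<le> C * sqrt (t - s)"
    by blast
  show ?thesis
  proof (intro exI allI impI)
    fix s t assume st: "0 \<le> s" "s < t" "t \<le> T"
    have c: "0 < c_const H" by (rule c_const_pos[OF H0 H(2)])
    have "K_op H u t - K_op H u s = c_const H *\<^sub>R (?V t - ?V s)"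
      using st by (simp add: K_op_eq(2)[OF H0 H(2) u] scaleR_diff_right)
    then have "norm (K_op H u t - K_op H u s) = c_const H * norm (?V t - ?V s)" using c by simp
    also have "\<dots> \<le> c_const H * (C * sqrt (t - s))"
      using c by (intro mult_left_mono C st) auto
    finally show "norm (K_op H u t - K_op H u s) \<le> c_const H * C * sqrt (t - s)" by (simp add: mult.assoc)
  qed
qed

text \<open>The Hoelder condition is asked for \<open>1/2 < H\<close> only, where a fractional
  derivative has to be taken; for the other values of \<open>H\<close> boundedness of
  \<open>f\<close> is what the Abel equation uses.\<close>

lemma K_op_range:
  fixes f :: "real \<Rightarrow> real^'n"
  assumes H: "0 < H" "H < 1" and T: "0 < T" and f: "continuous_on {0..T} f"
    and Hf: "1/2 < H \<Longrightarrow> \<exists>C. \<forall>s t. 0 \<le> s \<longrightarrow> s < t \<longrightarrow> t \<le> T \<longrightarrow> norm (f t - f s) \<le> C * sqrt (t - s)"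
  shows "\<exists>u\<in>L2 T. \<forall>t\<in>{0..T}. K_op H u t = integral {0..t} f"
proof -
  define c where "c = c_const H"
  have c: "0 < c" unfolding c_def by (rule c_const_pos[OF H])
  define h where "h s = indicator {0..T} s *\<^sub>R ((1 / c) *\<^sub>R f s)" for s
  have hf: "h s = (1 / c) *\<^sub>R f s" if "s \<in> {0..T}" for s using that by (simp add: h_def)
  have "(\<lambda>s. indicator {0..T} s *\<^sub>R ((1 / c) *\<^sub>R f s)) \<in> borel_measurable borel"
    by (rule borel_measurable_continuous_on_indicator) (auto intro!: continuous_intros f)
  then have hm: "h \<in> borel_measurable borel" by (simp add: h_def[abs_def])
  have "compact (f ` {0..T})" by (intro compact_continuous_image f) simp
  then obtain B where "\<forall>y\<in>f ` {0..T}. norm y \<le> B" using compact_imp_bounded bounded_iff by blast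
  then have hB: "norm (h s) \<le> B / c" if "s \<in> {0..T}" for s
    using that c by (simp add: hf divide_right_mono)
  have "\<exists>u. u \<in> borel_measurable borel \<and> set_integrable lborel {0..T} (\<lambda>t. (norm (u t))\<^sup>2) \<and>
     (\<forall>t\<in>{0..T}. V_frac (H - 1/2) u t = (LINT q:{0..t}|lborel. h q))"
  proof -
    consider "H < 1/2" | "H = 1/2" | "1/2 < H" by linarith
    then show ?thesis
    proof cases
      case 1
      then show ?thesis by (intro V_frac_range_neg[where B = "B / c"]) (use H T hm hB in auto)
    next
      case 2
      then have "H - 1/2 = 0" by simp
      show ?thesis unfolding \<open>H - 1/2 = 0\<close>
        by (rule V_frac_range_zero[where B = "B / c"]) (use T hm hB in auto)
    next
      case 3
      then obtain C where C: "\<And>s t. 0 \<le> s \<Longrightarrow> s < t \<Longrightarrow> t \<le> T \<Longrightarrow> norm (f t - f s) \<le> C * sqrt (t - s)"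
        using Hf by blast
      show ?thesis
      proof (rule V_frac_range_pos[where B = "B / c" and Cf = "C / c"])
        fix r s assume rs: "0 \<le> r" "r < s" "s \<le> T"
        then have "h s - h r = (1 / c) *\<^sub>R (f s - f r)" by (simp add: hf scaleR_diff_right)
        then have "norm (h s - h r) = norm (f s - f r) / c" using c by simp
        also have "\<dots> \<le> C * sqrt (s - r) / c" using C[OF rs] c by (intro divide_right_mono) auto
        finally show "norm (h s - h r) \<le> C / c * sqrt (s - r)" by simp
      qed (use 3 H T hm hB in auto)
    qed
  qed
  then obtain u where um: "u \<in> borel_measurable borel" and u2: "set_integrable lborel {0..T} (\<lambda>t. (norm (u t))\<^sup>2)"
     and uV: "\<And>t. t \<in> {0..T} \<Longrightarrow> V_frac (H - 1/2) u t = (LINT q:{0..t}|lborel. h q)"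
    by blast
  have L: "u \<in> L2 T"
    using um u2 by (simp add: L2_def set_borel_measurable_def)
  have "K_op H u t = integral {0..t} f" if t: "t \<in> {0..T}" for t
  proof -
    have "K_op H u t = c *\<^sub>R V_frac (H - 1/2) (restrict_zero T u) t"
      unfolding c_def by (rule K_op_eq(2)[OF H L t])
    also have "V_frac (H - 1/2) (restrict_zero T u) t = V_frac (H - 1/2) u t"
      by (rule V_frac_cong) (use t in \<open>auto simp: restrict_zero_def\<close>)
    also have "\<dots> = (LINT q:{0..t}|lborel. (1 / c) *\<^sub>R f q)"
      unfolding uV[OF t] by (intro set_lebesgue_integral_cong) (use t hf in auto)
    also have "\<dots> = (1 / c) *\<^sub>R integral {0..t} f"
    proof -
      have "set_integrable lborel {0..t} f"
        by (rule borel_integrable_atLeastAtMost'[OF continuous_on_subset[OF f]]) (use t in auto)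
      then show ?thesis by (simp add: set_borel_integral_eq_integral)
    qed
    finally show ?thesis using c by simp
  qed
  with L show ?thesis by blast
qed

lemma LINT_singleton: "(LINT s:{c..c}|lborel. f s) = 0" for f :: "real \<Rightarrow> 'a::{banach, second_countable_topology}"
  unfolding set_lebesgue_integral_def
proof (rule integral_eq_zero_AE)
  show "AE s in lborel. indicator {c..c} s *\<^sub>R f s = 0"
    using AE_lborel_neq[of c] by eventually_elim simp
qed

section \<open>Elementary estimates on a compact interval\<close>

lemma compact_norm_bound:
  fixes f :: "real \<Rightarrow> 'a::real_normed_vector"
  assumes "continuous_on {0..T} f"
  shows "\<exists>M\<ge>0. \<forall>t\<in>{0..T}. norm (f t) \<le> M"
proof -
  have "compact (f ` {0..T})" by (intro compact_continuous_image assms) simp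
  then have "bounded (f ` {0..T})" by (rule compact_imp_bounded)
  then obtain M where "0 < M" "\<forall>y\<in>f ` {0..T}. norm y \<le> M" by (auto simp: bounded_pos)
  then show ?thesis by (intro exI[of _ M]) auto
qed

lemma norm_increment_le:
  fixes f :: "real \<Rightarrow> 'a::euclidean_space"
  assumes d: "\<And>s. s \<in> {0..T} \<Longrightarrow> (f has_vector_derivative f' s) (at s within {0..T})"
    and M: "\<And>s. s \<in> {0..T} \<Longrightarrow> norm (f' s) \<le> M" and st: "0 \<le> s" "s \<le> t" "t \<le> T"
  shows "norm (f t - f s) \<le> M * (t - s)"
proof -
  have "(f' has_integral (f t - f s)) (cbox s t)"
    unfolding box_real
  proof (rule fundamental_theorem_of_calculus)
    show "(f has_vector_derivative f' x) (at x within {s..t})" if "x \<in> {s..t}" for x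
      by (rule has_vector_derivative_within_subset[OF d]) (use that st in auto)
  qed (use st in simp)
  moreover have "0 \<le> M" using order_trans[OF norm_ge_zero M[of s]] st by simp
  ultimately show ?thesis
    using has_integral_bound[of M f' "f t - f s" s t] M st by simp
qed

text \<open>Absorbs Lipschitz terms into 1/2-Hoelder bounds.\<close>

lemma linear_le_sqrt:
  fixes d :: real
  assumes "0 \<le> d" "d \<le> T"
  shows "d \<le> sqrt T * sqrt d"
proof -
  have "d = sqrt d * sqrt d" using assms by simp
  also have "\<dots> \<le> sqrt T * sqrt d" using assms by (intro mult_right_mono) auto
  finally show ?thesis .
qed

section \<open>Regularity of the drift\<close>

lemma Cb_space_SucD:
  assumes "Cb_space (Suc k) T f"
  shows "Cb_joint T f" "\<And>t x. t \<in> {0..T} \<Longrightarrow> f t differentiable (at x)"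
    "\<And>i. Cb_space k T (\<lambda>t x. frechet_derivative (f t) (at x) (axis i 1))"
  using assms by auto

lemma Cb_space_imp_joint: "Cb_space k T f \<Longrightarrow> Cb_joint T f"
  by (cases k) auto

lemma Cb_joint_bound:
  assumes "Cb_joint T f"
  shows "\<exists>M\<ge>0. \<forall>t\<in>{0..T}. \<forall>x. norm (f t x) \<le> M"
proof -
  obtain M where "0 < M" "\<forall>y\<in>(\<lambda>(t, x). f t x) ` ({0..T} \<times> UNIV). norm y \<le> M"
    using assms unfolding Cb_joint_def bounded_pos by blast
  then show ?thesis by (intro exI[of _ M]) auto
qed

lemma linear_expand_axis:
  fixes g :: "real^'n \<Rightarrow> 'a::real_vector"
  assumes "linear g"
  shows "g h = (\<Sum>i\<in>UNIV. h $ i *\<^sub>R g (axis i 1))"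
proof -
  have "g h = g (\<Sum>i\<in>UNIV. (h $ i) *\<^sub>R axis i 1)"
    using basis_expansion[of h] by (simp add: scalar_mult_eq_scaleR)
  also have "\<dots> = (\<Sum>i\<in>UNIV. h $ i *\<^sub>R g (axis i 1))"
    by (simp add: linear_sum[OF assms] linear_scale[OF assms])
  finally show ?thesis .
qed

lemma norm_linear_le_axis:
  fixes g :: "real^'n \<Rightarrow> 'a::real_normed_vector"
  assumes g: "linear g" and M: "\<And>i. norm (g (axis i 1)) \<le> M i"
  shows "norm (g h) \<le> (\<Sum>i\<in>UNIV. M i) * norm h"
proof -
  have "norm (g h) \<le> (\<Sum>i\<in>UNIV. norm (h $ i *\<^sub>R g (axis i 1)))"
    unfolding linear_expand_axis[OF g, of h] by (rule norm_sum)
  also have "\<dots> \<le> (\<Sum>i\<in>UNIV. norm h * M i)"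
    by (intro sum_mono) (auto intro!: mult_mono M component_le_norm_cart)
  finally show ?thesis by (simp add: sum_distrib_left mult.commute)
qed

lemma Cb_space_Lipschitz:
  fixes f :: "real \<Rightarrow> real^'n \<Rightarrow> real^'n"
  assumes f: "Cb_space (Suc k) T f"
  shows "\<exists>L\<ge>0. \<forall>t\<in>{0..T}. \<forall>x y. norm (f t x - f t y) \<le> L * norm (x - y)"
proof -
  define p where "p i t x = frechet_derivative (f t) (at x) (axis i 1)" for i t x
  have "\<forall>i. \<exists>M\<ge>0. \<forall>t\<in>{0..T}. \<forall>x. norm (p i t x) \<le> M"
    using Cb_joint_bound[OF Cb_space_imp_joint[OF Cb_space_SucD(3)[OF f]]] by (simp add: p_def)
  then obtain M where M: "\<And>i. 0 \<le> M i" "\<And>i t x. t \<in> {0..T} \<Longrightarrow> norm (p i t x) \<le> M i" by metis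
  show ?thesis
  proof (intro exI[of _ "\<Sum>i\<in>UNIV. M i"] conjI ballI allI)
    fix t x y assume t: "t \<in> {0..T}"
    show "norm (f t x - f t y) \<le> (\<Sum>i\<in>UNIV. M i) * norm (x - y)"
    proof (rule differentiable_bound[where S = UNIV])
      fix z
      have d: "(f t has_derivative frechet_derivative (f t) (at z)) (at z)"
        using Cb_space_SucD(2)[OF f t] by (simp add: frechet_derivative_works)
      then show "(f t has_derivative frechet_derivative (f t) (at z)) (at z within UNIV)" by simp
      show "onorm (frechet_derivative (f t) (at z)) \<le> (\<Sum>i\<in>UNIV. M i)"
        using norm_linear_le_axis[OF has_derivative_linear[OF d], of M] M(2)[OF t]
        by (intro onorm_le) (auto simp: p_def)
    qed auto
  qed (simp add: sum_nonneg M(1))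
qed

text \<open>Mean value inequality for \<open>f t\<close> minus its linearisation at
  \<open>x\<close>: on the segment, the derivative of this difference is controlled by the Lipschitz
  constants of the partial derivatives.\<close>

lemma Cb_space_Taylor:
  fixes f :: "real \<Rightarrow> real^'n \<Rightarrow> real^'n"
  assumes f: "Cb_space (Suc (Suc k)) T f"
  shows "\<exists>Q\<ge>0. \<forall>t\<in>{0..T}. \<forall>x y.
    norm (f t y - f t x - frechet_derivative (f t) (at x) (y - x)) \<le> Q * (norm (y - x))\<^sup>2"
proof -
  define p where "p i t x = frechet_derivative (f t) (at x) (axis i 1)" for i t x
  have "\<forall>i. \<exists>M\<ge>0. \<forall>t\<in>{0..T}. \<forall>x y. norm (p i t x - p i t y) \<le> M * norm (x - y)"
    using Cb_space_Lipschitz[OF Cb_space_SucD(3)[OF f]] by (simp add: p_def)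
  then obtain M where M: "\<And>i. 0 \<le> M i"
    "\<And>i t x y. t \<in> {0..T} \<Longrightarrow> norm (p i t x - p i t y) \<le> M i * norm (x - y)" by metis
  show ?thesis
  proof (intro exI[of _ "\<Sum>i\<in>UNIV. M i"] conjI ballI allI)
    fix t x y assume t: "t \<in> {0..T}"
    have d: "(f t has_derivative frechet_derivative (f t) (at z)) (at z within S)" for z S
      using Cb_space_SucD(2)[OF f t] has_derivative_at_withinI by (simp add: frechet_derivative_works) blast
    have lin: "linear (frechet_derivative (f t) (at z))" for z
      using has_derivative_linear[OF d[of z UNIV]] .
    have bl: "bounded_linear (frechet_derivative (f t) (at z))" for z
      using has_derivative_bounded_linear[OF d[of z UNIV]] .
    define g where "g z = f t z - frechet_derivative (f t) (at x) z" for z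
    have "norm (g y - g x) \<le> ((\<Sum>i\<in>UNIV. M i) * norm (y - x)) * norm (y - x)"
    proof (rule differentiable_bound[where S = "closed_segment x y"])
      fix z assume z: "z \<in> closed_segment x y"
      let ?d = "\<lambda>h. frechet_derivative (f t) (at z) h - frechet_derivative (f t) (at x) h"
      show "(g has_derivative ?d) (at z within closed_segment x y)"
        unfolding g_def[abs_def]
        by (intro has_derivative_diff d bounded_linear_imp_has_derivative bl)
      have zx: "norm (z - x) \<le> norm (y - x)"
        using segment_bound(1)[OF z] by simp
      have "norm (?d h) \<le> (\<Sum>i\<in>UNIV. M i * norm (y - x)) * norm h" for h
      proof (rule norm_linear_le_axis)
        show "linear ?d" by (intro linear_compose_sub lin)
        show "norm (?d (axis i 1)) \<le> M i * norm (y - x)" for i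
          using order_trans[OF M(2)[OF t, of i z x] mult_left_mono[OF zx M(1)]] by (simp add: p_def)
      qed
      then show "onorm ?d \<le> (\<Sum>i\<in>UNIV. M i) * norm (y - x)"
        by (intro onorm_le) (simp add: sum_distrib_right)
    qed auto
    then show "norm (f t y - f t x - frechet_derivative (f t) (at x) (y - x)) \<le> (\<Sum>i\<in>UNIV. M i) * (norm (y - x))\<^sup>2"
      by (simp add: g_def linear_diff[OF lin] power2_eq_square algebra_simps)
  qed (simp add: sum_nonneg M(1))
qed

lemma Cb_joint_along:
  assumes f: "Cb_joint T f" and \<phi>: "continuous_on {0..T} \<phi>"
  shows "continuous_on {0..T} (\<lambda>t. f t (\<phi> t))"
proof -
  have "continuous_on {0..T} ((\<lambda>(t, x). f t x) \<circ> (\<lambda>t. (t, \<phi> t)))"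
    by (intro continuous_on_compose continuous_intros \<phi>)
       (use f in \<open>auto simp: Cb_joint_def intro: continuous_on_subset\<close>)
  then show ?thesis by (simp add: comp_def)
qed

lemma divergence_along_continuous:
  assumes f: "Cb_space (Suc k) T f" and \<phi>: "continuous_on {0..T} \<phi>"
  shows "continuous_on {0..T} (\<lambda>t. divergence (f t) (\<phi> t))"
  unfolding divergence_def
  by (intro continuous_intros Cb_joint_along[OF Cb_space_imp_joint[OF Cb_space_SucD(3)[OF f]] \<phi>])

text \<open>The partial derivatives \<open>p i\<close> are twice differentiable, so each has a
  quadratic Taylor remainder. Criticality acts on the sum alone: the \<open>i\<close>-th components
  of the linear terms add up to the derivative of the divergence, which is 0, though each may be
  nonzero.\<close>

lemma divergence_quadratic_at_critical:
  fixes f :: "real \<Rightarrow> real^'n \<Rightarrow> real^'n"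
  assumes f: "Cb_space (Suc (Suc (Suc k))) T f"
  shows "\<exists>Q\<ge>0. \<forall>t\<in>{0..T}. \<forall>x y. (GDERIV (divergence (f t)) x :> 0) \<longrightarrow>
    \<bar>divergence (f t) y - divergence (f t) x\<bar> \<le> Q * (norm (y - x))\<^sup>2"
proof -
  define p where "p i t x = frechet_derivative (f t) (at x) (axis i 1)" for i t x
  have p: "Cb_space (Suc (Suc k)) T (p i)" for i
    using Cb_space_SucD(3)[OF f] by (simp add: p_def[abs_def])
  have "\<forall>i. \<exists>M\<ge>0. \<forall>t\<in>{0..T}. \<forall>x y.
      norm (p i t y - p i t x - frechet_derivative (p i t) (at x) (y - x)) \<le> M * (norm (y - x))\<^sup>2"
    using Cb_space_Taylor[OF p] by blast
  then obtain M where M: "\<And>i. 0 \<le> M i" "\<And>i t x y. t \<in> {0..T} \<Longrightarrow>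
      norm (p i t y - p i t x - frechet_derivative (p i t) (at x) (y - x)) \<le> M i * (norm (y - x))\<^sup>2" by metis
  have div: "divergence (f t) x = (\<Sum>i\<in>UNIV. p i t x $ i)" for t x
    by (simp add: divergence_def p_def)
  show ?thesis
  proof (intro exI[of _ "\<Sum>i\<in>UNIV. M i"] conjI ballI allI impI)
    fix t x y assume t: "t \<in> {0..T}" and crit: "GDERIV (divergence (f t)) x :> 0"
    let ?d = "\<lambda>i. frechet_derivative (p i t) (at x)"
    have "(p i t has_derivative ?d i) (at x)" for i
      using Cb_space_SucD(2)[OF p t] by (simp add: frechet_derivative_works)
    then have "((\<lambda>x. \<Sum>i\<in>UNIV. p i t x $ i) has_derivative (\<lambda>h. \<Sum>i\<in>UNIV. ?d i h $ i)) (at x)"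
      by (intro has_derivative_sum bounded_linear.has_derivative[OF bounded_linear_vec_nth])
    moreover have "((\<lambda>x. \<Sum>i\<in>UNIV. p i t x $ i) has_derivative (\<lambda>h. 0)) (at x)"
      using crit by (simp add: gderiv_def div[abs_def])
    ultimately have "(\<lambda>h. \<Sum>i\<in>UNIV. ?d i h $ i) = (\<lambda>h. 0)"
      by (rule has_derivative_unique)
    then have z: "(\<Sum>i\<in>UNIV. ?d i (y - x) $ i) = 0" by metis
    have "divergence (f t) y - divergence (f t) x = (\<Sum>i\<in>UNIV. (p i t y - p i t x - ?d i (y - x)) $ i)"
      using z by (simp add: div sum_subtractf)
    also have "\<bar>\<dots>\<bar> \<le> (\<Sum>i\<in>UNIV. M i * (norm (y - x))\<^sup>2)"
      by (rule order_trans[OF sum_abs sum_mono])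
         (rule order_trans[OF component_le_norm_cart M(2)[OF t]])
    finally show "\<bar>divergence (f t) y - divergence (f t) x\<bar> \<le> (\<Sum>i\<in>UNIV. M i) * (norm (y - x))\<^sup>2"
      by (simp add: sum_distrib_right)
  qed (simp add: sum_nonneg M(1))
qed

lemma assumption_A_sigma:
  fixes \<sigma> :: "real \<Rightarrow> real^'n"
  assumes "assumption_A T b \<sigma>"
  obtains \<sigma>' m where
    "\<And>s. s \<in> {0..T} \<Longrightarrow> (\<sigma> has_vector_derivative \<sigma>' s) (at s within {0..T})"
    "continuous_on {0..T} \<sigma>'" "0 < m" "\<And>s i. s \<in> {0..T} \<Longrightarrow> m \<le> \<sigma> s $ i"
proof -
  have "\<forall>i. \<exists>f'. (\<forall>t\<in>{0..T}. ((\<lambda>t. \<sigma> t $ i) has_real_derivative f' t) (at t within {0..T})) \<and> continuous_on {0..T} f'"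
    using assms by (simp add: assumption_A_def C1_on_interval_def)
  then obtain f where f: "\<And>i t. t \<in> {0..T} \<Longrightarrow> ((\<lambda>t. \<sigma> t $ i) has_real_derivative f i t) (at t within {0..T})"
    "\<And>i. continuous_on {0..T} (f i)" by metis
  obtain m where m: "\<And>i. 0 < m i" "\<And>i t. t \<in> {0..T} \<Longrightarrow> m i \<le> \<sigma> t $ i"
    using assms unfolding assumption_A_def by blast
  show ?thesis
  \<comment> \<open>Positive lower bounds for the finitely many components combine into one by
    taking their minimum.\<close>
  proof (rule that[of "\<lambda>t. \<chi> i. f i t" "Min (range m)"])
    show "(\<sigma> has_vector_derivative (\<chi> i. f i s)) (at s within {0..T})" if s: "s \<in> {0..T}" for s
      unfolding has_vector_derivative_def
    proof (subst has_derivative_componentwise_within, intro ballI)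
      fix v :: "real^'n" assume "v \<in> Basis"
      then obtain i where v: "v = axis i 1" by (auto simp: Basis_vec_def)
      show "((\<lambda>x. \<sigma> x \<bullet> v) has_derivative (\<lambda>x. (x *\<^sub>R (\<chi> i. f i s)) \<bullet> v)) (at s within {0..T})"
        using f(1)[OF s, of i] by (simp add: v inner_axis has_field_derivative_def mult.commute[of _ "f i s"] del: mult.commute)
    qed
    show "continuous_on {0..T} (\<lambda>t. \<chi> i. f i t)" by (intro continuous_intros f(2))
    show "0 < Min (range m)" using m(1) by simp
    show "Min (range m) \<le> \<sigma> s $ i" if "s \<in> {0..T}" for s i
      by (rule order_trans[OF Min_le m(2)[OF that]]) auto
  qed
qed

lemma Cb_1_3_time_Lipschitz:
  assumes "Cb_1_3 T b"
  shows "\<exists>B\<ge>0. \<forall>s t x. 0 \<le> s \<longrightarrow> s \<le> t \<longrightarrow> t \<le> T \<longrightarrow> norm (b t x - b s x) \<le> B * (t - s)"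
proof -
  obtain b' where b': "\<And>t x. t \<in> {0..T} \<Longrightarrow> ((\<lambda>s. b s x) has_vector_derivative b' t x) (at t within {0..T})"
    "Cb_joint T b'" using assms unfolding Cb_1_3_def by blast
  obtain B where B: "0 \<le> B" "\<And>t x. t \<in> {0..T} \<Longrightarrow> norm (b' t x) \<le> B" using Cb_joint_bound[OF b'(2)] by blast
  have "norm (b t x - b s x) \<le> B * (t - s)" if "0 \<le> s" "s \<le> t" "t \<le> T" for s t x
    by (rule norm_increment_le[where f = "\<lambda>s. b s x" and f' = "\<lambda>s. b' s x", OF b'(1) B(2) that])
  with B(1) show ?thesis by blast
qed

text \<open>Keeps the 1/2-Hoelder class stable under the drift, as the range statement for
  \<open>1/2 < H\<close> demands.\<close>

lemma Cb_1_3_along_Hoelder: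
  assumes b: "Cb_1_3 T b"
    and \<phi>: "\<exists>C. \<forall>s t. 0 \<le> s \<longrightarrow> s < t \<longrightarrow> t \<le> T \<longrightarrow> norm (\<phi> t - \<phi> s) \<le> C * sqrt (t - s)"
  shows "\<exists>C. \<forall>s t. 0 \<le> s \<longrightarrow> s < t \<longrightarrow> t \<le> T \<longrightarrow> norm (b t (\<phi> t) - b s (\<phi> s)) \<le> C * sqrt (t - s)"
proof -
  have b3: "Cb_space (Suc (Suc (Suc 0))) T b" using b by (simp only: Cb_1_3_def numeral_3_eq_3)
  obtain C where C: "\<And>s t. 0 \<le> s \<Longrightarrow> s < t \<Longrightarrow> t \<le> T \<Longrightarrow> norm (\<phi> t - \<phi> s) \<le> C * sqrt (t - s)" using \<phi> by blast
  obtain B where B: "0 \<le> B" "\<And>s t x. 0 \<le> s \<Longrightarrow> s \<le> t \<Longrightarrow> t \<le> T \<Longrightarrow> norm (b t x - b s x) \<le> B * (t - s)"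
    using Cb_1_3_time_Lipschitz[OF b] by blast
  obtain L where L: "0 \<le> L" "\<And>t x y. t \<in> {0..T} \<Longrightarrow> norm (b t x - b t y) \<le> L * norm (x - y)"
    using Cb_space_Lipschitz[OF b3] by blast
  have "norm (b t (\<phi> t) - b s (\<phi> s)) \<le> (L * C + B * sqrt T) * sqrt (t - s)"
    if st: "0 \<le> s" "s < t" "t \<le> T" for s t
  proof -
    have "b t (\<phi> t) - b s (\<phi> s) = (b t (\<phi> t) - b t (\<phi> s)) + (b t (\<phi> s) - b s (\<phi> s))" by simp
    also have "norm \<dots> \<le> L * norm (\<phi> t - \<phi> s) + B * (t - s)"
      by (rule norm_triangle_le, rule add_mono) (use L(2)[of t] B(2)[of s t] st in auto)
    also have "\<dots> \<le> L * (C * sqrt (t - s)) + B * (sqrt T * sqrt (t - s))"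
      by (intro add_mono mult_left_mono C linear_le_sqrt L(1) B(1)) (use st in auto)
    finally show ?thesis by (simp add: algebra_simps)
  qed
  then show ?thesis by blast
qed

lemma LINT_eq_integral_Icc:
  fixes f :: "real \<Rightarrow> 'a::euclidean_space"
  assumes "continuous_on {0..T} f" "t \<in> {0..T}"
  shows "(LINT s:{0..t}|lborel. f s) = integral {0..t} f"
  by (rule set_borel_integral_eq_integral(2)[OF borel_integrable_atLeastAtMost'[OF continuous_on_subset[OF assms(1)]]])
     (use assms(2) in auto)

text \<open>One number \<open>N\<close> controls both the excess of \<open>J\<close> and the
  distance to \<open>X\<close>, so a competitor with no excess has \<open>N = 0\<close> and
  coincides with \<open>X\<close> on \<open>{0..T}\<close>. The set \<open>S\<close> is arbitrary,
  so the same gap serves the free and the bridge problem.\<close>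

lemma unique_minimizerI:
  fixes X :: "real \<Rightarrow> real^'n"
  assumes "X \<in> S"
    and gap: "\<And>\<phi>. \<phi> \<in> S \<Longrightarrow> \<exists>N. J X + k * N\<^sup>2 \<le> J \<phi> \<and> (\<forall>t\<in>{0..T}. norm (\<phi> t - X t) \<le> C * N)"
    and k: "0 < k"
  shows "unique_minimizer T J S X"
  unfolding unique_minimizer_def is_arg_min_def
proof (intro conjI allI impI ballI notI)
  show "X \<in> S" by fact
  have ge: "J X \<le> J \<phi>" if \<phi>: "\<phi> \<in> S" for \<phi>
  proof -
    obtain N where "J X + k * N\<^sup>2 \<le> J \<phi>" using gap[OF \<phi>] by blast
    moreover have "0 \<le> k * N\<^sup>2" using k by simp
    ultimately show ?thesis by linarith
  qed
  { assume "\<exists>\<phi>. \<phi> \<in> S \<and> J \<phi> < J X"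
    then show False using ge by force }
  fix \<psi> t assume \<psi>: "\<psi> \<in> S \<and> (\<nexists>y. y \<in> S \<and> J y < J \<psi>)" and t: "t \<in> {0..T}"
  then obtain N where N: "J X + k * N\<^sup>2 \<le> J \<psi>" "\<forall>t\<in>{0..T}. norm (\<psi> t - X t) \<le> C * N" using gap by blast
  have "J \<psi> \<le> J X" using \<psi> \<open>X \<in> S\<close> by force
  with N(1) have "k * N\<^sup>2 \<le> 0" by linarith
  with k have "N = 0" by (simp add: mult_le_0_iff)
  with N(2) t show "\<psi> t = X t" by auto
qed

section \<open>Injectivity and range of the weighted operator\<close>

context
  fixes T H m :: real and \<sigma> \<sigma>' :: "real \<Rightarrow> real^'n"
  assumes H: "1/4 < H" "H < 1" and T: "0 < T"
    and \<sigma>: "\<And>s. s \<in> {0..T} \<Longrightarrow> (\<sigma> has_vector_derivative \<sigma>' s) (at s within {0..T})"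
    and \<sigma>'c: "continuous_on {0..T} \<sigma>'"
    and m: "0 < m" "\<And>s i. s \<in> {0..T} \<Longrightarrow> m \<le> \<sigma> s $ i"
begin

lemma H0: "0 < H"
  using H by simp

lemma \<sigma>_continuous: "continuous_on {0..T} \<sigma>"
  using \<sigma> by (meson continuous_on_eq_continuous_within has_vector_derivative_continuous)

lemma K_sigma_eq:
  assumes u: "u \<in> L2 T" and t: "t \<in> {0..T}"
  shows "K_sigma_op H \<sigma> u t = hadamard (\<sigma> t) (K_op H u t) - integral {0..t} (\<lambda>s. hadamard (\<sigma>' s) (K_op H u s))"
proof -
  have "has_young_integral (\<lambda>s. diag_mat (\<sigma> s)) (K_op H u) 0 t
    (hadamard (\<sigma> t) (K_op H u t) - hadamard (\<sigma> 0) (K_op H u 0) - integral {0..t} (\<lambda>s. hadamard (\<sigma>' s) (K_op H u s)))"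
    by (rule has_young_integral_C1[OF \<sigma> \<sigma>'c K_op_continuous[OF H0 H(2) u]]) (use t T in auto)
  \<comment> \<open>Removes the boundary term at 0 from the integration by parts.\<close>
  moreover have "K_op H u 0 = 0" unfolding K_op_def by (rule LINT_singleton)
  ultimately show ?thesis
    unfolding K_sigma_op_def by (simp add: young_integral_eq hadamard.zero_right)
qed

lemma hadamard_K_op_integrable:
  assumes u: "u \<in> L2 T" and t: "t \<in> {0..T}"
  shows "(\<lambda>s. hadamard (\<sigma>' s) (K_op H u s)) integrable_on {0..t}"
  by (intro integrable_continuous_real hadamard.continuous_on continuous_on_subset[OF \<sigma>'c]
       continuous_on_subset[OF K_op_continuous[OF H0 H(2) u]]) (use t T in auto)

lemma K_sigma_diff:
  assumes u: "u \<in> L2 T" and v: "v \<in> L2 T" and t: "t \<in> {0..T}"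
  shows "K_sigma_op H \<sigma> (\<lambda>t. u t - v t) t = K_sigma_op H \<sigma> u t - K_sigma_op H \<sigma> v t"
proof -
  have "integral {0..t} (\<lambda>s. hadamard (\<sigma>' s) (K_op H (\<lambda>t. u t - v t) s))
     = integral {0..t} (\<lambda>s. hadamard (\<sigma>' s) (K_op H u s) - hadamard (\<sigma>' s) (K_op H v s))"
    by (intro Henstock_Kurzweil_Integration.integral_cong)
       (use t in \<open>auto simp: K_op_diff[OF H0 H(2) u v] hadamard.diff_right\<close>)
  also have "\<dots> = integral {0..t} (\<lambda>s. hadamard (\<sigma>' s) (K_op H u s)) - integral {0..t} (\<lambda>s. hadamard (\<sigma>' s) (K_op H v s))"
    by (intro Henstock_Kurzweil_Integration.integral_diff hadamard_K_op_integrable u v t)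
  finally show ?thesis
    unfolding K_sigma_eq[OF L2_diff[OF u v] t] K_sigma_eq[OF u t] K_sigma_eq[OF v t] K_op_diff[OF H0 H(2) u v t]
    by (simp add: hadamard.diff_right)
qed

lemma integral_hadamard_bound:
  assumes S: "\<And>s. s \<in> {0..T} \<Longrightarrow> norm (\<sigma>' s) \<le> S" and u: "u \<in> L2 T" and t: "t \<in> {0..T}"
  shows "norm (integral {0..t} (\<lambda>s. hadamard (\<sigma>' s) (K_op H u s))) \<le> S * integral {0..t} (\<lambda>s. norm (K_op H u s))"
proof -
  have c: "continuous_on {0..t} (\<lambda>s. norm (K_op H u s))"
    by (intro continuous_intros continuous_on_subset[OF K_op_continuous[OF H0 H(2) u]]) (use t T in auto)
  have "norm (integral {0..t} (\<lambda>s. hadamard (\<sigma>' s) (K_op H u s))) \<le> integral {0..t} (\<lambda>s. S * norm (K_op H u s))"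
  proof (rule integral_norm_bound_integral)
    show "(\<lambda>s. S * norm (K_op H u s)) integrable_on {0..t}"
      by (intro integrable_continuous_real continuous_intros c)
    show "norm (hadamard (\<sigma>' s) (K_op H u s)) \<le> S * norm (K_op H u s)" if "s \<in> {0..t}" for s
      by (rule order_trans[OF norm_hadamard]) (use S[of s] that t in \<open>auto intro: mult_right_mono\<close>)
  qed (rule hadamard_K_op_integrable[OF u t])
  then show ?thesis by simp
qed

lemma K_sigma_bound:
  "\<exists>C\<ge>0. \<forall>u\<in>L2 T. \<forall>t\<in>{0..T}. norm (K_sigma_op H \<sigma> u t) \<le> C * L2_norm_on T u"
proof -
  obtain C where C: "0 \<le> C" "\<And>u t. (u::real \<Rightarrow> real^'n) \<in> L2 T \<Longrightarrow> t \<in> {0..T} \<Longrightarrow> norm (K_op H u t) \<le> C * L2_norm_on T u"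
    using K_op_bound[OF H0 H(2) T, where ?'n = 'n] by blast
  obtain S where S: "0 \<le> S" "\<forall>s\<in>{0..T}. norm (\<sigma> s) \<le> S" using compact_norm_bound[OF \<sigma>_continuous] by blast
  obtain S' where S': "0 \<le> S'" "\<forall>s\<in>{0..T}. norm (\<sigma>' s) \<le> S'" using compact_norm_bound[OF \<sigma>'c] by blast
  have "norm (K_sigma_op H \<sigma> u t) \<le> (S * C + S' * (T * C)) * L2_norm_on T u" if u: "u \<in> L2 T" and t: "t \<in> {0..T}" for u t
  proof -
    let ?N = "L2_norm_on T u"
    have N: "0 \<le> ?N" by (rule L2_norm_on_nonneg)
    have "integral {0..t} (\<lambda>s. norm (K_op H u s)) \<le> integral {0..t} (\<lambda>s. C * ?N)"
      by (intro integral_le integrable_continuous_real continuous_intros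
           continuous_on_subset[OF K_op_continuous[OF H0 H(2) u]] C(2) u) (use t T in auto)
    also have "\<dots> = t * (C * ?N)" using t by simp
    also have "\<dots> \<le> T * (C * ?N)" using t C N by (intro mult_right_mono) auto
    finally have i: "integral {0..t} (\<lambda>s. norm (K_op H u s)) \<le> T * (C * ?N)" .
    have "norm (K_sigma_op H \<sigma> u t) \<le> norm (hadamard (\<sigma> t) (K_op H u t)) + norm (integral {0..t} (\<lambda>s. hadamard (\<sigma>' s) (K_op H u s)))"
      unfolding K_sigma_eq[OF u t] by (rule norm_triangle_ineq4)
    also have "\<dots> \<le> S * (C * ?N) + S' * (T * (C * ?N))"
    proof (intro add_mono)
      show "norm (hadamard (\<sigma> t) (K_op H u t)) \<le> S * (C * ?N)"
        by (rule order_trans[OF norm_hadamard mult_mono]) (use S C u t in auto)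
      show "norm (integral {0..t} (\<lambda>s. hadamard (\<sigma>' s) (K_op H u s))) \<le> S' * (T * (C * ?N))"
        using integral_hadamard_bound[OF _ u t, of S'] S' mult_left_mono[OF i S'(1)] by auto
    qed
    finally show ?thesis by (simp add: algebra_simps)
  qed
  moreover have "0 \<le> S * C + S' * (T * C)" using S S' C T by simp
  ultimately show ?thesis by blast
qed

lemma norm_hadamard_ge:
  assumes t: "t \<in> {0..T}"
  shows "m * norm x \<le> norm (hadamard (\<sigma> t) x)"
proof -
  have "(m * norm x)\<^sup>2 = (\<Sum>i\<in>UNIV. m\<^sup>2 * (x $ i)\<^sup>2)"
    unfolding power_mult_distrib power2_norm_eq_inner[of x]
    by (simp add: inner_vec_def power2_eq_square sum_distrib_left)
  also have "\<dots> \<le> (\<Sum>i\<in>UNIV. (\<sigma> t $ i)\<^sup>2 * (x $ i)\<^sup>2)"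
    using m t by (intro sum_mono mult_right_mono power_mono) auto
  also have "\<dots> = (norm (hadamard (\<sigma> t) x))\<^sup>2"
    unfolding power2_norm_eq_inner by (simp add: inner_vec_def hadamard_def power2_eq_square mult_ac)
  finally show ?thesis by (rule power2_le_imp_le) simp
qed

text \<open>A vanishing image says \<sigma> g = \<integral> \<sigma>' g for g =
  \<open>K_op H u\<close>, a homogeneous Volterra equation. As the entries of
  \<open>\<sigma>\<close> are at least \<open>m\<close>, Gronwall's lemma with constant 0 gives g =
  0, and injectivity of \<open>K_op\<close> applies.\<close>

lemma K_sigma_injective:
  assumes u: "u \<in> L2 T" and z: "\<And>t. t \<in> {0..T} \<Longrightarrow> K_sigma_op H \<sigma> u t = 0"
  shows "AE t in lborel. t \<in> {0..T} \<longrightarrow> u t = 0"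
proof (rule K_op_injective[OF H T u])
  obtain S where S: "0 \<le> S" "\<forall>s\<in>{0..T}. norm (\<sigma>' s) \<le> S" using compact_norm_bound[OF \<sigma>'c] by blast
  fix t assume t: "t \<in> {0..T}"
  have "norm (K_op H u t) \<le> 0 * exp (S / m * t)"
  proof (rule gronwall[where y = "\<lambda>t. norm (K_op H u t)" and T = T])
    show "continuous_on {0..T} (\<lambda>t. norm (K_op H u t))"
      using K_op_continuous[OF H0 H(2) u] T by (intro continuous_intros) auto
    fix t assume t: "t \<in> {0..T}"
    have "m * norm (K_op H u t) \<le> norm (hadamard (\<sigma> t) (K_op H u t))" by (rule norm_hadamard_ge[OF t])
    also have "\<dots> \<le> S * integral {0..t} (\<lambda>s. norm (K_op H u s))"
      using z[OF t] integral_hadamard_bound[OF _ u t, of S] S by (simp add: K_sigma_eq[OF u t])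
    finally show "norm (K_op H u t) \<le> 0 + S / m * integral {0..t} (\<lambda>t. norm (K_op H u t))"
      using m by (simp add: field_simps)
  qed (use S m t in auto)
  then show "K_op H u t = 0" by simp
qed

lemma K_sigma_continuous:
  assumes u: "u \<in> L2 T"
  shows "continuous_on {0..T} (K_sigma_op H \<sigma> u)"
proof -
  have "continuous_on {0..T} (\<lambda>t. hadamard (\<sigma> t) (K_op H u t) - integral {0..t} (\<lambda>s. hadamard (\<sigma>' s) (K_op H u s)))"
    by (intro continuous_intros hadamard.continuous_on \<sigma>_continuous K_op_continuous H0 H u
         indefinite_integral_continuous_1 hadamard_K_op_integrable) (use T in auto)
  then show ?thesis by (rule continuous_on_eq) (simp add: K_sigma_eq[OF u])
qed

lemma K_sigma_Hoelder:
  assumes H2: "1/2 < H" and u: "u \<in> L2 T"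
  shows "\<exists>C. \<forall>s t. 0 \<le> s \<longrightarrow> s < t \<longrightarrow> t \<le> T \<longrightarrow> norm (K_sigma_op H \<sigma> u t - K_sigma_op H \<sigma> u s) \<le> C * sqrt (t - s)"
proof -
  let ?g = "K_op H u"
  obtain C where C: "\<And>s t. 0 \<le> s \<Longrightarrow> s < t \<Longrightarrow> t \<le> T \<Longrightarrow> norm (?g t - ?g s) \<le> C * sqrt (t - s)"
    using K_op_Hoelder[OF H2 H(2) T u] by blast
  obtain S where S: "0 \<le> S" "\<forall>s\<in>{0..T}. norm (\<sigma> s) \<le> S" using compact_norm_bound[OF \<sigma>_continuous] by blast
  obtain S' where S': "0 \<le> S'" "\<forall>s\<in>{0..T}. norm (\<sigma>' s) \<le> S'" using compact_norm_bound[OF \<sigma>'c] by blast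
  obtain G where G: "0 \<le> G" "\<forall>s\<in>{0..T}. norm (?g s) \<le> G"
    using compact_norm_bound[OF K_op_continuous[OF H0 H(2) u]] T by auto
  have "norm (K_sigma_op H \<sigma> u t - K_sigma_op H \<sigma> u s) \<le> (S * C + S' * (2 * G) * sqrt T) * sqrt (t - s)"
    if st: "0 \<le> s" "s < t" "t \<le> T" for s t
  proof -
    define h where "h r = hadamard (\<sigma>' r) (?g r)" for r
    have I: "integral {0..t} h = integral {0..s} h + integral {s..t} h"
      by (rule Henstock_Kurzweil_Integration.integral_combine[symmetric])
         (use st hadamard_K_op_integrable[OF u, of t] in \<open>auto simp: h_def[abs_def]\<close>)
    \<comment> \<open>The crude oscillation bound \<open>2 * G\<close> suffices, since it is
      multiplied by the length \<open>t - s\<close>.\<close>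
    have inc: "norm (hadamard (\<sigma> t - \<sigma> s) (?g t) - integral {s..t} h) \<le> S' * (2 * G) * (t - s)"
      unfolding h_def
    proof (rule hadamard_increment_bound[OF \<sigma> \<sigma>'c _ K_op_continuous[OF H0 H(2) u]])
      fix r assume r: "r \<in> {s..t}"
      have "norm (?g t - ?g r) \<le> norm (?g t) + norm (?g r)" by (rule norm_triangle_ineq4)
      also have "\<dots> \<le> G + G" using G r st by (intro add_mono) auto
      finally show "norm (?g t - ?g r) \<le> 2 * G" by simp
    qed (use S' st T in auto)
    have "K_sigma_op H \<sigma> u t - K_sigma_op H \<sigma> u s
        = (hadamard (\<sigma> t - \<sigma> s) (?g t) - integral {s..t} h) + hadamard (\<sigma> s) (?g t - ?g s)"
      using st I by (simp add: K_sigma_eq[OF u] h_def[abs_def] hadamard.diff_left hadamard.diff_right)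
    also have "norm \<dots> \<le> S' * (2 * G) * (t - s) + S * (C * sqrt (t - s))"
    proof (rule norm_triangle_le, rule add_mono[OF inc])
      show "norm (hadamard (\<sigma> s) (?g t - ?g s)) \<le> S * (C * sqrt (t - s))"
        by (rule order_trans[OF norm_hadamard mult_mono]) (use S C[OF st] st in auto)
    qed
    also have "S' * (2 * G) * (t - s) \<le> S' * (2 * G) * (sqrt T * sqrt (t - s))"
      using S' G st by (intro mult_left_mono linear_le_sqrt) auto
    finally show ?thesis by (simp add: algebra_simps)
  qed
  then show ?thesis by blast
qed

text \<open>Dividing by \<open>\<sigma>\<close> reduces the problem to \<open>K_op\<close>: if g is
  a primitive of f with \<sigma> f = \<beta>, the product rule gives \<sigma> g - \<integral>
  \<sigma>' g = \<integral> \<beta>. The reciprocal of \<open>\<sigma>\<close> is Lipschitz by its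
  lower bound, so f inherits the Hoelder condition.\<close>

lemma K_sigma_range:
  fixes \<beta> :: "real \<Rightarrow> real^'n"
  assumes \<beta>: "continuous_on {0..T} \<beta>"
    and H\<beta>: "1/2 < H \<Longrightarrow> \<exists>C. \<forall>s t. 0 \<le> s \<longrightarrow> s < t \<longrightarrow> t \<le> T \<longrightarrow> norm (\<beta> t - \<beta> s) \<le> C * sqrt (t - s)"
  shows "\<exists>u\<in>L2 T. \<forall>t\<in>{0..T}. K_sigma_op H \<sigma> u t = integral {0..t} \<beta>"
proof -
  define \<iota> where "\<iota> s = (\<chi> i. 1 / \<sigma> s $ i)" for s
  define f where "f s = hadamard (\<iota> s) (\<beta> s)" for s
  have ne: "\<sigma> s $ i \<noteq> 0" if "s \<in> {0..T}" for s i using m(1) m(2)[OF that, of i] by auto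
  have \<iota>c: "continuous_on {0..T} \<iota>"
    unfolding \<iota>_def by (intro continuous_intros \<sigma>_continuous) (use ne in auto)
  have fc: "continuous_on {0..T} f"
    unfolding f_def by (intro hadamard.continuous_on \<iota>c \<beta>)
  have \<sigma>f: "hadamard (\<sigma> s) (f s) = \<beta> s" if "s \<in> {0..T}" for s
    using ne[OF that] by (simp add: f_def \<iota>_def hadamard_def vec_eq_iff)
  have "\<exists>u\<in>L2 T. \<forall>t\<in>{0..T}. K_op H u t = integral {0..t} f"
  proof (rule K_op_range[OF H0 H(2) T fc])
    assume H2: "1/2 < H"
    obtain C where C: "\<And>s t. 0 \<le> s \<Longrightarrow> s < t \<Longrightarrow> t \<le> T \<Longrightarrow> norm (\<beta> t - \<beta> s) \<le> C * sqrt (t - s)"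
      using H\<beta>[OF H2] by blast
    obtain S where S: "0 \<le> S" "\<forall>s\<in>{0..T}. norm (\<sigma>' s) \<le> S" using compact_norm_bound[OF \<sigma>'c] by blast
    obtain I where I: "0 \<le> I" "\<forall>s\<in>{0..T}. norm (\<iota> s) \<le> I" using compact_norm_bound[OF \<iota>c] by blast
    obtain B where B: "0 \<le> B" "\<forall>s\<in>{0..T}. norm (\<beta> s) \<le> B" using compact_norm_bound[OF \<beta>] by blast
    show "\<exists>C. \<forall>s t. 0 \<le> s \<longrightarrow> s < t \<longrightarrow> t \<le> T \<longrightarrow> norm (f t - f s) \<le> C * sqrt (t - s)"
    proof (intro exI allI impI)
      fix s t assume st: "0 \<le> s" "s < t" "t \<le> T"
      have "\<iota> t - \<iota> s = hadamard (hadamard (\<iota> t) (\<iota> s)) (\<sigma> s - \<sigma> t)"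
        using ne[of s] ne[of t] st by (simp add: \<iota>_def hadamard_def vec_eq_iff field_simps)
      also have "norm \<dots> \<le> (I * I) * (S * (t - s))"
      proof (rule order_trans[OF norm_hadamard mult_mono])
        show "norm (hadamard (\<iota> t) (\<iota> s)) \<le> I * I"
          by (rule order_trans[OF norm_hadamard mult_mono]) (use I st in auto)
        show "norm (\<sigma> s - \<sigma> t) \<le> S * (t - s)"
          using norm_increment_le[OF \<sigma>, of S s t] S st by (simp add: norm_minus_commute)
      qed (use I in auto)
      also have "\<dots> \<le> (I * I) * (S * (sqrt T * sqrt (t - s)))"
        using S I st by (intro mult_left_mono linear_le_sqrt) auto
      finally have d\<iota>: "norm (\<iota> t - \<iota> s) \<le> (I * I) * (S * (sqrt T * sqrt (t - s)))" .
      have "f t - f s = hadamard (\<iota> t) (\<beta> t - \<beta> s) + hadamard (\<iota> t - \<iota> s) (\<beta> s)"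
        by (simp add: f_def hadamard.diff_left hadamard.diff_right)
      also have "norm \<dots> \<le> I * (C * sqrt (t - s)) + (I * I) * (S * (sqrt T * sqrt (t - s))) * B"
      proof (rule norm_triangle_le, rule add_mono)
        show "norm (hadamard (\<iota> t) (\<beta> t - \<beta> s)) \<le> I * (C * sqrt (t - s))"
          by (rule order_trans[OF norm_hadamard mult_mono]) (use I C[OF st] st in auto)
        show "norm (hadamard (\<iota> t - \<iota> s) (\<beta> s)) \<le> (I * I) * (S * (sqrt T * sqrt (t - s))) * B"
          by (rule order_trans[OF norm_hadamard mult_mono[OF d\<iota>]]) (use I S B T st in auto)
      qed
      finally show "norm (f t - f s) \<le> (I * C + I * I * S * sqrt T * B) * sqrt (t - s)"
        by (simp add: algebra_simps)
    qed
  qed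
  then obtain u where u: "u \<in> L2 T" "\<And>t. t \<in> {0..T} \<Longrightarrow> K_op H u t = integral {0..t} f" by blast
  have "K_sigma_op H \<sigma> u t = integral {0..t} \<beta>" if t: "t \<in> {0..T}" for t
  proof -
    define g where "g s = integral {0..s} f" for s
    have sub: "{0..t} \<subseteq> {0..T}" using t by auto
    have "((\<lambda>s. hadamard (\<sigma> s) (f s) + hadamard (\<sigma>' s) (g s)) has_integral hadamard (\<sigma> t) (g t) - hadamard (\<sigma> 0) (g 0)) {0..t}"
    proof (rule fundamental_theorem_of_calculus)
      fix s assume s: "s \<in> {0..t}"
      then have sT: "s \<in> {0..T}" using sub by auto
      have "(g has_vector_derivative f s) (at s within {0..T})"
        unfolding g_def[abs_def] by (rule integral_has_vector_derivative[OF fc sT])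
      then have "((\<lambda>s. hadamard (\<sigma> s) (g s)) has_vector_derivative (hadamard (\<sigma> s) (f s) + hadamard (\<sigma>' s) (g s))) (at s within {0..T})"
        by (rule hadamard.has_vector_derivative[OF \<sigma>[OF sT]])
      then show "((\<lambda>s. hadamard (\<sigma> s) (g s)) has_vector_derivative (hadamard (\<sigma> s) (f s) + hadamard (\<sigma>' s) (g s))) (at s within {0..t})"
        by (rule has_vector_derivative_within_subset[OF _ sub])
    qed (use t in simp)
    moreover have "g 0 = 0" by (simp add: g_def)
    ultimately have "hadamard (\<sigma> t) (g t) = integral {0..t} (\<lambda>s. hadamard (\<sigma> s) (f s) + hadamard (\<sigma>' s) (g s))"
      by (simp add: integral_unique hadamard.zero_right)
    also have "\<dots> = integral {0..t} (\<lambda>s. \<beta> s + hadamard (\<sigma>' s) (K_op H u s))"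
      by (intro Henstock_Kurzweil_Integration.integral_cong) (use sub \<sigma>f u(2) in \<open>auto simp: g_def\<close>)
    also have "\<dots> = integral {0..t} \<beta> + integral {0..t} (\<lambda>s. hadamard (\<sigma>' s) (K_op H u s))"
      by (intro Henstock_Kurzweil_Integration.integral_add hadamard_K_op_integrable u(1) t
           integrable_continuous_real continuous_on_subset[OF \<beta> sub])
    finally show ?thesis
      by (simp add: K_sigma_eq[OF u(1) t] u(2)[OF t] g_def)
  qed
  with u(1) show ?thesis by blast
qed

section \<open>The functional near the flow\<close>

context
  fixes b :: "real \<Rightarrow> real^'n \<Rightarrow> real^'n"
  assumes b: "Cb_1_3 T b"
begin

lemma Cb_1_3_space: "Cb_space (Suc (Suc (Suc 0))) T b"
  using b by (simp only: Cb_1_3_def numeral_3_eq_3)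

lemma drift_along_continuous:
  assumes "continuous_on {0..T} \<phi>"
  shows "continuous_on {0..T} (\<lambda>t. b t (\<phi> t))"
  by (rule Cb_joint_along[OF Cb_space_imp_joint[OF Cb_1_3_space] assms])

lemma drift_in_range:
  assumes \<phi>: "continuous_on {0..T} \<phi>"
    and H\<phi>: "1/2 < H \<Longrightarrow> \<exists>C. \<forall>s t. 0 \<le> s \<longrightarrow> s < t \<longrightarrow> t \<le> T \<longrightarrow> norm (\<phi> t - \<phi> s) \<le> C * sqrt (t - s)"
  shows "\<exists>w\<in>L2 T. \<forall>t\<in>{0..T}. K_sigma_op H \<sigma> w t = integral {0..t} (\<lambda>s. b s (\<phi> s))"
  by (rule K_sigma_range[OF drift_along_continuous[OF \<phi>] Cb_1_3_along_Hoelder[OF b H\<phi>]])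

text \<open>Gives content to the choice in \<open>K_sigma_inv\<close>: the path minus
  \<open>x0\<close> is an image by membership, the drift integral is one by the range statement, and
  the operator respects differences.\<close>

lemma residual_in_range:
  assumes \<phi>: "\<phi> \<in> affine_CM T H \<sigma> x0"
  defines "u \<equiv> K_sigma_inv T H \<sigma> (\<lambda>t. \<phi> t - x0 - (LINT s:{0..t}|lborel. b s (\<phi> s)))"
  shows "continuous_on {0..T} \<phi>" "u \<in> L2 T"
    "\<And>t. t \<in> {0..T} \<Longrightarrow> K_sigma_op H \<sigma> u t = \<phi> t - x0 - integral {0..t} (\<lambda>s. b s (\<phi> s))"
proof -
  obtain v where v: "v \<in> L2 T" "\<And>t. t \<in> {0..T} \<Longrightarrow> \<phi> t - x0 = K_sigma_op H \<sigma> v t"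
    using \<phi> unfolding affine_CM_def CM_space_def by auto
  have \<phi>v: "\<phi> t = x0 + K_sigma_op H \<sigma> v t" if "t \<in> {0..T}" for t
    using v(2)[OF that] by (simp add: algebra_simps)
  have "continuous_on {0..T} (\<lambda>t. x0 + K_sigma_op H \<sigma> v t)"
    by (intro continuous_intros K_sigma_continuous v)
  then show c: "continuous_on {0..T} \<phi>"
    by (rule continuous_on_eq) (simp add: \<phi>v)
  have L: "(LINT s:{0..t}|lborel. b s (\<phi> s)) = integral {0..t} (\<lambda>s. b s (\<phi> s))" if "t \<in> {0..T}" for t
    by (rule LINT_eq_integral_Icc[OF drift_along_continuous[OF c] that])
  have "\<exists>w\<in>L2 T. \<forall>t\<in>{0..T}. K_sigma_op H \<sigma> w t = integral {0..t} (\<lambda>s. b s (\<phi> s))"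
  proof (rule drift_in_range[OF c])
    assume "1/2 < H"
    then obtain C where "\<forall>s t. 0 \<le> s \<longrightarrow> s < t \<longrightarrow> t \<le> T \<longrightarrow> norm (K_sigma_op H \<sigma> v t - K_sigma_op H \<sigma> v s) \<le> C * sqrt (t - s)"
      using K_sigma_Hoelder v(1) by blast
    then show "\<exists>C. \<forall>s t. 0 \<le> s \<longrightarrow> s < t \<longrightarrow> t \<le> T \<longrightarrow> norm (\<phi> t - \<phi> s) \<le> C * sqrt (t - s)"
      by (intro exI[of _ C]) (simp add: \<phi>v)
  qed
  then obtain w where w: "w \<in> L2 T" "\<And>t. t \<in> {0..T} \<Longrightarrow> K_sigma_op H \<sigma> w t = integral {0..t} (\<lambda>s. b s (\<phi> s))" by blast
  \<comment> \<open>The witness is the preimage of the path minus the preimage of its drift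
    integral.\<close>
  have "\<exists>u. u \<in> L2 T \<and> (\<forall>t\<in>{0..T}. \<phi> t - x0 - (LINT s:{0..t}|lborel. b s (\<phi> s)) = K_sigma_op H \<sigma> u t)"
    by (rule exI[of _ "\<lambda>t. v t - w t"]) (auto simp: L2_diff v w K_sigma_diff L)
  then have "u \<in> L2 T \<and> (\<forall>t\<in>{0..T}. \<phi> t - x0 - (LINT s:{0..t}|lborel. b s (\<phi> s)) = K_sigma_op H \<sigma> u t)"
    unfolding u_def K_sigma_inv_def by (rule someI_ex)
  then show "u \<in> L2 T" "\<And>t. t \<in> {0..T} \<Longrightarrow> K_sigma_op H \<sigma> u t = \<phi> t - x0 - integral {0..t} (\<lambda>s. b s (\<phi> s))"
    by (auto simp: L)
qed

section \<open>The flow as a competitor\<close>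

context
  fixes X :: "real \<Rightarrow> real^'n"
  assumes X: "\<And>t. t \<in> {0..T} \<Longrightarrow> (X has_vector_derivative b t (X t)) (at t within {0..T})"
begin

lemma flow_continuous: "continuous_on {0..T} X"
  using X by (meson continuous_on_eq_continuous_within has_vector_derivative_continuous)

lemma flow_eq:
  assumes t: "t \<in> {0..T}"
  shows "X t = X 0 + integral {0..t} (\<lambda>s. b s (X s))"
proof -
  have "((\<lambda>s. b s (X s)) has_integral X t - X 0) {0..t}"
  proof (rule fundamental_theorem_of_calculus)
    show "(X has_vector_derivative b s (X s)) (at s within {0..t})" if "s \<in> {0..t}" for s
      by (rule has_vector_derivative_within_subset[OF X]) (use that t in auto)
  qed (use t in simp)
  then show ?thesis by (simp add: integral_unique)
qed

text \<open>\<open>X\<close> minus its initial value is its own drift integral, and \<open>X\<close>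
  is Lipschitz, so the range statement applies to it.\<close>

lemma flow_in_affine_CM: "X \<in> affine_CM T H \<sigma> (X 0)"
proof -
  obtain B where B: "0 \<le> B" "\<forall>t\<in>{0..T}. norm (b t (X t)) \<le> B"
    using compact_norm_bound[OF drift_along_continuous[OF flow_continuous]] by blast
  have "norm (X t - X s) \<le> B * sqrt T * sqrt (t - s)" if st: "0 \<le> s" "s < t" "t \<le> T" for s t
  proof -
    have "norm (X t - X s) \<le> B * (t - s)"
      by (rule norm_increment_le[OF X]) (use B st in auto)
    also have "\<dots> \<le> B * (sqrt T * sqrt (t - s))"
      by (intro mult_left_mono linear_le_sqrt) (use B st in auto)
    finally show ?thesis by (simp add: mult.assoc)
  qed
  then have "\<exists>w\<in>L2 T. \<forall>t\<in>{0..T}. K_sigma_op H \<sigma> w t = integral {0..t} (\<lambda>s. b s (X s))"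
    by (intro drift_in_range[OF flow_continuous]) blast
  then obtain w where w: "w \<in> L2 T" "\<And>t. t \<in> {0..T} \<Longrightarrow> K_sigma_op H \<sigma> w t = integral {0..t} (\<lambda>s. b s (X s))"
    by blast
  have "X t - X 0 = K_sigma_op H \<sigma> w t" if t: "t \<in> {0..T}" for t
    unfolding w(2)[OF t] by (subst flow_eq[OF t]) simp
  with w(1) show ?thesis
    unfolding affine_CM_def CM_space_def by blast
qed

text \<open>The residual of the flow is 0, but \<open>K_sigma_inv\<close> could return any preimage
  of 0; injectivity makes each of them vanish almost everywhere, so the energy is 0.\<close>

lemma J_functional_flow:
  "J_functional T H b \<sigma> (X 0) \<epsilon> X = d_const H / 2 * integral {0..T} (\<lambda>t. divergence (b t) (X t))"
proof -
  define u where "u = K_sigma_inv T H \<sigma> (\<lambda>t. X t - X 0 - (LINT s:{0..t}|lborel. b s (X s)))"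
  note u = residual_in_range[OF flow_in_affine_CM, folded u_def]
  have "AE t in lborel. t \<in> {0..T} \<longrightarrow> u t = 0"
  proof (rule K_sigma_injective[OF u(2)])
    show "K_sigma_op H \<sigma> u t = 0" if t: "t \<in> {0..T}" for t
      unfolding u(3)[OF t] by (subst flow_eq[OF t]) simp
  qed
  then have zero: "AE t in lborel. indicator {0..T} t *\<^sub>R (norm (u t))\<^sup>2 = 0"
    by eventually_elim (auto simp: indicator_def)
  have "(LINT t:{0..T}|lborel. (norm (u t))\<^sup>2) = 0"
    unfolding set_lebesgue_integral_def by (rule integral_eq_zero_AE[OF zero])
  then show ?thesis
    using T by (simp add: J_functional_def u_def[symmetric]
       LINT_eq_integral_Icc[OF divergence_along_continuous[OF Cb_1_3_space flow_continuous]])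
qed

text \<open>Subtracting the flow equation leaves the image of the residual control and a Lipschitz
  drift difference. The former is bounded uniformly in \<open>t\<close> by the L2 norm of the
  control, which becomes the constant in Gronwall's lemma.\<close>

lemma distance_to_flow_bound:
  "\<exists>C. \<forall>\<phi>\<in>affine_CM T H \<sigma> (X 0). \<forall>t\<in>{0..T}. norm (\<phi> t - X t) \<le>
     C * L2_norm_on T (K_sigma_inv T H \<sigma> (\<lambda>t. \<phi> t - X 0 - (LINT s:{0..t}|lborel. b s (\<phi> s))))"
proof -
  obtain C where C: "0 \<le> C" "\<And>u t. u \<in> L2 T \<Longrightarrow> t \<in> {0..T} \<Longrightarrow> norm (K_sigma_op H \<sigma> u t) \<le> C * L2_norm_on T u"
    using K_sigma_bound by blast
  obtain L where L: "0 \<le> L" "\<And>t x y. t \<in> {0..T} \<Longrightarrow> norm (b t x - b t y) \<le> L * norm (x - y)"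
    using Cb_space_Lipschitz[OF Cb_1_3_space] by blast
  have "norm (\<phi> t - X t) \<le> C * exp (L * T) *
     L2_norm_on T (K_sigma_inv T H \<sigma> (\<lambda>t. \<phi> t - X 0 - (LINT s:{0..t}|lborel. b s (\<phi> s))))"
    if \<phi>: "\<phi> \<in> affine_CM T H \<sigma> (X 0)" and t: "t \<in> {0..T}" for \<phi> t
  proof -
    define u where "u = K_sigma_inv T H \<sigma> (\<lambda>t. \<phi> t - X 0 - (LINT s:{0..t}|lborel. b s (\<phi> s)))"
    note u = residual_in_range[OF \<phi>, folded u_def]
    let ?N = "L2_norm_on T u"
    have dc: "continuous_on {0..T} (\<lambda>t. norm (\<phi> t - X t))"
      by (intro continuous_intros u(1) flow_continuous)
    have "norm (\<phi> t - X t) \<le> (C * ?N) * exp (L * t)"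
    proof (rule gronwall[OF dc L(1) _ t])
      fix t assume t: "t \<in> {0..T}"
      then have sub: "{0..t} \<subseteq> {0..T}" by auto
      have i: "(\<lambda>s. b s (\<phi> s)) integrable_on {0..t}" "(\<lambda>s. b s (X s)) integrable_on {0..t}"
        by (intro integrable_continuous_real continuous_on_subset[OF drift_along_continuous sub] u(1) flow_continuous)+
      have "\<phi> t - X t = K_sigma_op H \<sigma> u t + integral {0..t} (\<lambda>s. b s (\<phi> s) - b s (X s))"
        using flow_eq[OF t] u(3)[OF t] Henstock_Kurzweil_Integration.integral_diff[OF i]
        by (simp add: algebra_simps)
      also have "norm \<dots> \<le> C * ?N + integral {0..t} (\<lambda>s. L * norm (\<phi> s - X s))"
      proof (rule norm_triangle_le, rule add_mono[OF C(2)[OF u(2) t]], rule integral_norm_bound_integral)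
        show "(\<lambda>s. L * norm (\<phi> s - X s)) integrable_on {0..t}"
          by (intro integrable_continuous_real continuous_intros continuous_on_subset[OF dc sub])
      qed (use L sub i in \<open>auto intro: Henstock_Kurzweil_Integration.integrable_diff\<close>)
      finally show "norm (\<phi> t - X t) \<le> C * ?N + L * integral {0..t} (\<lambda>s. norm (\<phi> s - X s))" by simp
    qed
    also have "\<dots> \<le> (C * ?N) * exp (L * T)"
      using t L C by (intro mult_left_mono mult_nonneg_nonneg L2_norm_on_nonneg) (auto intro: mult_left_mono)
    finally show ?thesis by (simp add: u_def mult_ac)
  qed
  then show ?thesis by blast
qed

text \<open>\<open>C\<close> and \<open>D\<close> are fixed before \<open>\<epsilon>\<close>, so
  small \<open>\<epsilon>\<close> can later be played against \<open>D\<close>. The witness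
  \<open>N\<close> is the L2 norm of the chosen preimage of the residual.\<close>

lemma J_functional_gap:
  assumes crit: "\<And>t. t \<in> {0..T} \<Longrightarrow> GDERIV (divergence (b t)) (X t) :> 0"
  shows "\<exists>C D. \<forall>\<epsilon>. \<forall>\<phi>\<in>affine_CM T H \<sigma> (X 0). \<exists>N.
     J_functional T H b \<sigma> (X 0) \<epsilon> X + (1 / (2 * \<epsilon>) - D) * N\<^sup>2 \<le> J_functional T H b \<sigma> (X 0) \<epsilon> \<phi> \<and>
     (\<forall>t\<in>{0..T}. norm (\<phi> t - X t) \<le> C * N)"
proof -
  obtain C where C: "\<And>\<phi> t. \<phi> \<in> affine_CM T H \<sigma> (X 0) \<Longrightarrow> t \<in> {0..T} \<Longrightarrow> norm (\<phi> t - X t) \<le>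
     C * L2_norm_on T (K_sigma_inv T H \<sigma> (\<lambda>t. \<phi> t - X 0 - (LINT s:{0..t}|lborel. b s (\<phi> s))))"
    using distance_to_flow_bound by blast
  obtain Q where Q: "0 \<le> Q" "\<And>t x y. t \<in> {0..T} \<Longrightarrow> GDERIV (divergence (b t)) x :> 0 \<Longrightarrow>
    \<bar>divergence (b t) y - divergence (b t) x\<bar> \<le> Q * (norm (y - x))\<^sup>2"
    using divergence_quadratic_at_critical[OF Cb_1_3_space] by blast
  \<comment> \<open>The divergence changes by at most \<open>Q * (C * N)\<^sup>2\<close> at each
    time; integration contributes \<open>T\<close>, and the coefficient of the second term of the
    functional contributes its absolute value.\<close>
  let ?D = "\<bar>d_const H / 2\<bar> * (T * (Q * C\<^sup>2))"
  have "J_functional T H b \<sigma> (X 0) \<epsilon> X + (1 / (2 * \<epsilon>) - ?D) * N\<^sup>2 \<le> J_functional T H b \<sigma> (X 0) \<epsilon> \<phi>"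
    if \<phi>: "\<phi> \<in> affine_CM T H \<sigma> (X 0)"
      and N: "N = L2_norm_on T (K_sigma_inv T H \<sigma> (\<lambda>t. \<phi> t - X 0 - (LINT s:{0..t}|lborel. b s (\<phi> s))))" for \<epsilon> \<phi> N
  proof -
    define \<delta> where "\<delta> = integral {0..T} (\<lambda>t. divergence (b t) (\<phi> t) - divergence (b t) (X t))"
    note c\<phi> = divergence_along_continuous[OF Cb_1_3_space residual_in_range(1)[OF \<phi>]]
    note cX = divergence_along_continuous[OF Cb_1_3_space flow_continuous]
    have energy: "(LINT t:{0..T}|lborel. (norm (K_sigma_inv T H \<sigma>
        (\<lambda>t. \<phi> t - X 0 - (LINT s:{0..t}|lborel. b s (\<phi> s))) t))\<^sup>2) = N\<^sup>2"
      unfolding N L2_norm_on_def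
      by (intro real_sqrt_pow2[symmetric]) (auto simp: set_lebesgue_integral_def intro!: integral_nonneg_AE)
    have "\<bar>\<delta>\<bar> \<le> integral {0..T} (\<lambda>t. Q * (C * N)\<^sup>2)"
      unfolding \<delta>_def real_norm_def[symmetric]
    proof (rule integral_norm_bound_integral)
      fix t assume t: "t \<in> {0..T}"
      have "Q * (norm (\<phi> t - X t))\<^sup>2 \<le> Q * (C * N)\<^sup>2"
        using C[OF \<phi> t] Q by (intro mult_left_mono power_mono) (auto simp: N)
      then show "norm (divergence (b t) (\<phi> t) - divergence (b t) (X t)) \<le> Q * (C * N)\<^sup>2"
        using Q(2)[OF t crit[OF t], of "\<phi> t"] by simp
    qed (intro integrable_continuous_real continuous_intros c\<phi> cX)+
    then have "\<bar>\<delta>\<bar> \<le> T * (Q * C\<^sup>2) * N\<^sup>2" using T by (simp add: power_mult_distrib mult_ac)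
    then have "\<bar>d_const H / 2\<bar> * \<bar>\<delta>\<bar> \<le> \<bar>d_const H / 2\<bar> * (T * (Q * C\<^sup>2) * N\<^sup>2)"
      by (rule mult_left_mono) simp
    then have "\<bar>d_const H / 2 * \<delta>\<bar> \<le> ?D * N\<^sup>2"
      by (simp only: abs_mult mult.assoc)
    then have le: "- (?D * N\<^sup>2) \<le> d_const H / 2 * \<delta>" by linarith
    have "integral {0..T} (\<lambda>t. divergence (b t) (\<phi> t)) = integral {0..T} (\<lambda>t. divergence (b t) (X t)) + \<delta>"
      unfolding \<delta>_def
      by (subst Henstock_Kurzweil_Integration.integral_diff) (auto intro!: integrable_continuous_real c\<phi> cX)
    then have "J_functional T H b \<sigma> (X 0) \<epsilon> \<phi> = J_functional T H b \<sigma> (X 0) \<epsilon> X + 1 / (2 * \<epsilon>) * N\<^sup>2 + d_const H / 2 * \<delta>"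
      using T unfolding J_functional_flow J_functional_def[of T H b \<sigma> "X 0" \<epsilon> \<phi>] energy
      by (simp add: LINT_eq_integral_Icc[OF c\<phi>] algebra_simps)
    with le show ?thesis by (simp only: left_diff_distrib)
  qed
  with C show ?thesis by blast
qed

end

end

end

section \<open>The threshold for \<epsilon>\<close>

theorem theorem4p10:
  fixes b :: "real \<Rightarrow> real^'n \<Rightarrow> real^'n"
    and \<sigma> :: "real \<Rightarrow> real^'n"
    and X :: "real \<Rightarrow> real^'n"
    and x0 :: "real^'n"
    and H T :: real
  assumes "1/4 < H" and "H < 1" and "0 < T"
    and "assumption_A T b \<sigma>"
    and "\<forall>t\<in>{0..T}. (X has_vector_derivative b t (X t)) (at t within {0..T})"
    and "X 0 = x0"
    and "\<forall>t\<in>{0..T}. GDERIV (divergence (b t)) (X t) :> 0"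
  shows "\<exists>\<epsilon>0>0. \<forall>\<epsilon>. 0 < \<epsilon> \<and> \<epsilon> < \<epsilon>0 \<longrightarrow>
           unique_minimizer T (J_functional T H b \<sigma> x0 \<epsilon>) (affine_CM T H \<sigma> x0) X \<and>
           unique_minimizer T (J_functional T H b \<sigma> x0 \<epsilon>) (affine_CM_bridge T H \<sigma> x0 (X T)) X"
proof -
  obtain \<sigma>' m where \<sigma>:
    "\<And>s. s \<in> {0..T} \<Longrightarrow> (\<sigma> has_vector_derivative \<sigma>' s) (at s within {0..T})"
    "continuous_on {0..T} \<sigma>'" "0 < m" "\<And>s i. s \<in> {0..T} \<Longrightarrow> m \<le> \<sigma> s $ i"
    using assumption_A_sigma[OF assms(4)] by blast
  have b: "Cb_1_3 T b" using assms(4) by (simp add: assumption_A_def)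
  have X: "\<And>t. t \<in> {0..T} \<Longrightarrow> (X has_vector_derivative b t (X t)) (at t within {0..T})"
    using assms(5) by blast
  have crit: "\<And>t. t \<in> {0..T} \<Longrightarrow> GDERIV (divergence (b t)) (X t) :> 0"
    using assms(7) by blast
  have XA: "X \<in> affine_CM T H \<sigma> x0"
    unfolding assms(6)[symmetric]
    by (rule flow_in_affine_CM[where \<sigma>' = \<sigma>' and m = m and b = b]; fact assms(1-3) \<sigma> b X)
  have "\<exists>C D. \<forall>\<epsilon>. \<forall>\<phi>\<in>affine_CM T H \<sigma> (X 0). \<exists>N.
     J_functional T H b \<sigma> (X 0) \<epsilon> X + (1 / (2 * \<epsilon>) - D) * N\<^sup>2 \<le> J_functional T H b \<sigma> (X 0) \<epsilon> \<phi> \<and>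
     (\<forall>t\<in>{0..T}. norm (\<phi> t - X t) \<le> C * N)"
    by (rule J_functional_gap[where \<sigma>' = \<sigma>' and m = m]; fact assms(1-3) \<sigma> b X crit)
  then obtain C D where gap: "\<And>\<epsilon> \<phi>. \<phi> \<in> affine_CM T H \<sigma> x0 \<Longrightarrow> \<exists>N.
     J_functional T H b \<sigma> x0 \<epsilon> X + (1 / (2 * \<epsilon>) - D) * N\<^sup>2 \<le> J_functional T H b \<sigma> x0 \<epsilon> \<phi> \<and>
     (\<forall>t\<in>{0..T}. norm (\<phi> t - X t) \<le> C * N)"
    unfolding assms(6) by blast
  \<comment> \<open>Below this value \<open>1 / (2 * \<epsilon>)\<close> exceeds
    \<open>\<bar>D\<bar> + 1\<close>, so the coefficient of \<open>N\<^sup>2\<close> in the gap is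
    positive; the summand 1 keeps the denominator nonzero when \<open>D = 0\<close>.\<close>
  let ?\<epsilon>0 = "1 / (2 * (\<bar>D\<bar> + 1))"
  show ?thesis
  proof (intro exI[of _ ?\<epsilon>0] conjI allI impI)
    fix \<epsilon> assume \<epsilon>: "0 < \<epsilon> \<and> \<epsilon> < ?\<epsilon>0"
    have "2 * (\<bar>D\<bar> + 1) * \<epsilon> < 1" using \<epsilon> by (simp add: field_simps)
    then have "\<bar>D\<bar> + 1 < 1 / (2 * \<epsilon>)" using \<epsilon> by (simp add: field_simps)
    then have k: "0 < 1 / (2 * \<epsilon>) - D" by linarith
    show "unique_minimizer T (J_functional T H b \<sigma> x0 \<epsilon>) (affine_CM T H \<sigma> x0) X"
      by (rule unique_minimizerI[OF XA gap k])
    \<comment> \<open>The bridge set is a subset of the affine space containing \<open>X\<close>, so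
      the gap and the threshold carry over.\<close>
    show "unique_minimizer T (J_functional T H b \<sigma> x0 \<epsilon>) (affine_CM_bridge T H \<sigma> x0 (X T)) X"
      by (rule unique_minimizerI[OF _ gap k]) (use XA in \<open>auto simp: affine_CM_bridge_def\<close>)
  qed simp
qed

end
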